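(* Let $n\geq 1$ be an integer and let $X$ be a simply-connected space with rational homology of finite type. Suppose that $B\mathrm{aut}_1(X)\simeq_{\mathbb{Q}} S^{2n}$. Then $X$ is $\pi$-infinite, and $X$ has vanishing rational Gottlieb elements above degree $2n-1$, i.e. $G_k(X_{\mathbb{Q}})=0$ for all $k>2n-1$. In particular, the rational homotopy type of $S^{2n}$ cannot be realized as the classifying space $B\mathrm{aut}_1(Y)$ of any simply-connected $\pi$-finite space $Y$ with rational homology of finite type.
   Context: For a (CW) space $X$, $\mathrm{aut}_1(X)$ denotes the monoid of self-maps of $X$ homotopic to the identity, and $B\mathrm{aut}_1(X)$ is its classifying space; it is simply connected and classifies fibrations with fibre $X$ over simply-connected bases (it is the universal cover of $B\mathrm{aut}(X)$). The relation $\simeq_{\mathbb{Q}}$ means having the same rational homotopy type, and $X_{\mathbb{Q}}$ is the rationalization of $X$. Throughout, spaces are considered up to rational homotopy, and the rational homotopy type of $B\mathrm{aut}_1(X)$ is understood through Sullivan's theorem: if $(\Lambda V,d)$ is the Sullivan minimal model of $X$, then the differential graded Lie algebra $(\mathrm{Der}'(\Lambda V),D)$ is a Lie model for $B\mathrm{aut}_1(X)$. Here $\mathrm{Der}_k(\Lambda V)$ is the space of derivations of $\Lambda V$ lowering degree by $k$, the bracket is the graded commutator, $D=[d,-]$, and $\mathrm{Der}'_k(\Lambda V)=\mathrm{Der}_k(\Lambda V)$ for $k>1$, $\mathrm{Der}'_1(\Lambda V)$ is the space of $D$-cycles in $\mathrm{Der}_1(\Lambda V)$, and $\mathrm{Der}'_k(\Lambda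 V)=0$ for $k<1$. In particular $\pi_*(\Omega B\mathrm{aut}_1(X))\otimes\mathbb{Q}\cong H_*(\mathrm{Der}'(\Lambda V),D)$ as graded Lie algebras (Samelson product on the left). A space $X$ is called $\pi$-finite if it has only finitely many non-zero rational homotopy groups $\pi_i(X)\otimes\mathbb{Q}$, and $\pi$-infinite otherwise. A class $\alpha\in\pi_k(Z)$ is a Gottlieb element of a space $Z$ if the map $\alpha\vee 1_Z:S^k\vee Z\to Z$ extends to a map $S^k\times Z\to Z$. The Gottlieb elements form a graded subgroup $G_*(Z)\subset\pi_*(Z)$; elements of $G_*(X_{\mathbb{Q}})$ are the rational Gottlieb elements of $X$. *)

theory Defs
  imports
    Complex_Main
    "HOL-Library.Function_Algebras"
    "HOL-Library.Product_Plus"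
    "HOL-Computational_Algebra.Polynomial"
begin

text \<open>
  Simply connected spaces with rational homology of finite type, taken up to rational homotopy,
  are represented by their Sullivan minimal models \<open>(\<Lambda>V, d)\<close>; the rational homotopy type of
  \<open>Baut\<^sub>1(X)\<close> is given by Sullivan's Lie model \<open>Der'(\<Lambda>V)\<close>.
  The ground field is the field of rational numbers, and all degrees are integers.
\<close>

definition koszul :: "int \<Rightarrow> int \<Rightarrow> rat" where
  "koszul i j = (if odd i \<and> odd j then - 1 else 1)"


section \<open>Commutative differential graded algebras\<close>

text \<open>The underlying vector space is the whole type, the internal direct sum of the \<open>cgr A p\<close>.\<close>

record 'a cdga =
  csmul :: "rat \<Rightarrow> 'a \<Rightarrow> 'a"
  cmult :: "'a \<Rightarrow> 'a \<Rightarrow> 'a"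
  cone :: "'a"
  cgr :: "int \<Rightarrow> 'a set"
  cdiff :: "'a \<Rightarrow> 'a"

definition is_decomp :: "(int \<Rightarrow> 'a::ab_group_add set) \<Rightarrow> 'a \<Rightarrow> (int \<Rightarrow> 'a) \<Rightarrow> bool" where
  "is_decomp gr x f \<longleftrightarrow>
     finite {p. f p \<noteq> 0} \<and> (\<forall>p. f p \<in> gr p) \<and> x = (\<Sum>p | f p \<noteq> 0. f p)"

definition graded_space ::
  "(rat \<Rightarrow> 'a::ab_group_add \<Rightarrow> 'a) \<Rightarrow> (int \<Rightarrow> 'a set) \<Rightarrow> bool" where
  "graded_space s gr \<longleftrightarrow>
     vector_space s \<and> (\<forall>p. module.subspace s (gr p)) \<and> (\<forall>x. \<exists>!f. is_decomp gr x f)"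

text \<open>The homogeneous component of \<open>x\<close> of degree \<open>p\<close>.\<close>

definition hcomp :: "(int \<Rightarrow> 'a::ab_group_add set) \<Rightarrow> 'a \<Rightarrow> int \<Rightarrow> 'a" where
  "hcomp gr x = (THE f. is_decomp gr x f)"

definition is_cdga :: "'a::ab_group_add cdga \<Rightarrow> bool" where
  "is_cdga A \<longleftrightarrow>
     graded_space (csmul A) (cgr A) \<and>
     (\<forall>p<0. cgr A p = {0}) \<and>
     (\<forall>x. Vector_Spaces.linear (csmul A) (csmul A) (cmult A x)) \<and>
     (\<forall>y. Vector_Spaces.linear (csmul A) (csmul A) (\<lambda>x. cmult A x y)) \<and>
     (\<forall>x y z. cmult A (cmult A x y) z = cmult A x (cmult A y z)) \<and>
     cone A \<in> cgr A 0 \<and>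
     (\<forall>x. cmult A (cone A) x = x \<and> cmult A x (cone A) = x) \<and>
     (\<forall>p q. \<forall>x\<in>cgr A p. \<forall>y\<in>cgr A q.
        cmult A x y \<in> cgr A (p + q) \<and>
        cmult A x y = csmul A (koszul p q) (cmult A y x)) \<and>
     Vector_Spaces.linear (csmul A) (csmul A) (cdiff A) \<and>
     (\<forall>p. \<forall>x\<in>cgr A p. cdiff A x \<in> cgr A (p + 1)) \<and>
     (\<forall>x. cdiff A (cdiff A x) = 0) \<and>
     (\<forall>p. \<forall>x\<in>cgr A p. \<forall>y.
        cdiff A (cmult A x y) =
          cmult A (cdiff A x) y + csmul A (koszul 1 p) (cmult A x (cdiff A y)))"

definition cdga_mor ::
  "'a::ab_group_add cdga \<Rightarrow> 'b::ab_group_add cdga \<Rightarrow> ('a \<Rightarrow> 'b) \<Rightarrow> bool" where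
  "cdga_mor A B f \<longleftrightarrow>
     Vector_Spaces.linear (csmul A) (csmul B) f \<and>
     (\<forall>p. \<forall>x\<in>cgr A p. f x \<in> cgr B p) \<and>
     (\<forall>x y. f (cmult A x y) = cmult B (f x) (f y)) \<and>
     f (cone A) = cone B \<and>
     (\<forall>x. f (cdiff A x) = cdiff B (f x))"

definition ground_cdga :: "rat cdga" where
  "ground_cdga = \<lparr> csmul = (*), cmult = (*), cone = 1,
     cgr = (\<lambda>p. if p = 0 then UNIV else {0}), cdiff = (\<lambda>x. 0) \<rparr>"

text \<open>The augmentation; it is unique as soon as \<open>A\<close> is connected, as \<open>\<Lambda>V\<close> is.\<close>

definition aug :: "'a::ab_group_add cdga \<Rightarrow> 'a \<Rightarrow> rat" where
  "aug A = (THE e. cdga_mor A ground_cdga e)"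

definition finite_type_cohomology :: "'a::ab_group_add cdga \<Rightarrow> bool" where
  "finite_type_cohomology A \<longleftrightarrow>
     (\<forall>p. \<exists>S. finite S \<and>
        {x \<in> cgr A p. cdiff A x = 0} \<subseteq>
          module.span (csmul A) (S \<union> cdiff A ` cgr A (p - 1)))"


section \<open>Minimal Sullivan algebras\<close>

text \<open>
  \<open>\<Lambda>V = TV / I\<close>, with \<open>I\<close> the ideal generated by the \<open>x \<otimes> y - (-1)\<^bsup>|x||y|\<^esup> y \<otimes> x\<close>.
  The tensor algebra is presented as the free vector space on words in homogeneous elements
  of \<open>V\<close> (finitely supported functions on words) modulo multilinearity in the letters, so the
  multilinearity relations are listed together with the commutation relations.
\<close>

definition letter_words :: "(int \<Rightarrow> 'a set) \<Rightarrow> 'a list set" where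
  "letter_words V = lists (\<Union>p. V p)"

definition fscale :: "rat \<Rightarrow> ('b \<Rightarrow> rat) \<Rightarrow> 'b \<Rightarrow> rat" where
  "fscale c f = (\<lambda>w. c * f w)"

definition single_word :: "'a list \<Rightarrow> 'a list \<Rightarrow> rat" where
  "single_word w = (\<lambda>w'. if w' = w then 1 else 0)"

definition word_space :: "(int \<Rightarrow> 'a set) \<Rightarrow> ('a list \<Rightarrow> rat) set" where
  "word_space V = {f. finite {w. f w \<noteq> 0} \<and> {w. f w \<noteq> 0} \<subseteq> letter_words V}"

definition word_val :: "'a cdga \<Rightarrow> 'a list \<Rightarrow> 'a" where
  "word_val A w = foldr (cmult A) w (cone A)"

definition word_eval :: "'a::ab_group_add cdga \<Rightarrow> ('a list \<Rightarrow> rat) \<Rightarrow> 'a" where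
  "word_eval A f = (\<Sum>w | f w \<noteq> 0. csmul A (f w) (word_val A w))"

definition lambda_relations ::
  "'a::ab_group_add cdga \<Rightarrow> (int \<Rightarrow> 'a set) \<Rightarrow> ('a list \<Rightarrow> rat) set" where
  "lambda_relations A V =
     {single_word (u @ [x + y] @ w) - single_word (u @ [x] @ w) - single_word (u @ [y] @ w)
        | u w x y. u \<in> letter_words V \<and> w \<in> letter_words V \<and> (\<exists>p. x \<in> V p \<and> y \<in> V p)} \<union>
     {single_word (u @ [csmul A c x] @ w) - fscale c (single_word (u @ [x] @ w))
        | u w c x. u \<in> letter_words V \<and> w \<in> letter_words V \<and> (\<exists>p. x \<in> V p)} \<union>
     {single_word (u @ [x, y] @ w) - fscale (koszul p q) (single_word (u @ [y, x] @ w))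
        | u w x y p q. u \<in> letter_words V \<and> w \<in> letter_words V \<and> x \<in> V p \<and> y \<in> V q}"

definition free_on :: "'a::ab_group_add cdga \<Rightarrow> (int \<Rightarrow> 'a set) \<Rightarrow> bool" where
  "free_on A V \<longleftrightarrow>
     (\<forall>p. module.subspace (csmul A) (V p) \<and> V p \<subseteq> cgr A p) \<and>
     word_eval A ` word_space V = UNIV \<and>
     (\<forall>f\<in>word_space V. word_eval A f = 0 \<longrightarrow> f \<in> module.span fscale (lambda_relations A V))"

definition generated_subalgebra ::
  "'a::ab_group_add cdga \<Rightarrow> (int \<Rightarrow> 'a set) \<Rightarrow> 'a set" where
  "generated_subalgebra A V = module.span (csmul A) (word_val A ` letter_words V)"

text \<open>\<open>\<Lambda>\<^sup>+V \<cdot> \<Lambda>\<^sup>+V\<close>\<close>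

definition decomposables :: "'a::ab_group_add cdga \<Rightarrow> 'a set" where
  "decomposables A =
     module.span (csmul A) {cmult A x y | x y p q. 0 < p \<and> 0 < q \<and> x \<in> cgr A p \<and> y \<in> cgr A q}"

definition minimal_sullivan :: "'a::ab_group_add cdga \<Rightarrow> (int \<Rightarrow> 'a set) \<Rightarrow> bool" where
  "minimal_sullivan A V \<longleftrightarrow>
     is_cdga A \<and> free_on A V \<and> (\<forall>p<1. V p = {0}) \<and>
     (\<exists>F :: nat \<Rightarrow> int \<Rightarrow> 'a set.
        (\<forall>m p. module.subspace (csmul A) (F m p) \<and> F m p \<subseteq> F (Suc m) p) \<and>
        (\<forall>p. V p = (\<Union>m. F m p)) \<and>
        (\<forall>p. \<forall>x\<in>F 0 p. cdiff A x = 0) \<and>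
        (\<forall>m p. \<forall>x\<in>F (Suc m) p. cdiff A x \<in> generated_subalgebra A (F m))) \<and>
     (\<forall>p. \<forall>x\<in>V p. cdiff A x \<in> decomposables A)"

text \<open>
  The minimal models of simply connected spaces with rational homology of finite type:
  \<open>V = V\<^bsup>\<ge>2\<^esup>\<close>, and every \<open>H\<^sup>p(\<Lambda>V) = Hom(H\<^sub>p(X), \<rat>)\<close> is finite-dimensional.
\<close>

definition sc_finite_type_model :: "'a::ab_group_add cdga \<Rightarrow> (int \<Rightarrow> 'a set) \<Rightarrow> bool" where
  "sc_finite_type_model A V \<longleftrightarrow>
     minimal_sullivan A V \<and> V 1 = {0} \<and> finite_type_cohomology A"


section \<open>Rational homotopy groups and Gottlieb elements\<close>

text \<open>
  \<open>sphere_tensor k A\<close> is \<open>H\<^sup>*(S\<^sup>k; \<rat>) \<otimes> A\<close>, a model of \<open>S\<^sup>k \<times> X\<close> for \<open>k \<ge> 1\<close> since spheres are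
  formal: the pair \<open>(a, b)\<close> stands for \<open>a + s b\<close>, where \<open>|s| = k\<close> and \<open>s\<^sup>2 = 0\<close>. Hence
  \<open>(a + s b) (a' + s b') = a a' + s (b a' + (-1)\<^bsup>k|a|\<^esup> a b')\<close>; \<open>sign_twist A k\<close> is the linear map
  \<open>a \<mapsto> (-1)\<^bsup>k|a|\<^esup> a\<close>.
\<close>

definition sign_twist :: "'a::ab_group_add cdga \<Rightarrow> int \<Rightarrow> 'a \<Rightarrow> 'a" where
  "sign_twist A k x =
     (\<Sum>p | hcomp (cgr A) x p \<noteq> 0. csmul A (koszul k p) (hcomp (cgr A) x p))"

definition sphere_tensor :: "nat \<Rightarrow> 'a::ab_group_add cdga \<Rightarrow> ('a \<times> 'a) cdga" where
  "sphere_tensor k A = \<lparr>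
     csmul = (\<lambda>c (a, b). (csmul A c a, csmul A c b)),
     cmult = (\<lambda>(a, b) (a', b').
       (cmult A a a', cmult A b a' + cmult A (sign_twist A (int k) a) b')),
     cone = (cone A, 0),
     cgr = (\<lambda>p. cgr A p \<times> cgr A (p - int k)),
     cdiff = (\<lambda>(a, b). (cdiff A a, csmul A (koszul 1 (int k)) (cdiff A b))) \<rparr>"

definition sphere_coh :: "nat \<Rightarrow> (rat \<times> rat) cdga" where
  "sphere_coh k = sphere_tensor k ground_cdga"

text \<open>
  \<open>\<pi>\<^sub>k(X) \<otimes> \<rat> = \<pi>\<^sub>k(X\<^sub>\<rat>)\<close> for \<open>k \<ge> 1\<close>: homotopy classes of maps \<open>S\<^sup>k \<rightarrow> X\<^sub>\<rat>\<close> correspond to homotopy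
  classes of morphisms \<open>\<Lambda>V \<rightarrow> H\<^sup>*(S\<^sup>k; \<rat>)\<close>. As \<open>\<Lambda>V\<close> is minimal with \<open>V\<^sup>1 = 0\<close>, homotopic morphisms
  are equal, so no quotient is taken.
\<close>

definition rat_homotopy_group ::
  "'a::ab_group_add cdga \<Rightarrow> nat \<Rightarrow> ('a \<Rightarrow> rat \<times> rat) set" where
  "rat_homotopy_group A k = {\<alpha>. cdga_mor A (sphere_coh k) \<alpha>}"

definition const_class :: "'a::ab_group_add cdga \<Rightarrow> 'a \<Rightarrow> rat \<times> rat" where
  "const_class A = (\<lambda>x. (aug A x, 0))"

definition pi_finite :: "'a::ab_group_add cdga \<Rightarrow> bool" where
  "pi_finite A \<longleftrightarrow> finite {k. 1 \<le> k \<and> rat_homotopy_group A k \<noteq> {const_class A}}"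

text \<open>
  \<open>\<alpha>\<close> is a Gottlieb element of \<open>X\<^sub>\<rat>\<close> iff \<open>\<alpha> \<or> 1\<close> extends to \<open>S\<^sup>k \<times> X\<^sub>\<rat> \<rightarrow> X\<^sub>\<rat>\<close>, that is, iff there is
  \<open>F : \<Lambda>V \<rightarrow> H\<^sup>*(S\<^sup>k; \<rat>) \<otimes> \<Lambda>V\<close> restricting to the identity on \<open>X\<^sub>\<rat>\<close> and to \<open>\<alpha>\<close> on \<open>S\<^sup>k\<close>.
  Strict restrictions suffice, as \<open>H\<^sup>*(S\<^sup>k) \<otimes> \<Lambda>V\<close> maps onto the model
  \<open>H\<^sup>*(S\<^sup>k) \<times>\<^sub>\<rat> \<Lambda>V\<close> of \<open>S\<^sup>k \<or> X\<close>.
\<close>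

definition rat_gottlieb :: "'a::ab_group_add cdga \<Rightarrow> nat \<Rightarrow> ('a \<Rightarrow> rat \<times> rat) set" where
  "rat_gottlieb A k =
     {\<alpha> \<in> rat_homotopy_group A k. \<exists>F. cdga_mor A (sphere_tensor k A) F \<and>
        (\<forall>x. fst (F x) = x) \<and> (\<forall>x. map_prod (aug A) (aug A) (F x) = \<alpha> x)}"


section \<open>Differential graded Lie algebras\<close>

text \<open>
  Only the homogeneous pieces \<open>lgr L k\<close> matter: the bracket and the differential carry the
  degrees of their arguments. Reduced dg Lie algebras (concentrated in degrees \<open>\<ge> 1\<close>) are the
  Lie models of simply connected spaces.
\<close>

record 'a dgl =
  lsmul :: "rat \<Rightarrow> 'a \<Rightarrow> 'a"
  lgr :: "int \<Rightarrow> 'a set"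
  lbr :: "int \<Rightarrow> int \<Rightarrow> 'a \<Rightarrow> 'a \<Rightarrow> 'a"
  ldiff :: "int \<Rightarrow> 'a \<Rightarrow> 'a"

definition is_dgl :: "'a::ab_group_add dgl \<Rightarrow> bool" where
  "is_dgl L \<longleftrightarrow>
     vector_space (lsmul L) \<and>
     (\<forall>k. module.subspace (lsmul L) (lgr L k)) \<and>
     (\<forall>k<1. lgr L k = {0}) \<and>
     (\<forall>i j. \<forall>x\<in>lgr L i. \<forall>y\<in>lgr L j.
        lbr L i j x y \<in> lgr L (i + j) \<and>
        lbr L i j x y = - lsmul L (koszul i j) (lbr L j i y x)) \<and>
     (\<forall>i j. \<forall>x\<in>lgr L i. \<forall>y\<in>lgr L j. \<forall>z\<in>lgr L j. \<forall>c.
        lbr L i j x (y + z) = lbr L i j x y + lbr L i j x z \<and>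
        lbr L i j x (lsmul L c y) = lsmul L c (lbr L i j x y)) \<and>
     (\<forall>i j k. \<forall>x\<in>lgr L i. \<forall>y\<in>lgr L j. \<forall>z\<in>lgr L k.
        lbr L i (j + k) x (lbr L j k y z) =
          lbr L (i + j) k (lbr L i j x y) z
          + lsmul L (koszul i j) (lbr L j (i + k) y (lbr L i k x z))) \<and>
     (\<forall>k. \<forall>x\<in>lgr L k. \<forall>y\<in>lgr L k. \<forall>c.
        ldiff L k x \<in> lgr L (k - 1) \<and>
        ldiff L k (x + y) = ldiff L k x + ldiff L k y \<and>
        ldiff L k (lsmul L c x) = lsmul L c (ldiff L k x) \<and>
        ldiff L (k - 1) (ldiff L k x) = 0) \<and>
     (\<forall>i j. \<forall>x\<in>lgr L i. \<forall>y\<in>lgr L j.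
        ldiff L (i + j) (lbr L i j x y) =
          lbr L (i - 1) j (ldiff L i x) y
          + lsmul L (koszul 1 i) (lbr L i (j - 1) x (ldiff L j y)))"

definition dgl_mor ::
  "'a::ab_group_add dgl \<Rightarrow> 'b::ab_group_add dgl \<Rightarrow> (int \<Rightarrow> 'a \<Rightarrow> 'b) \<Rightarrow> bool" where
  "dgl_mor L M f \<longleftrightarrow>
     (\<forall>k. \<forall>x\<in>lgr L k. \<forall>y\<in>lgr L k. \<forall>c.
        f k x \<in> lgr M k \<and>
        f k (x + y) = f k x + f k y \<and>
        f k (lsmul L c x) = lsmul M c (f k x) \<and>
        f (k - 1) (ldiff L k x) = ldiff M k (f k x)) \<and>
     (\<forall>i j. \<forall>x\<in>lgr L i. \<forall>y\<in>lgr L j.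
        f (i + j) (lbr L i j x y) = lbr M i j (f i x) (f j y))"

definition lcycles :: "'a::ab_group_add dgl \<Rightarrow> int \<Rightarrow> 'a set" where
  "lcycles L k = {x \<in> lgr L k. ldiff L k x = 0}"

definition lboundaries :: "'a dgl \<Rightarrow> int \<Rightarrow> 'a set" where
  "lboundaries L k = ldiff L (k + 1) ` lgr L (k + 1)"

text \<open>Injectivity and surjectivity of \<open>H\<^sub>k(L) \<rightarrow> H\<^sub>k(M)\<close> are stated on cycles.\<close>

definition dgl_quasi_iso :: "'a::ab_group_add dgl \<Rightarrow> 'b::ab_group_add dgl \<Rightarrow> bool" where
  "dgl_quasi_iso L M \<longleftrightarrow> is_dgl L \<and> is_dgl M \<and>
     (\<exists>f. dgl_mor L M f \<and>
        (\<forall>k. \<forall>x\<in>lcycles L k. f k x \<in> lboundaries M k \<longrightarrow> x \<in> lboundaries L k) \<and>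
        (\<forall>k. \<forall>y\<in>lcycles M k. \<exists>x\<in>lcycles L k. f k x - y \<in> lboundaries M k))"

text \<open>
  A zigzag of quasi-isomorphisms (\<open>equivclp\<close> is the equivalence closure) all of whose
  intermediate objects live on the type \<open>'m\<close>. Any zigzag takes this form for a large enough \<open>'m\<close>,
  the two outer quasi-isomorphisms being isomorphisms from and onto copies of \<open>L\<close> and \<open>K\<close>; a
  statement polymorphic in \<open>'m\<close> therefore covers all zigzags.
\<close>

definition dgl_quasi_isomorphic ::
  "'m::ab_group_add itself \<Rightarrow> 'a::ab_group_add dgl \<Rightarrow> 'b::ab_group_add dgl \<Rightarrow> bool" where
  "dgl_quasi_isomorphic _ L K \<longleftrightarrow>
     (\<exists>M N :: 'm dgl. dgl_quasi_iso M L \<and> equivclp dgl_quasi_iso M N \<and> dgl_quasi_iso N K)"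


section \<open>Lie models of classifying spaces and of spheres\<close>

text \<open>Derivations lowering degree by \<open>k\<close> (raising it when \<open>k < 0\<close>).\<close>

definition derivations :: "'a::ab_group_add cdga \<Rightarrow> int \<Rightarrow> ('a \<Rightarrow> 'a) set" where
  "derivations A k =
     {\<theta>. Vector_Spaces.linear (csmul A) (csmul A) \<theta> \<and>
         (\<forall>p. \<forall>x\<in>cgr A p. \<theta> x \<in> cgr A (p - k)) \<and>
         (\<forall>p. \<forall>x\<in>cgr A p. \<forall>y.
            \<theta> (cmult A x y) = cmult A (\<theta> x) y + csmul A (koszul k p) (cmult A x (\<theta> y)))}"

definition der_bracket ::
  "'a::ab_group_add cdga \<Rightarrow> int \<Rightarrow> int \<Rightarrow> ('a \<Rightarrow> 'a) \<Rightarrow> ('a \<Rightarrow> 'a) \<Rightarrow> 'a \<Rightarrow> 'a" where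
  "der_bracket A i j \<theta> \<eta> = (\<lambda>x. \<theta> (\<eta> x) - csmul A (koszul i j) (\<eta> (\<theta> x)))"

text \<open>\<open>D = [d, -]\<close>, where \<open>d\<close> lowers degree by \<open>-1\<close>.\<close>

definition der_diff :: "'a::ab_group_add cdga \<Rightarrow> int \<Rightarrow> ('a \<Rightarrow> 'a) \<Rightarrow> 'a \<Rightarrow> 'a" where
  "der_diff A k \<theta> = der_bracket A (- 1) k (cdiff A) \<theta>"

definition Der' :: "'a::ab_group_add cdga \<Rightarrow> ('a \<Rightarrow> 'a) dgl" where
  "Der' A = \<lparr>
     lsmul = (\<lambda>c \<theta> x. csmul A c (\<theta> x)),
     lgr = (\<lambda>k. if k > 1 then derivations A k
                else if k = 1 then {\<theta> \<in> derivations A 1. der_diff A 1 \<theta> = 0}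
                else {0}),
     lbr = der_bracket A,
     ldiff = der_diff A \<rparr>"

text \<open>
  The free graded Lie algebra on one generator \<open>x\<close> of degree \<open>e\<close>: the sub Lie algebra generated
  by \<open>x\<close> of the tensor algebra \<open>T(x) = \<rat>[x]\<close> with the graded commutator.
\<close>

inductive free_lie_gen1 :: "int \<Rightarrow> int \<Rightarrow> rat poly \<Rightarrow> bool" for e :: int where
  gen: "free_lie_gen1 e e [:0, 1:]"
| zero: "free_lie_gen1 e k 0"
| add: "free_lie_gen1 e k p \<Longrightarrow> free_lie_gen1 e k q \<Longrightarrow> free_lie_gen1 e k (p + q)"
| scale: "free_lie_gen1 e k p \<Longrightarrow> free_lie_gen1 e k (smult c p)"
| bracket: "free_lie_gen1 e i p \<Longrightarrow> free_lie_gen1 e j q \<Longrightarrow>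
    free_lie_gen1 e (i + j) (p * q - smult (koszul i j) (q * p))"

text \<open>The Quillen minimal model of \<open>S\<^sup>m\<close>, \<open>m \<ge> 2\<close>: generator in degree \<open>m - 1\<close>, zero differential.\<close>

definition sphere_lie :: "nat \<Rightarrow> rat poly dgl" where
  "sphere_lie m = \<lparr>
     lsmul = smult,
     lgr = (\<lambda>k. {p. free_lie_gen1 (int m - 1) k p}),
     lbr = (\<lambda>i j p q. p * q - smult (koszul i j) (q * p)),
     ldiff = (\<lambda>k p. 0) \<rparr>"

text \<open>
  \<open>Baut\<^sub>1(X) \<simeq>\<^sub>\<rat> S\<^sup>m\<close>: simply connected spaces have the same rational homotopy type iff their Lie
  models are connected by a zigzag of quasi-isomorphisms.
\<close>

definition Baut1_rat_equiv_sphere ::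
  "'m::ab_group_add itself \<Rightarrow> 'a::ab_group_add cdga \<Rightarrow> nat \<Rightarrow> bool" where
  "Baut1_rat_equiv_sphere T A m \<longleftrightarrow> dgl_quasi_isomorphic T (Der' A) (sphere_lie m)"

end

(*
  Put e = 2n - 1. The homology of Der' is spanned by a class x of degree e and alpha = [x, x] of
  degree 2e. Since d is decomposable, boundaries in Der' vanish after composition with the augmentation
  eps. Hence a Gottlieb element above degree e comes from a multiple of alpha, and it suffices to
  show that eps(alpha v) = 0 for all v of degree 2e. Otherwise normalise alpha v = 1 and put w = x v,
  so that x w = 1/2 and u = d w is a decomposable cocycle. As Der' is acyclic between the degrees e and
  2e, u alpha = D eta for a combination eta of derivations c theta with 2 <= |c| <= e - 1. Then
  y = w alpha - eta is a cycle of degree e with y w = 0, so it bounds, and so does [x, y]; but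
  [x, y] v = x w - x (eta v) has augmentation 1/2.

  The derivation eta is obtained by duality. A homotopy for the action on alpha turns a functional
  that vanishes on the candidates D eta into a cocycle F on the bar construction of the Sullivan
  algebra, and F [u] = 0 for every decomposable cocycle u, because shuffling generators into words
  contracts the bar construction to the words whose letters are generators.

  If V is concentrated in finitely many degrees, with top degree N, the derivation dual to a generator
  of degree N is a cycle with non-zero augmentation; N >= 2e > e because alpha is non-zero.
*)
theory Submission
  imports Defs
begin

section \<open>Commutative differential graded algebras\<close>

text \<open>For e > 1, acyclicity in degree e - 1 already yields some eta with D eta = u \<alpha>,
  but it gives no control over the scalars eta w and eps (x (eta v)) on which the contradiction
  rests. For combinations of c \<theta> with 2 \<le> |c| \<le> e - 1 both vanish for reasons of
  degree, so D eta = u \<alpha> has to be solved inside their span. The upper bound comes from the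
  homotopy: an operator containing at least one contraction has degree at most 2 e - 1. Passing to
  functionals replaces tensors by multilinear functions on lists of letters, without choosing bases.
  On the bar side, shuffling gives a homotopy for W - P, where W counts generators and P is the
  top-to-random shuffle, with eigenvalues among 0, ..., k on words of length k. This is invertible
  where the weight exceeds the length. The word [u] has length 1 and weight 2, which is how
  decomposability enters. The inner differential only raises the weight, and the degree bounds the
  weight because generators have degree at least 2, so an induction on the leading weight
  ends.\<close>

lemma koszul_sym: "koszul i j = koszul j i"
  by (auto simp: koszul_def)

lemma koszul_sq [simp]: "koszul i j * koszul i j = 1"
  by (auto simp: koszul_def)

lemma koszul_sq_left [simp]: "koszul i j * (koszul i j * r) = r"
  by (auto simp: koszul_def)

lemma koszul_add: "koszul i (j + k) = koszul i j * koszul i k"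
  by (auto simp: koszul_def)

lemma koszul_minus1: "koszul (- 1) k = koszul 1 k"
  by (auto simp: koszul_def)

lemma linearI:
  assumes "vector_space s1" "vector_space s2"
    and "\<And>x y. f (x + y) = f x + f y" "\<And>r x. f (s1 r x) = s2 r (f x)"
  shows "Vector_Spaces.linear s1 s2 f"
  using assms by (simp add: Vector_Spaces.linear_iff)

lemma vector_space_rat: "vector_space ((*) :: rat \<Rightarrow> rat \<Rightarrow> rat)"
  by unfold_locales (auto simp: algebra_simps)

lemma vector_space_fun:
  assumes "vector_space s"
  shows "vector_space (\<lambda>c f x. s c (f x))"
proof -
  interpret vector_space s by fact
  show ?thesis
    by unfold_locales (auto simp: fun_eq_iff scale_right_distrib scale_left_distrib)
qed

lemma vector_space_fscale: "vector_space fscale"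
  by unfold_locales (auto simp: fscale_def fun_eq_iff algebra_simps)

locale cdga =
  fixes A :: "'a::ab_group_add cdga"
  assumes cdga: "is_cdga A"
begin

abbreviation sm where "sm \<equiv> csmul A"
abbreviation gr where "gr \<equiv> cgr A"
abbreviation one where "one \<equiv> cone A"
abbreviation d where "d \<equiv> cdiff A"
abbreviation mul (infixl "\<odot>" 70) where "x \<odot> y \<equiv> cmult A x y"

lemma vs: "vector_space sm"
  using cdga unfolding is_cdga_def graded_space_def by blast

sublocale vs: vector_space sm
  by (rule vs)

lemma subspace_gr: "vs.subspace (gr p)"
  using cdga unfolding is_cdga_def graded_space_def by blast

lemma gr_0 [simp]: "0 \<in> gr p"
  using subspace_gr vs.subspace_0 by blast
lemma gr_add: "x \<in> gr p \<Longrightarrow> y \<in> gr p \<Longrightarrow> x + y \<in> gr p"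
  using subspace_gr vs.subspace_add by blast
lemma gr_diff: "x \<in> gr p \<Longrightarrow> y \<in> gr p \<Longrightarrow> x - y \<in> gr p"
  using subspace_gr vs.subspace_diff by blast
lemma gr_scale: "x \<in> gr p \<Longrightarrow> sm r x \<in> gr p"
  using subspace_gr vs.subspace_scale by blast
lemma gr_neg: "p < 0 \<Longrightarrow> x \<in> gr p \<Longrightarrow> x = 0"
  using cdga unfolding is_cdga_def by blast+

lemma mul_linear: "Vector_Spaces.linear sm sm (cmult A x)"
  and mul_linear': "Vector_Spaces.linear sm sm (\<lambda>x. x \<odot> y)"
  and d_linear: "Vector_Spaces.linear sm sm d"
  using cdga unfolding is_cdga_def by blast+

lemma mul_add_right: "x \<odot> (y + z) = x \<odot> y + x \<odot> z"
  and mul_scale_right [simp]: "x \<odot> sm r y = sm r (x \<odot> y)"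
  using mul_linear[of x] by (simp_all add: Vector_Spaces.linear_iff)
lemma mul_add_left: "(x + y) \<odot> z = x \<odot> z + y \<odot> z"
  and mul_scale_left [simp]: "sm r x \<odot> z = sm r (x \<odot> z)"
  using mul_linear'[of z] by (simp_all add: Vector_Spaces.linear_iff)
lemma d_add: "d (x + y) = d x + d y"
  and d_scale [simp]: "d (sm r x) = sm r (d x)"
  using d_linear by (simp_all add: Vector_Spaces.linear_iff)

lemma mul_zero [simp]: "x \<odot> 0 = 0" "0 \<odot> x = 0"
  using mul_add_right[of x 0 0] mul_add_left[of 0 0 x] by (simp_all only: add_0_right add_cancel_right_right)
lemma d_zero [simp]: "d 0 = 0"
  using d_add[of 0 0] by simp
lemma mul_minus_right [simp]: "x \<odot> (- y) = - (x \<odot> y)"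
  by (rule minus_unique[symmetric]) (simp flip: mul_add_right)
lemma mul_minus_left [simp]: "(- x) \<odot> y = - (x \<odot> y)"
  by (rule minus_unique[symmetric]) (simp flip: mul_add_left)
lemma d_minus [simp]: "d (- y) = - d y"
  by (rule minus_unique[symmetric]) (simp flip: d_add)

lemma mul_assoc: "(x \<odot> y) \<odot> z = x \<odot> (y \<odot> z)"
  and one_gr: "one \<in> gr 0"
  and mul_one [simp]: "one \<odot> x = x" "x \<odot> one = x"
  and d_d [simp]: "d (d x) = 0"
  using cdga unfolding is_cdga_def by blast+

lemma mul_gr: "x \<in> gr p \<Longrightarrow> y \<in> gr q \<Longrightarrow> x \<odot> y \<in> gr (p + q)"
  and mul_comm: "x \<in> gr p \<Longrightarrow> y \<in> gr q \<Longrightarrow> x \<odot> y = sm (koszul p q) (y \<odot> x)"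
  and d_gr: "x \<in> gr p \<Longrightarrow> d x \<in> gr (p + 1)"
  and d_mul_gr: "x \<in> gr p \<Longrightarrow> d (x \<odot> y) = d x \<odot> y + sm (koszul 1 p) (x \<odot> d y)"
  using cdga unfolding is_cdga_def by blast+

section \<open>Homogeneous components\<close>

lemma decomp_ex1: "\<exists>!f. is_decomp gr x f"
proof -
  have "graded_space sm gr" using cdga unfolding is_cdga_def by blast
  then show ?thesis by (simp add: graded_space_def)
qed

lemma hcomp_decomp: "is_decomp gr x (hcomp gr x)"
  unfolding hcomp_def using decomp_ex1 by (rule theI')

lemma hcomp_unique: "is_decomp gr x f \<Longrightarrow> hcomp gr x = f"
  using decomp_ex1 hcomp_decomp by blast

lemma hcomp_gr [simp]: "hcomp gr x p \<in> gr p"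
  and hcomp_finite [simp]: "finite {p. hcomp gr x p \<noteq> 0}"
  and hcomp_sum: "(\<Sum>p | hcomp gr x p \<noteq> 0. hcomp gr x p) = x"
  using hcomp_decomp[of x] unfolding is_decomp_def by simp_all

lemma hcomp_hom: "x \<in> gr p \<Longrightarrow> hcomp gr x = (\<lambda>q. if q = p then x else 0)"
  by (rule hcomp_unique) (auto simp: is_decomp_def)

lemma sum_supp:
  fixes f :: "'i \<Rightarrow> 'b::comm_monoid_add"
  assumes "finite S" "\<And>i. i \<notin> S \<Longrightarrow> f i = 0"
  shows "(\<Sum>i | f i \<noteq> 0. f i) = sum f S"
  by (rule sum.mono_neutral_left) (use assms in auto)

lemma hcomp_add: "hcomp gr (x + y) p = hcomp gr x p + hcomp gr y p"
proof -
  let ?f = "\<lambda>p. hcomp gr x p + hcomp gr y p"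
  let ?S = "{p. hcomp gr x p \<noteq> 0} \<union> {p. hcomp gr y p \<noteq> 0}"
  have fin: "finite ?S" by simp
  have "sum (hcomp gr z) ?S = z" if "z \<in> {x, y}" for z
    using hcomp_sum[of z] sum_supp[of ?S "hcomp gr z"] that by auto
  then have "x + y = sum (hcomp gr x) ?S + sum (hcomp gr y) ?S" by simp
  then have "x + y = sum ?f ?S" by (simp only: sum.distrib)
  also have "\<dots> = (\<Sum>p | ?f p \<noteq> 0. ?f p)"
    by (rule sum_supp[symmetric]) auto
  finally have eq: "x + y = (\<Sum>p | ?f p \<noteq> 0. ?f p)" .
  have "finite {p. ?f p \<noteq> 0}"
    by (rule finite_subset[OF _ fin]) auto
  then have "is_decomp gr (x + y) ?f"
    unfolding is_decomp_def using eq by (simp add: gr_add)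
  then have "hcomp gr (x + y) = ?f" by (rule hcomp_unique)
  then show ?thesis by simp
qed

lemma hcomp_scale: "hcomp gr (sm r x) p = sm r (hcomp gr x p)"
proof -
  let ?f = "\<lambda>p. sm r (hcomp gr x p)"
  let ?S = "{p. hcomp gr x p \<noteq> 0}"
  have "sm r x = sum ?f ?S" by (subst hcomp_sum[of x, symmetric]) (rule vs.scale_sum_right)
  also have "\<dots> = (\<Sum>p | ?f p \<noteq> 0. ?f p)"
    by (rule sum_supp[symmetric]) auto
  finally have eq: "sm r x = (\<Sum>p | ?f p \<noteq> 0. ?f p)" .
  have "finite {p. ?f p \<noteq> 0}"
    by (rule finite_subset[of _ ?S]) auto
  then have "is_decomp gr (sm r x) ?f"
    unfolding is_decomp_def using eq by (simp add: gr_scale)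
  then have "hcomp gr (sm r x) = ?f" by (rule hcomp_unique)
  then show ?thesis by simp
qed

lemma gr_unique: "x \<in> gr p \<Longrightarrow> x \<in> gr q \<Longrightarrow> p \<noteq> q \<Longrightarrow> x = 0"
  using hcomp_hom[of x p] hcomp_hom[of x q] by metis

lemma hom_induct [case_names hom add]:
  assumes "\<And>p x. x \<in> gr p \<Longrightarrow> P x" "\<And>x y. P x \<Longrightarrow> P y \<Longrightarrow> P (x + y)"
  shows "P x"
proof -
  have "P (sum (hcomp gr x) S)" if "finite S" for S
    using that
  proof (induct S rule: finite_induct)
    case empty show ?case using assms(1)[of 0 0] by simp
  next
    case (insert p S)
    then show ?case using assms(1)[OF hcomp_gr] assms(2) by simp
  qed
  from this[OF hcomp_finite[of x]] show ?thesis by (simp only: hcomp_sum)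
qed

text \<open>The grading involution puts the sign rules into a form without degrees:
  \<open>tau_mul\<close>, \<open>tau_d\<close> and \<open>d_mul\<close> hold for all elements, so
  the letters of bar words need not be homogeneous.\<close>

definition tau :: "'a \<Rightarrow> 'a" where "tau = sign_twist A 1"

lemma sign_twist_supp:
  assumes "finite S" "\<And>p. p \<notin> S \<Longrightarrow> hcomp gr x p = 0"
  shows "sign_twist A k x = (\<Sum>p\<in>S. sm (koszul k p) (hcomp gr x p))"
  unfolding sign_twist_def
  by (rule sum.mono_neutral_left) (use assms in auto)

lemma sign_twist_gr: "x \<in> gr p \<Longrightarrow> sign_twist A k x = sm (koszul k p) x"
  by (subst sign_twist_supp[of "{p}"]) (auto simp: hcomp_hom)

lemma sign_twist_add: "sign_twist A k (x + y) = sign_twist A k x + sign_twist A k y"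
proof -
  let ?S = "{p. hcomp gr x p \<noteq> 0} \<union> {p. hcomp gr y p \<noteq> 0}"
  have "sign_twist A k z = (\<Sum>p\<in>?S. sm (koszul k p) (hcomp gr z p))" if "z \<in> {x, y, x + y}" for z
    by (rule sign_twist_supp) (use that in \<open>auto simp: hcomp_add\<close>)
  then show ?thesis
    by (simp add: hcomp_add vs.scale_right_distrib sum.distrib)
qed

lemma sign_twist_scale: "sign_twist A k (sm r x) = sm r (sign_twist A k x)"
proof -
  let ?S = "{p. hcomp gr x p \<noteq> 0}"
  have "sign_twist A k z = (\<Sum>p\<in>?S. sm (koszul k p) (hcomp gr z p))" if "z \<in> {x, sm r x}" for z
    by (rule sign_twist_supp) (use that in \<open>auto simp: hcomp_scale\<close>)
  then show ?thesis
    by (simp add: hcomp_scale vs.scale_sum_right mult.commute)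
qed

lemma tau_gr: "x \<in> gr p \<Longrightarrow> tau x = sm (koszul 1 p) x"
  by (simp add: tau_def sign_twist_gr)
lemma tau_add: "tau (x + y) = tau x + tau y"
  by (simp add: tau_def sign_twist_add)
lemma tau_scale [simp]: "tau (sm r x) = sm r (tau x)"
  by (simp add: tau_def sign_twist_scale)
lemma tau_zero [simp]: "tau 0 = 0"
  using tau_add[of 0 0] by simp
lemma tau_minus [simp]: "tau (- y) = - tau y"
  by (rule minus_unique[symmetric]) (simp flip: tau_add)
lemma tau_one [simp]: "tau one = one"
  using tau_gr[OF one_gr] by (simp add: koszul_def)

lemma tau_tau [simp]: "tau (tau x) = x"
proof (induct x rule: hom_induct)
  case (hom p x)
  then show ?case by (simp add: tau_gr)
qed (simp add: tau_add)

lemma tau_mul: "tau (x \<odot> y) = tau x \<odot> tau y"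
proof (induct x rule: hom_induct)
  case (hom p x)
  note x = this
  show ?case
  proof (induct y rule: hom_induct)
    case (hom q y)
    show ?case
      using tau_gr[OF mul_gr[OF x hom]] tau_gr[OF x] tau_gr[OF hom]
      by (simp add: koszul_add mult.commute)
  qed (simp add: tau_add mul_add_right)
qed (simp add: tau_add mul_add_left)

lemma tau_d: "tau (d x) = - d (tau x)"
proof (induct x rule: hom_induct)
  case (hom p x)
  have "koszul 1 (p + 1) = - koszul 1 p" by (auto simp: koszul_def)
  then show ?case using tau_gr[OF hom] tau_gr[OF d_gr[OF hom]] by simp
qed (simp add: tau_add d_add)

lemma d_mul: "d (x \<odot> y) = d x \<odot> y + tau x \<odot> d y"
proof (induct x rule: hom_induct)
  case (hom p x)
  then show ?case by (simp add: d_mul_gr tau_gr)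
qed (simp add: tau_add mul_add_left d_add algebra_simps)

lemma mul_comm_odd:
  assumes "v \<in> gr p" "odd p"
  shows "v \<odot> c = tau c \<odot> v"
proof (induct c rule: hom_induct)
  case (hom q c)
  show ?case
    using mul_comm[OF assms(1) hom] tau_gr[OF hom] assms(2) by (simp add: koszul_def)
qed (simp add: tau_add mul_add_left mul_add_right)

lemma mul_comm_even:
  assumes "v \<in> gr p" "even p"
  shows "v \<odot> c = c \<odot> v"
proof (induct c rule: hom_induct)
  case (hom q c)
  show ?case
    using mul_comm[OF assms(1) hom] assms(2) by (simp add: koszul_def)
qed (simp add: mul_add_left mul_add_right)

lemma tau_gr_closed: "x \<in> gr p \<Longrightarrow> tau x \<in> gr p"
  by (simp add: tau_gr gr_scale)

lemma d_one [simp]: "d one = 0"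
  using d_mul[of one one] by simp

end

section \<open>Free algebras as spaces of words\<close>

definition linear_ext :: "(rat \<Rightarrow> 'y::ab_group_add \<Rightarrow> 'y) \<Rightarrow> ('b \<Rightarrow> 'y) \<Rightarrow> ('b \<Rightarrow> rat) \<Rightarrow> 'y" where
  "linear_ext s \<Phi> f = (\<Sum>w | f w \<noteq> 0. s (f w) (\<Phi> w))"

lemma linear_ext_supp:
  assumes "vector_space s" "finite S" "\<And>w. w \<notin> S \<Longrightarrow> f w = 0"
  shows "linear_ext s \<Phi> f = (\<Sum>w\<in>S. s (f w) (\<Phi> w))"
proof -
  interpret vector_space s by fact
  show ?thesis
    unfolding linear_ext_def
    by (rule sum.mono_neutral_left) (use assms in auto)
qed

lemma linear_ext_rules:
  fixes s :: "rat \<Rightarrow> 'y::ab_group_add \<Rightarrow> 'y"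
  assumes "vector_space s"
  shows linear_ext_add: "finite {w. f w \<noteq> 0} \<Longrightarrow> finite {w. g w \<noteq> 0} \<Longrightarrow>
      linear_ext s \<Phi> (f + g) = linear_ext s \<Phi> f + linear_ext s \<Phi> g"
    and linear_ext_scale: "finite {w. f w \<noteq> 0} \<Longrightarrow>
      linear_ext s \<Phi> (fscale c f) = s c (linear_ext s \<Phi> f)"
    and linear_ext_diff: "finite {w. f w \<noteq> 0} \<Longrightarrow> finite {w. g w \<noteq> 0} \<Longrightarrow>
      linear_ext s \<Phi> (f - g) = linear_ext s \<Phi> f - linear_ext s \<Phi> g"
    and linear_ext_single: "linear_ext s \<Phi> (single_word u) = s 1 (\<Phi> u)"
proof -
  interpret vector_space s by fact
  note linear_ext_supp = linear_ext_supp[OF assms]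
  show "linear_ext s \<Phi> (f + g) = linear_ext s \<Phi> f + linear_ext s \<Phi> g"
    if "finite {w. f w \<noteq> 0}" "finite {w. g w \<noteq> 0}"
    using that linear_ext_supp[of "{w. f w \<noteq> 0} \<union> {w. g w \<noteq> 0}"]
    by (simp add: scale_left_distrib sum.distrib)
  show "linear_ext s \<Phi> (f - g) = linear_ext s \<Phi> f - linear_ext s \<Phi> g"
    if "finite {w. f w \<noteq> 0}" "finite {w. g w \<noteq> 0}"
    using that linear_ext_supp[of "{w. f w \<noteq> 0} \<union> {w. g w \<noteq> 0}"]
    by (simp add: scale_left_diff_distrib sum_subtractf)
  show "linear_ext s \<Phi> (fscale c f) = s c (linear_ext s \<Phi> f)"
    if "finite {w. f w \<noteq> 0}"
    using that linear_ext_supp[of "{w. f w \<noteq> 0}"]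
    by (simp add: fscale_def scale_sum_right)
  show "linear_ext s \<Phi> (single_word u) = s 1 (\<Phi> u)"
    using linear_ext_supp[of "{u}" "single_word u" \<Phi>] by (simp add: single_word_def)
qed

lemma ground_cdga_simps [simp]:
  "csmul ground_cdga = (*)" "cmult ground_cdga = (*)" "cone ground_cdga = 1"
  "cgr ground_cdga p = (if p = 0 then UNIV else {0})" "cdiff ground_cdga x = 0"
  by (simp_all add: ground_cdga_def)

locale sullivan = cdga A for A :: "'a::ab_group_add cdga" +
  fixes V :: "int \<Rightarrow> 'a set"
  assumes minimal: "minimal_sullivan A V" and V_1: "V 1 = {0}"
begin

abbreviation LW where "LW \<equiv> letter_words V"
abbreviation val where "val \<equiv> word_val A"

lemmas minimal' = minimal[unfolded minimal_sullivan_def, THEN conjunct2]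
lemmas free_on = minimal'[THEN conjunct1]
lemmas V_neg = minimal'[THEN conjunct2, THEN conjunct1]
lemmas V_d = minimal'[THEN conjunct2, THEN conjunct2, THEN conjunct2]

lemma subspace_V: "vs.subspace (V p)" and V_gr: "x \<in> V p \<Longrightarrow> x \<in> gr p"
  using free_on unfolding free_on_def by blast+

lemma V_0 [simp]: "0 \<in> V p"
  using subspace_V vs.subspace_0 by blast
lemma V_add: "x \<in> V p \<Longrightarrow> y \<in> V p \<Longrightarrow> x + y \<in> V p"
  using subspace_V vs.subspace_add by blast
lemma V_scale: "x \<in> V p \<Longrightarrow> sm r x \<in> V p"
  using subspace_V vs.subspace_scale by blast

lemma V_ge2: "x \<in> V p \<Longrightarrow> x \<noteq> 0 \<Longrightarrow> 2 \<le> p"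
proof -
  assume x: "x \<in> V p" "x \<noteq> 0"
  have "\<not> p < 1" "p \<noteq> 1" using x V_1 V_neg by auto
  then show "2 \<le> p" by linarith
qed

lemma V_decomposable: "x \<in> V p \<Longrightarrow> d x \<in> decomposables A"
  using V_d by blast

lemma val_Nil [simp]: "val [] = one" and val_Cons [simp]: "val (x # w) = x \<odot> val w"
  by (simp_all add: word_val_def)

lemma val_append: "val (u @ w) = val u \<odot> val w"
  by (induct u) (simp_all add: mul_assoc)

lemma LW_Nil [simp]: "[] \<in> LW"
  by (simp add: letter_words_def)
lemma LW_Cons: "x # w \<in> LW \<longleftrightarrow> (\<exists>p. x \<in> V p) \<and> w \<in> LW"
  by (auto simp: letter_words_def)
lemma LW_append [simp]: "u @ w \<in> LW \<longleftrightarrow> u \<in> LW \<and> w \<in> LW"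
  by (induct u) (auto simp: LW_Cons)

lemma word_eval_ext: "word_eval A f = linear_ext sm val f"
  by (simp add: word_eval_def linear_ext_def)

lemma word_eval_surj: "\<exists>f. f \<in> word_space V \<and> word_eval A f = x"
proof -
  have "x \<in> word_eval A ` word_space V" using free_on by (simp add: free_on_def)
  then show ?thesis by blast
qed

lemma word_eval_0D: "f \<in> word_space V \<Longrightarrow> word_eval A f = 0 \<Longrightarrow>
    f \<in> module.span fscale (lambda_relations A V)"
  using free_on by (simp add: free_on_def)

text \<open>A list of coefficients and words, in place of a finitely supported function, allows list
  induction and lets \<open>Dl\<close> be formed by concatenation.\<close>

lemma word_rep: "\<exists>L. (\<forall>(r, w)\<in>set L. w \<in> LW) \<and> x = (\<Sum>(r, w)\<leftarrow>L. sm r (val w))"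
proof -
  obtain f where f: "f \<in> word_space V" "word_eval A f = x"
    using word_eval_surj by blast
  then have fin: "finite {w. f w \<noteq> 0}" and sub: "{w. f w \<noteq> 0} \<subseteq> LW"
    by (auto simp: word_space_def)
  obtain ws where ws: "set ws = {w. f w \<noteq> 0}" "distinct ws"
    using finite_distinct_list[OF fin] by blast
  have "x = (\<Sum>w\<leftarrow>ws. sm (f w) (val w))"
    using f(2) ws by (simp add: word_eval_def sum_list_distinct_conv_sum_set)
  then have "x = (\<Sum>(r, w)\<leftarrow>map (\<lambda>w. (f w, w)) ws. sm r (val w))"
    by (simp add: comp_def)
  moreover have "\<forall>(r, w)\<in>set (map (\<lambda>w. (f w, w)) ws). w \<in> LW"
    using ws sub by auto
  ultimately show ?thesis by blast
qed

lemma word_induct [case_names word add]: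
  assumes "\<And>r w. w \<in> LW \<Longrightarrow> P (sm r (val w))" "\<And>x y. P x \<Longrightarrow> P y \<Longrightarrow> P (x + y)"
  shows "P x"
proof -
  have "P (\<Sum>(r, w)\<leftarrow>L. sm r (val w))" if "\<forall>(r, w)\<in>set L. w \<in> LW" for L
    using that
  proof (induct L)
    case Nil
    show ?case using assms(1)[of "[]" 0] by simp
  next
    case (Cons a L)
    then show ?case using assms by (cases a) simp
  qed
  then show ?thesis using word_rep[of x] by auto
qed

text \<open>The universal property of the free algebra. By \<open>free_on\<close> the kernel of
  evaluation is spanned by the relations, so the linear extension of a function that respects the
  three kinds of relations agrees on all representatives of an element.\<close>

lemma word_descent:
  fixes s :: "rat \<Rightarrow> 'y::ab_group_add \<Rightarrow> 'y"
  assumes s: "vector_space s"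
    and add: "\<And>u w x y p. u \<in> LW \<Longrightarrow> w \<in> LW \<Longrightarrow> x \<in> V p \<Longrightarrow> y \<in> V p \<Longrightarrow>
        \<Phi> (u @ [x + y] @ w) = \<Phi> (u @ [x] @ w) + \<Phi> (u @ [y] @ w)"
    and scale: "\<And>u w x c p. u \<in> LW \<Longrightarrow> w \<in> LW \<Longrightarrow> x \<in> V p \<Longrightarrow>
        \<Phi> (u @ [sm c x] @ w) = s c (\<Phi> (u @ [x] @ w))"
    and comm: "\<And>u w x y p q. u \<in> LW \<Longrightarrow> w \<in> LW \<Longrightarrow> x \<in> V p \<Longrightarrow> y \<in> V q \<Longrightarrow>
        \<Phi> (u @ [x, y] @ w) = s (koszul p q) (\<Phi> (u @ [y, x] @ w))"
  shows "\<exists>g. Vector_Spaces.linear sm s g \<and> (\<forall>w\<in>LW. g (val w) = \<Phi> w)"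
proof -
  interpret s: vector_space s by fact
  interpret f: vector_space fscale by (rule vector_space_fscale)
  note ext = linear_ext_rules[OF s, where \<Phi> = \<Phi>]
  note extA = linear_ext_rules[OF vs, where \<Phi> = val]
  have fin1: "finite {w. single_word u w \<noteq> 0}" for u :: "'a list"
    by (rule finite_subset[of _ "{u}"]) (auto simp: single_word_def)
  have fins: "finite {w. fscale c f w \<noteq> 0}" if "finite {w. f w \<noteq> 0}" for c f
    by (rule finite_subset[OF _ that]) (auto simp: fscale_def)
  have find: "finite {w. (f - g) w \<noteq> (0::rat)}" if "finite {w. f w \<noteq> 0}" "finite {w. g w \<noteq> 0}"
    for f g :: "'a list \<Rightarrow> rat"
    by (rule finite_subset[OF _ finite_UnI[OF that]]) auto
  have rel: "finite {w. f w \<noteq> 0} \<and> linear_ext s \<Phi> f = 0" if "f \<in> lambda_relations A V" for f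
    using that[unfolded lambda_relations_def]
  proof (elim UnE CollectE exE conjE)
    fix u w x y p
    assume f: "f = single_word (u @ [x + y] @ w) - single_word (u @ [x] @ w) - single_word (u @ [y] @ w)"
      and h: "u \<in> LW" "w \<in> LW" "x \<in> V p" "y \<in> V p"
    show ?thesis
      unfolding f ext(3)[OF find[OF fin1 fin1] fin1] ext(3)[OF fin1 fin1] ext(4) add[OF h]
      by (intro conjI find fin1) simp
  next
    fix u w c x p
    assume f: "f = single_word (u @ [sm c x] @ w) - fscale c (single_word (u @ [x] @ w))"
      and h: "u \<in> LW" "w \<in> LW" "x \<in> V p"
    show ?thesis
      unfolding f by (intro conjI find fins fin1)
        (simp add: ext(2,3,4) fins fin1 scale[OF h, simplified])
  next
    fix u w x y p q
    assume f: "f = single_word (u @ [x, y] @ w) - fscale (koszul p q) (single_word (u @ [y, x] @ w))"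
      and h: "u \<in> LW" "w \<in> LW" "x \<in> V p" "y \<in> V q"
    show ?thesis
      unfolding f by (intro conjI find fins fin1)
        (simp add: ext(2,3,4) fins fin1 comm[OF h, simplified])
  qed
  have relspan: "finite {w. f w \<noteq> 0} \<and> linear_ext s \<Phi> f = 0"
    if "f \<in> module.span fscale (lambda_relations A V)" for f
    using that
  proof (induct rule: f.span_induct_alt)
    case base then show ?case by (simp add: linear_ext_def)
  next
    case (step c x y)
    have x: "finite {w. x w \<noteq> 0}" "linear_ext s \<Phi> x = 0"
      and y: "finite {w. y w \<noteq> 0}" "linear_ext s \<Phi> y = 0"
      using step rel by blast+
    have "finite {w. (fscale c x + y) w \<noteq> 0}"
      by (rule finite_subset[OF _ finite_UnI[OF x(1) y(1)]]) (auto simp: fscale_def)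
    then show ?case
      unfolding ext(1)[OF fins[OF x(1)] y(1)] ext(2)[OF x(1)] x(2) y(2) by simp
  qed
  have ws: "finite {w. f w \<noteq> 0}" if "f \<in> word_space V" for f
    using that by (simp add: word_space_def)
  have ws_comb: "f + g \<in> word_space V" "fscale c f \<in> word_space V" "f - g \<in> word_space V"
    if "f \<in> word_space V" "g \<in> word_space V" for f g c
  proof -
    have "finite {w. (f + g) w \<noteq> 0}" "finite {w. (f - g) w \<noteq> 0}"
      by (rule finite_subset[OF _ finite_UnI[OF ws[OF that(1)] ws[OF that(2)]]]; auto)+
    moreover have "f w = 0" "g w = 0" if "w \<notin> LW" for w
      using that \<open>f \<in> word_space V\<close> \<open>g \<in> word_space V\<close> by (auto simp: word_space_def)
    then have "{w. (f + g) w \<noteq> 0} \<subseteq> LW" "{w. (f - g) w \<noteq> 0} \<subseteq> LW" "{w. fscale c f w \<noteq> 0} \<subseteq> LW"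
      by (force simp: fscale_def)+
    ultimately show "f + g \<in> word_space V" "fscale c f \<in> word_space V" "f - g \<in> word_space V"
      using fins[OF ws[OF that(1)], of c] by (simp_all add: word_space_def)
  qed
  have eq: "linear_ext s \<Phi> f = linear_ext s \<Phi> g"
    if "f \<in> word_space V" "g \<in> word_space V" "word_eval A f = word_eval A g" for f g
  proof -
    note fin = ws[OF that(1)] ws[OF that(2)]
    have "word_eval A (f - g) = 0"
      unfolding word_eval_ext extA(3)[OF fin] using that(3) by (simp add: word_eval_ext)
    then have "linear_ext s \<Phi> (f - g) = 0"
      using word_eval_0D[OF ws_comb(3)[OF that(1,2)]] relspan by blast
    then show ?thesis unfolding ext(3)[OF fin] by simp
  qed
  define rep where "rep x = (SOME f. f \<in> word_space V \<and> word_eval A f = x)" for x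
  have rep: "rep x \<in> word_space V \<and> word_eval A (rep x) = x" for x
    unfolding rep_def by (rule someI_ex[OF word_eval_surj])
  have "Vector_Spaces.linear sm s (\<lambda>x. linear_ext s \<Phi> (rep x))"
  proof (rule linearI[OF vs s])
    fix x y c
    have repw: "rep x \<in> word_space V" for x using rep by blast
    have repe: "linear_ext sm val (rep x) = x" for x
      using rep unfolding word_eval_ext by blast
    note fin = ws[OF repw]
    have "linear_ext s \<Phi> (rep (x + y)) = linear_ext s \<Phi> (rep x + rep y)"
      by (rule eq[OF repw ws_comb(1)[OF repw repw]])
        (simp only: word_eval_ext extA(1)[OF fin fin] repe)
    then show "linear_ext s \<Phi> (rep (x + y)) = linear_ext s \<Phi> (rep x) + linear_ext s \<Phi> (rep y)"
      unfolding ext(1)[OF fin fin] .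
    have "linear_ext s \<Phi> (rep (sm c x)) = linear_ext s \<Phi> (fscale c (rep x))"
      by (rule eq[OF repw ws_comb(2)[OF repw repw]])
        (simp only: word_eval_ext extA(2)[OF fin] repe)
    then show "linear_ext s \<Phi> (rep (sm c x)) = s c (linear_ext s \<Phi> (rep x))"
      unfolding ext(2)[OF fin] .
  qed
  moreover have "linear_ext s \<Phi> (rep (val w)) = \<Phi> w" if "w \<in> LW" for w
  proof -
    have "single_word w \<in> word_space V"
      using that fin1[of w] by (auto simp: word_space_def single_word_def)
    moreover have "word_eval A (single_word w) = val w"
      by (simp add: word_eval_ext extA(4))
    ultimately have "linear_ext s \<Phi> (rep (val w)) = linear_ext s \<Phi> (single_word w)"
      using rep[of "val w"] eq by metis
    then show ?thesis by (simp add: ext(4))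
  qed
  ultimately show ?thesis by (intro exI[of _ "\<lambda>x. linear_ext s \<Phi> (rep x)"]) simp
qed

section \<open>The universal derivation\<close>

text \<open>The Boolean carries the parity of the generator in the last slot, on which the sign
  rules depend; bilinearity is required for each parity separately.\<close>

definition bil :: "(rat \<Rightarrow> 'y::ab_group_add \<Rightarrow> 'y) \<Rightarrow> (bool \<Rightarrow> 'a \<Rightarrow> 'a \<Rightarrow> 'y) \<Rightarrow> bool" where
  "bil s F \<longleftrightarrow>
     (\<forall>\<epsilon> x y v. F \<epsilon> (x + y) v = F \<epsilon> x v + F \<epsilon> y v) \<and> (\<forall>\<epsilon> r x v. F \<epsilon> (sm r x) v = s r (F \<epsilon> x v)) \<and>
     (\<forall>\<epsilon> c x y. F \<epsilon> c (x + y) = F \<epsilon> c x + F \<epsilon> c y) \<and> (\<forall>\<epsilon> r c x. F \<epsilon> c (sm r x) = s r (F \<epsilon> c x))"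

lemma bilD:
  assumes "bil s F"
  shows "F \<epsilon> (x + y) v = F \<epsilon> x v + F \<epsilon> y v" "F \<epsilon> (sm r x) v = s r (F \<epsilon> x v)"
    "F \<epsilon> c (x + y) = F \<epsilon> c x + F \<epsilon> c y" "F \<epsilon> c (sm r x) = s r (F \<epsilon> c x)"
    "F \<epsilon> 0 v = 0" "F \<epsilon> c 0 = 0"
proof -
  show "F \<epsilon> (x + y) v = F \<epsilon> x v + F \<epsilon> y v" "F \<epsilon> (sm r x) v = s r (F \<epsilon> x v)"
    "F \<epsilon> c (x + y) = F \<epsilon> c x + F \<epsilon> c y" "F \<epsilon> c (sm r x) = s r (F \<epsilon> c x)" for x y v r c
    using assms by (auto simp: bil_def)
  from this(1)[of 0 0 v] this(3)[of c 0 0] show "F \<epsilon> 0 v = 0" "F \<epsilon> c 0 = 0"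
    by simp_all
qed

text \<open>\<open>par v\<close> is the parity of the degree of \<open>v\<close>; it is junk on inhomogeneous elements.\<close>

definition par :: "'a \<Rightarrow> bool" where
  "par x \<longleftrightarrow> (\<exists>p. odd p \<and> x \<in> V p \<and> x \<noteq> 0)"

abbreviation tw :: "bool \<Rightarrow> 'a \<Rightarrow> 'a" where
  "tw \<epsilon> c \<equiv> (if \<epsilon> then tau c else c)"

text \<open>The removed letter is thought of as moved to the right end of the word. It passes the
  letters behind it, which twists them if it is odd; the product of the remaining coefficient with
  the letter gives back the word.\<close>

primrec wdel :: "'a list \<Rightarrow> (bool \<times> 'a \<times> 'a) list" where
  "wdel [] = []"
| "wdel (x # w) = (par x, tw (par x) (val w), x) # map (\<lambda>(\<epsilon>, c, v). (\<epsilon>, x \<odot> c, v)) (wdel w)"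

definition wsum :: "(bool \<Rightarrow> 'a \<Rightarrow> 'a \<Rightarrow> 'y::ab_group_add) \<Rightarrow> 'a list \<Rightarrow> 'y" where
  "wsum F w = (\<Sum>(\<epsilon>, c, v)\<leftarrow>wdel w. F \<epsilon> c v)"

lemma wsum_Nil [simp]: "wsum F [] = 0"
  by (simp add: wsum_def)

lemma wsum_Cons:
  "wsum F (x # w) = F (par x) (tw (par x) (val w)) x + wsum (\<lambda>\<epsilon> c v. F \<epsilon> (x \<odot> c) v) w"
  by (simp add: wsum_def comp_def case_prod_unfold)

lemma wsum_add: "wsum (\<lambda>\<epsilon> c v. F \<epsilon> c v + G \<epsilon> c v) w = wsum F w + wsum G w"
  by (simp add: wsum_def case_prod_unfold sum_list_addf)

lemma wsum_scale:
  assumes "vector_space s"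
  shows "wsum (\<lambda>\<epsilon> c v. s r (F \<epsilon> c v)) w = s r (wsum F w)"
proof -
  interpret vector_space s by fact
  have "(\<Sum>x\<leftarrow>L. s r (f x)) = s r (\<Sum>x\<leftarrow>L. f x)" for L :: "(bool \<times> 'a \<times> 'a) list" and f
    by (induct L) (simp_all add: scale_right_distrib)
  then show ?thesis by (simp add: wsum_def case_prod_unfold)
qed

lemma bil_mul: "bil s F \<Longrightarrow> bil s (\<lambda>\<epsilon> c v. F \<epsilon> (x \<odot> c) v)"
  by (simp add: bil_def mul_add_right)

lemma par_V: "x \<in> V p \<Longrightarrow> x \<noteq> 0 \<Longrightarrow> par x \<longleftrightarrow> odd p"
  unfolding par_def using gr_unique V_gr by metis

lemma bil_par: "bil s F \<Longrightarrow> x \<in> V p \<Longrightarrow> F (par x) (tw (par x) c) x = F (odd p) (tw (odd p) c) x"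
  by (cases "x = 0") (auto simp: par_V bilD(6))

lemma tw_add: "tw \<epsilon> (x + y) = tw \<epsilon> x + tw \<epsilon> y"
  and tw_mul: "tw \<epsilon> (x \<odot> y) = tw \<epsilon> x \<odot> tw \<epsilon> y"
  by (simp_all add: tau_add tau_mul)

lemma tw_gr: "x \<in> gr q \<Longrightarrow> tw (odd p) x = sm (koszul p q) x"
  by (auto simp: tau_gr koszul_def)

lemma val_V_comm: "x \<in> V p \<Longrightarrow> y \<in> V q \<Longrightarrow> val (u @ [x, y] @ w) = sm (koszul p q) (val (u @ [y, x] @ w))"
proof (induct u)
  case Nil
  then have "x \<odot> y = sm (koszul p q) (y \<odot> x)" using mul_comm V_gr by blast
  then show ?case by (simp flip: mul_assoc)
qed simp

text \<open>Swapping adjacent letters x and y interchanges the term that removes x with the term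
  that removes y, up to the Koszul sign; in all other terms the swap happens inside the coefficient.
  The induction over the prefix absorbs its letters into F, hence F is arbitrary.\<close>

lemma wsum_descends:
  fixes s :: "rat \<Rightarrow> 'y::ab_group_add \<Rightarrow> 'y"
  assumes s: "vector_space s" and F: "bil s F"
  shows "\<exists>g. Vector_Spaces.linear sm s g \<and> (\<forall>w\<in>LW. g (val w) = wsum F w)"
proof (rule word_descent[OF s])
  interpret s: vector_space s by fact
  show "wsum F (u @ [x + y] @ w) = wsum F (u @ [x] @ w) + wsum F (u @ [y] @ w)"
    if "x \<in> V p" "y \<in> V p" for u w x y p
    using F
  proof (induct u arbitrary: F)
    case Nil
    show ?case
      using bil_par[OF Nil that(1)] bil_par[OF Nil that(2)] bil_par[OF Nil V_add[OF that]]
      by (simp add: wsum_Cons mul_add_left bilD(1,3)[OF Nil] wsum_add algebra_simps)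
  next
    case (Cons z u)
    have "val (u @ [x + y] @ w) = val (u @ [x] @ w) + val (u @ [y] @ w)"
      by (simp add: val_append mul_add_left mul_add_right)
    then show ?case
      using Cons(1)[OF bil_mul[OF Cons(2)]]
      by (simp add: wsum_Cons tw_add tau_add bilD(1)[OF Cons(2)] algebra_simps)
  qed
  show "wsum F (u @ [sm r x] @ w) = s r (wsum F (u @ [x] @ w))"
    if "x \<in> V p" for u w x r p
    using F
  proof (induct u arbitrary: F)
    case Nil
    show ?case
      using bil_par[OF Nil that(1)] bil_par[OF Nil V_scale[OF that]]
      by (simp add: wsum_Cons bilD(2,4)[OF Nil] wsum_scale[OF s] s.scale_right_distrib)
  next
    case (Cons z u)
    have "val (u @ [sm r x] @ w) = sm r (val (u @ [x] @ w))"
      by (simp add: val_append)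
    then show ?case
      using Cons(1)[OF bil_mul[OF Cons(2)]]
      by (simp add: wsum_Cons bilD(2)[OF Cons(2)] s.scale_right_distrib)
  qed
  show "wsum F (u @ [x, y] @ w) = s (koszul p q) (wsum F (u @ [y, x] @ w))"
    if "x \<in> V p" "y \<in> V q" for u w x y p q
    using F
  proof (induct u arbitrary: F)
    case Nil
    note b = bil_mul[OF Nil]
    have c: "x \<odot> y \<odot> c = sm (koszul p q) (y \<odot> x \<odot> c)" for c
      using val_V_comm[OF that, of "[]" "[]"] by simp
    have "(\<lambda>\<epsilon> c v. F \<epsilon> (x \<odot> (y \<odot> c)) v) = (\<lambda>\<epsilon> c v. s (koszul p q) (F \<epsilon> (y \<odot> (x \<odot> c)) v))"
      by (intro ext) (simp add: c bilD(2)[OF Nil] flip: mul_assoc)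
    then have "wsum (\<lambda>\<epsilon> c v. F \<epsilon> (x \<odot> (y \<odot> c)) v) w = s (koszul p q) (wsum (\<lambda>\<epsilon> c v. F \<epsilon> (y \<odot> (x \<odot> c)) v) w)"
      by (simp only: wsum_scale[OF s])
    moreover have "F (par x) (tw (par x) (y \<odot> c)) x = s (koszul p q) (F (par x) (y \<odot> tw (par x) c) x)" for c
    proof -
      have "tw (odd p) (y \<odot> c) = sm (koszul p q) (y \<odot> tw (odd p) c)"
        using tw_mul[of "odd p" y c] tw_gr[OF V_gr[OF that(2)], of p] by simp
      then show ?thesis
        using bil_par[OF Nil that(1), of "y \<odot> c"] bil_par[OF b that(1), of y c]
        by (simp add: bilD(2)[OF Nil])
    qed
    moreover have "F (par y) (x \<odot> tw (par y) c) y = s (koszul p q) (F (par y) (tw (par y) (x \<odot> c)) y)" for c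
    proof -
      have "x \<odot> tw (odd q) c = sm (koszul p q) (tw (odd q) (x \<odot> c))"
        using tw_mul[of "odd q" x c] tw_gr[OF V_gr[OF that(1)], of q]
        by (simp add: koszul_sym[of q p])
      then show ?thesis
        using bil_par[OF Nil that(2), of "x \<odot> c"] bil_par[OF b that(2), of x c]
        by (simp add: bilD(2)[OF Nil])
    qed
    ultimately show ?case
      by (simp only: append.simps wsum_Cons val_Cons s.scale_right_distrib add_ac)
  next
    case (Cons z u)
    then show ?case
      using Cons(1)[OF bil_mul[OF Cons(2)]] val_V_comm[OF that, of u w]
      by (simp add: wsum_Cons bilD(2)[OF Cons(2)] s.scale_right_distrib)
  qed
qed

text \<open>The representation of c by words is chosen arbitrarily, so nothing ties
  \<open>Dl (x + y)\<close> to \<open>Dl x\<close> and \<open>Dl y\<close>. Only the pairing with a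
  map that satisfies \<open>bil\<close> is independent of the choice
  (\<open>del_ext\<close>).\<close>

definition Dl :: "'a \<Rightarrow> (bool \<times> 'a \<times> 'a) list" where
  "Dl c = concat (map (\<lambda>(r, w). map (\<lambda>(\<epsilon>, c, v). (\<epsilon>, sm r c, v)) (wdel w))
     (SOME L. (\<forall>(r, w)\<in>set L. w \<in> LW) \<and> c = (\<Sum>(r, w)\<leftarrow>L. sm r (val w))))"

text \<open>
  The universal right derivation \<open>c \<mapsto> \<Sum> \<partial>\<^sub>b c \<otimes> b\<close> into \<open>\<Lambda>V \<otimes> V\<close>, composed with a map \<open>F\<close> that is
  bilinear for either parity of \<open>b\<close>. It is an explicit sum of values of \<open>F\<close> and therefore commutes with
  every linear operation on \<open>F\<close>.
\<close>

definition del :: "(bool \<Rightarrow> 'a \<Rightarrow> 'a \<Rightarrow> 'y::ab_group_add) \<Rightarrow> 'a \<Rightarrow> 'y" where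
  "del F c = (\<Sum>(\<epsilon>, c, v)\<leftarrow>Dl c. F \<epsilon> c v)"

lemma del_ext:
  fixes s :: "rat \<Rightarrow> 'y::ab_group_add \<Rightarrow> 'y"
  assumes s: "vector_space s" and F: "bil s F"
  shows "\<exists>g. Vector_Spaces.linear sm s g \<and> del F = g \<and> (\<forall>w\<in>LW. g (val w) = wsum F w)"
proof -
  interpret s: vector_space s by fact
  obtain g where g: "Vector_Spaces.linear sm s g" "\<forall>w\<in>LW. g (val w) = wsum F w"
    using wsum_descends[OF s F] by blast
  interpret g: Vector_Spaces.linear sm s g by fact
  have "del F c = g c" for c
  proof -
    define L where "L = (SOME L. (\<forall>(r, w)\<in>set L. w \<in> LW) \<and> c = (\<Sum>(r, w)\<leftarrow>L. sm r (val w)))"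
    have L: "(\<forall>(r, w)\<in>set L. w \<in> LW) \<and> c = (\<Sum>(r, w)\<leftarrow>L. sm r (val w))"
      unfolding L_def by (rule someI_ex[OF word_rep])
    have "(\<Sum>(\<epsilon>, c, v)\<leftarrow>concat (map (\<lambda>(r, w). map (\<lambda>(\<epsilon>, c, v). (\<epsilon>, sm r c, v)) (wdel w)) L). F \<epsilon> c v)
        = g (\<Sum>(r, w)\<leftarrow>L. sm r (val w))"
      using L[THEN conjunct1]
    proof (induct L)
      case Nil then show ?case by (simp add: g.zero)
    next
      case (Cons a L)
      obtain r w where a: "a = (r, w)" by force
      have "(\<Sum>(\<epsilon>, c, v)\<leftarrow>map (\<lambda>(\<epsilon>, c, v). (\<epsilon>, sm r c, v)) (wdel w). F \<epsilon> c v)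
          = wsum (\<lambda>\<epsilon> c v. s r (F \<epsilon> c v)) w"
        by (simp add: wsum_def comp_def case_prod_unfold bilD(2)[OF F])
      then show ?case
        using Cons g(2) by (simp add: a wsum_scale[OF s] g.add g.scale)
    qed
    then show ?thesis
      unfolding del_def Dl_def L_def[symmetric] using L[THEN conjunct2] by simp
  qed
  then show ?thesis using g by blast
qed

lemma
  fixes s :: "rat \<Rightarrow> 'y::ab_group_add \<Rightarrow> 'y"
  assumes s: "vector_space s" and F: "bil s F"
  shows del_arg_add: "del F (x + y) = del F x + del F y"
    and del_arg_scale: "del F (sm r x) = s r (del F x)"
    and del_val: "w \<in> LW \<Longrightarrow> del F (val w) = wsum F w"
  using del_ext[OF s F] by (auto simp: Vector_Spaces.linear_iff)

lemma wdel_par: "w \<in> LW \<Longrightarrow> (\<epsilon>, c, v) \<in> set (wdel w) \<Longrightarrow> \<exists>p. v \<in> V p \<and> (odd p \<longleftrightarrow> \<epsilon>)"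
proof (induct w arbitrary: c)
  case (Cons x w)
  consider "v = x" "\<epsilon> = par x" | c where "(\<epsilon>, c, v) \<in> set (wdel w)"
    using Cons(3) by auto
  then show ?case
  proof cases
    case 1
    then show ?thesis
      using Cons(2) par_V[of x] by (cases "x = 0") (auto simp: LW_Cons par_def intro: exI[of _ 0])
  next
    case 2
    then show ?thesis using Cons by (auto simp: LW_Cons)
  qed
qed simp

lemma Dl_par: "(\<epsilon>, c', v) \<in> set (Dl c) \<Longrightarrow> \<exists>p. v \<in> V p \<and> (odd p \<longleftrightarrow> \<epsilon>)"
proof -
  define L where "L = (SOME L. (\<forall>(r, w)\<in>set L. w \<in> LW) \<and> c = (\<Sum>(r, w)\<leftarrow>L. sm r (val w)))"
  have L: "(\<forall>(r, w)\<in>set L. w \<in> LW) \<and> c = (\<Sum>(r, w)\<leftarrow>L. sm r (val w))"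
    unfolding L_def by (rule someI_ex[OF word_rep])
  assume "(\<epsilon>, c', v) \<in> set (Dl c)"
  then show ?thesis
    using L wdel_par unfolding Dl_def L_def[symmetric] by fastforce
qed

text \<open>Every entry of \<open>Dl\<close> carries a generator together with its true parity, so
  the two maps may differ where the Boolean and the degree disagree. The sign computations below
  rely on this.\<close>

lemma del_cong:
  "(\<And>\<epsilon> c v p. v \<in> V p \<Longrightarrow> odd p \<longleftrightarrow> \<epsilon> \<Longrightarrow> F \<epsilon> c v = G \<epsilon> c v) \<Longrightarrow> del F c = del G c"
  unfolding del_def using Dl_par by (intro arg_cong[of _ _ sum_list] map_cong) force+

lemma del_0 [simp]: "del (\<lambda>\<epsilon> c v. 0) c = 0"
  by (simp add: del_def case_prod_unfold)
lemma del_add: "del (\<lambda>\<epsilon> c v. F \<epsilon> c v + G \<epsilon> c v) c = del F c + del G c"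
  by (simp add: del_def case_prod_unfold sum_list_addf)
lemma del_uminus: "del (\<lambda>\<epsilon> c v. - F \<epsilon> c v) c = - del F c"
  by (rule minus_unique[symmetric]) (use del_add[of F "\<lambda>\<epsilon> c v. - F \<epsilon> c v" c] in simp)
lemma del_diff: "del (\<lambda>\<epsilon> c v. F \<epsilon> c v - G \<epsilon> c v) c = del F c - del G c"
  using del_add[of F "\<lambda>\<epsilon> c v. - G \<epsilon> c v" c] by (simp add: del_uminus)

lemma del_commute:
  assumes "\<And>f g. O' (\<lambda>y. f y + g y) = O' f + O' g"
  shows "O' (\<lambda>y. del (\<lambda>\<epsilon> c v. K \<epsilon> c v y) c) = del (\<lambda>\<epsilon> c v. O' (K \<epsilon> c v)) c"
proof -
  have 0: "O' (\<lambda>y. 0) = 0" using assms[of "\<lambda>y. 0" "\<lambda>y. 0"] by simp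
  have "O' (\<lambda>y. \<Sum>(\<epsilon>, c, v)\<leftarrow>L. K \<epsilon> c v y) = (\<Sum>(\<epsilon>, c, v)\<leftarrow>L. O' (K \<epsilon> c v))" for L
    by (induct L) (simp_all add: 0 assms case_prod_unfold)
  then show ?thesis by (simp add: del_def)
qed

text \<open>A generator split off from a has to pass b on its way to the right end, which twists
  b.\<close>

lemma del_mul:
  fixes s :: "rat \<Rightarrow> 'y::ab_group_add \<Rightarrow> 'y"
  assumes s: "vector_space s" and F: "bil s F"
  shows "del F (a \<odot> b) =
    del (\<lambda>\<epsilon> c v. F \<epsilon> (a \<odot> c) v) b + del (\<lambda>\<epsilon> c v. F \<epsilon> (c \<odot> tw \<epsilon> b) v) a"
proof -
  interpret s: vector_space s by fact
  have b1: "bil s (\<lambda>\<epsilon> c v. F \<epsilon> (c \<odot> tw \<epsilon> b) v)" if "bil s F" for b F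
    using that by (simp add: bil_def mul_add_left)
  note rules = del_arg_add[OF s] del_arg_scale[OF s]
  have words: "wsum F (u @ w) = wsum (\<lambda>\<epsilon> c v. F \<epsilon> (val u \<odot> c) v) w
      + wsum (\<lambda>\<epsilon> c v. F \<epsilon> (c \<odot> tw \<epsilon> (val w)) v) u" if "bil s F" for u w F
    using that
  proof (induct u arbitrary: F)
    case (Cons x u)
    show ?case
      using Cons(1)[OF bil_mul[OF Cons(2), of x]]
      by (simp add: wsum_Cons mul_assoc val_append tau_mul add_ac)
  qed simp
  show ?thesis
    using F
  proof (induct a arbitrary: F rule: word_induct)
    case (word r u)
    note a = this
    show ?case
    proof (induct b rule: word_induct)
      case (word q w)
      have "del F (sm q (sm r (val (u @ w)))) = s q (s r (wsum F (u @ w)))"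
        using a word by (simp add: rules[OF a(2)] del_val[OF s a(2)])
      moreover have "del (\<lambda>\<epsilon> c v. F \<epsilon> (sm r (val u) \<odot> c) v) (sm q (val w)) =
          s q (s r (wsum (\<lambda>\<epsilon> c v. F \<epsilon> (val u \<odot> c) v) w))"
        using word by (simp only: rules[OF bil_mul[OF a(2)]] del_val[OF s bil_mul[OF a(2)]])
          (simp add: bilD(2)[OF a(2)] wsum_scale[OF s])
      moreover have "del (\<lambda>\<epsilon> c v. F \<epsilon> (c \<odot> tw \<epsilon> (sm q (val w))) v) (sm r (val u)) =
          s q (s r (wsum (\<lambda>\<epsilon> c v. F \<epsilon> (c \<odot> tw \<epsilon> (val w)) v) u))"
      proof -
        have "(\<lambda>\<epsilon> c v. F \<epsilon> (c \<odot> tw \<epsilon> (sm q (val w))) v) =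
            (\<lambda>\<epsilon> c v. s q (F \<epsilon> (c \<odot> tw \<epsilon> (val w)) v))"
          by (intro ext) (simp add: bilD(2)[OF a(2)])
        then have "wsum (\<lambda>\<epsilon> c v. F \<epsilon> (c \<odot> tw \<epsilon> (sm q (val w))) v) u =
            s q (wsum (\<lambda>\<epsilon> c v. F \<epsilon> (c \<odot> tw \<epsilon> (val w)) v) u)"
          by (simp only: wsum_scale[OF s])
        then show ?thesis
          using rules(2)[OF b1[OF a(2)], of "sm q (val w)" r "val u"]
            del_val[OF s b1[OF a(2)] a(1), of "sm q (val w)"]
          by (simp add: mult.commute)
      qed
      ultimately show ?case
        using words[OF a(2), of u w] by (simp add: val_append s.scale_right_distrib)
    next
      case (add x y)
      have "(\<lambda>\<epsilon> c v. F \<epsilon> (c \<odot> tw \<epsilon> (x + y)) v) =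
          (\<lambda>\<epsilon> c v. F \<epsilon> (c \<odot> tw \<epsilon> x) v + F \<epsilon> (c \<odot> tw \<epsilon> y) v)"
        by (intro ext) (simp add: tau_add mul_add_right bilD(1)[OF a(2)])
      then show ?case
        using add by (simp only: mul_add_right rules[OF a(2)] rules[OF bil_mul[OF a(2)]] del_add add_ac)
    qed
  next
    case (add x y)
    have "(\<lambda>\<epsilon> c v. F \<epsilon> ((x + y) \<odot> c) v) =
        (\<lambda>\<epsilon> c v. F \<epsilon> (x \<odot> c) v + F \<epsilon> (y \<odot> c) v)"
      by (intro ext) (simp add: mul_add_left bilD(1)[OF add(3)])
    then show ?case
      using add(1)[OF add(3)] add(2)[OF add(3)]
      by (simp only: mul_add_left rules[OF add(3)] rules[OF b1[OF add(3)]] del_add add_ac)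
  qed
qed

section \<open>Augmentation and word length\<close>

text \<open>The augmentation, built from its values on words so that it can be computed by word
  induction; \<open>aug_eps\<close> identifies it with \<open>aug A\<close>.\<close>

definition eps :: "'a \<Rightarrow> rat" where
  "eps = (SOME g. Vector_Spaces.linear sm (*) g \<and> (\<forall>w\<in>LW. g (val w) = (if w = [] then 1 else 0)))"

lemma eps_spec: "Vector_Spaces.linear sm (*) eps \<and> (\<forall>w\<in>LW. eps (val w) = (if w = [] then 1 else 0))"
proof -
  have "\<exists>g. Vector_Spaces.linear sm (*) g \<and> (\<forall>w\<in>LW. g (val w) = (if w = [] then (1::rat) else 0))"
    by (rule word_descent[OF vector_space_rat]) simp_all
  then show ?thesis unfolding eps_def by (rule someI_ex)
qed

lemma eps_add: "eps (x + y) = eps x + eps y" and eps_scale [simp]: "eps (sm r x) = r * eps x"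
  and eps_val: "w \<in> LW \<Longrightarrow> eps (val w) = (if w = [] then 1 else 0)"
  using eps_spec by (auto simp: Vector_Spaces.linear_iff)

lemma eps_zero [simp]: "eps 0 = 0"
  using eps_add[of 0 0] by simp
lemma eps_uminus [simp]: "eps (- x) = - eps x"
  by (rule minus_unique[symmetric]) (simp flip: eps_add)
lemma eps_diff: "eps (x - y) = eps x - eps y"
  using eps_add[of x "- y"] by simp
lemma eps_one [simp]: "eps one = 1"
  using eps_val[of "[]"] by simp
lemma one_nonzero: "one \<noteq> 0"
  using eps_one eps_zero by force

lemma eps_mul: "eps (x \<odot> y) = eps x * eps y"
proof (induct x rule: word_induct)
  case (word r u)
  note u = this
  show ?case
  proof (induct y rule: word_induct)
    case (word q w)
    then show ?case using u by (simp add: eps_val flip: val_append)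
  qed (simp only: mul_add_right eps_add distrib_left)
qed (simp only: mul_add_left eps_add distrib_right)

text \<open>The decreasing filtration by word length. \<open>Fil (Suc 0)\<close> is the augmentation
  ideal (\<open>Fil_1_iff\<close>), and minimality of the model enters as \<open>d_Fil\<close>: the
  differential raises the filtration by one.\<close>

definition Fil :: "nat \<Rightarrow> 'a set" where
  "Fil m = vs.span (val ` {w \<in> LW. m \<le> length w})"

lemma Fil_zero [simp]: "0 \<in> Fil m"
  and Fil_add: "x \<in> Fil m \<Longrightarrow> y \<in> Fil m \<Longrightarrow> x + y \<in> Fil m"
  and Fil_scale: "x \<in> Fil m \<Longrightarrow> sm r x \<in> Fil m"
  and Fil_uminus: "x \<in> Fil m \<Longrightarrow> - x \<in> Fil m"
  unfolding Fil_def by (auto intro: vs.span_zero vs.span_add vs.span_scale vs.span_neg)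

lemma val_Fil: "w \<in> LW \<Longrightarrow> m \<le> length w \<Longrightarrow> val w \<in> Fil m"
  unfolding Fil_def by (auto intro: vs.span_base)

lemma Fil_induct [consumes 1, case_names zero word]:
  assumes "x \<in> Fil m" "P 0"
    "\<And>r w y. w \<in> LW \<Longrightarrow> m \<le> length w \<Longrightarrow> P y \<Longrightarrow> P (sm r (val w) + y)"
  shows "P x"
  using assms(1) unfolding Fil_def
  by (induct rule: vs.span_induct_alt) (use assms in auto)

lemma Fil_mono: "m \<le> k \<Longrightarrow> Fil k \<subseteq> Fil m"
  unfolding Fil_def by (rule vs.span_mono) auto

lemma Fil_0 [simp]: "x \<in> Fil 0"
  by (induct x rule: word_induct) (auto intro: Fil_scale Fil_add val_Fil)

lemma V_Fil: "x \<in> V p \<Longrightarrow> x \<in> Fil (Suc 0)"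
  using val_Fil[of "[x]" "Suc 0"] by (auto simp: LW_Cons)

lemma Fil_mul:
  assumes "x \<in> Fil m" "y \<in> Fil k"
  shows "x \<odot> y \<in> Fil (m + k)"
  using assms(1)
proof (induct rule: Fil_induct)
  case (word r u x)
  have "val u \<odot> y \<in> Fil (m + k)"
    using assms(2)
  proof (induct rule: Fil_induct)
    case (word q w y)
    have "val u \<odot> val w \<in> Fil (m + k)"
      using val_Fil[of "u @ w" "m + k"] word \<open>u \<in> LW\<close> \<open>m \<le> length u\<close> by (simp add: val_append)
    then show ?case using word by (simp add: mul_add_right Fil_add Fil_scale)
  qed simp
  then show ?case using word by (simp add: mul_add_left Fil_add Fil_scale)
qed simp

lemma reduce_Fil: "x - sm (eps x) one \<in> Fil (Suc 0)"
proof (induct x rule: word_induct)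
  case (word r w)
  show ?case
  proof (cases "w = []")
    case False
    then have "Suc 0 \<le> length w" by (cases w) auto
    then show ?thesis using word False by (simp add: eps_val Fil_scale val_Fil)
  qed simp
next
  case (add x y)
  have "x + y - sm (eps (x + y)) one = (x - sm (eps x) one) + (y - sm (eps y) one)"
    by (simp add: eps_add vs.scale_left_distrib)
  then show ?case using Fil_add[OF add] by (simp only:)
qed

lemma eps_Fil: "x \<in> Fil (Suc 0) \<Longrightarrow> eps x = 0"
  by (induct rule: Fil_induct) (auto simp: eps_add eps_val)

lemma Fil_1_iff: "x \<in> Fil (Suc 0) \<longleftrightarrow> eps x = 0"
  using reduce_Fil[of x] eps_Fil[of x] by auto

lemma tau_V: "x \<in> V p \<Longrightarrow> tau x \<in> V p"
  using tau_gr[OF V_gr] V_scale by metis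

lemma tau_val: "tau (val w) = val (map tau w)"
  by (induct w) (simp_all add: tau_mul)

lemma tau_LW: "w \<in> LW \<Longrightarrow> map tau w \<in> LW"
  by (induct w) (auto simp: LW_Cons intro: tau_V)

lemma tau_Fil: "x \<in> Fil m \<Longrightarrow> tau x \<in> Fil m"
  by (induct rule: Fil_induct) (simp_all add: tau_add tau_val Fil_add Fil_scale val_Fil tau_LW)

text \<open>Nonzero letters have degree at least 2 by \<open>V_ge2\<close>. If a letter is zero, the
  value of the word is zero and lies in every degree.\<close>

lemma val_gr: "w \<in> LW \<Longrightarrow> \<exists>q \<ge> 2 * int (length w). val w \<in> gr q"
proof (induct w)
  case (Cons x w)
  then obtain p q where p: "x \<in> V p" and q: "2 * int (length w) \<le> q" "val w \<in> gr q"
    by (auto simp: LW_Cons)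
  show ?case
  proof (cases "x = 0")
    case False
    then have "2 \<le> p" using V_ge2 p by blast
    then show ?thesis
      using q mul_gr[OF V_gr[OF p] q(2)] by (intro exI[of _ "p + q"]) auto
  qed auto
qed (use one_gr in auto)

lemma Fil_hcomp: "x \<in> Fil m \<Longrightarrow> p < 2 * int m \<Longrightarrow> hcomp gr x p = 0"
proof (induct rule: Fil_induct)
  case zero
  then show ?case using hcomp_scale[of 0 0 p] by simp
next
  case (word r w y)
  then obtain q where "q \<ge> 2 * int (length w)" "val w \<in> gr q" using val_gr[of w] by blast
  moreover have "p \<noteq> q" using word calculation by simp
  ultimately show ?case using word by (simp add: hcomp_add hcomp_scale hcomp_hom)
qed

lemma hcomp_reduce: "p < 2 \<Longrightarrow> hcomp gr x p = (if p = 0 then sm (eps x) one else 0)"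
  using Fil_hcomp[OF reduce_Fil, of p x] hcomp_add[of "x - sm (eps x) one" "sm (eps x) one" p]
  by (simp add: hcomp_scale hcomp_hom[OF one_gr])

lemma gr_0_eq: "x \<in> gr 0 \<Longrightarrow> x = sm (eps x) one"
  using hcomp_reduce[of 0 x] by (simp add: hcomp_hom)

lemma gr_low: "x \<in> gr p \<Longrightarrow> p < 2 \<Longrightarrow> p \<noteq> 0 \<Longrightarrow> x = 0"
  using hcomp_reduce[of p x] by (simp add: hcomp_hom)

lemma eps_gr: "x \<in> gr p \<Longrightarrow> p \<noteq> 0 \<Longrightarrow> eps x = 0"
  using hcomp_reduce[of 0 x] one_nonzero by (simp add: hcomp_hom split: if_splits)

lemma gr_Fil: "x \<in> gr p \<Longrightarrow> p \<noteq> 0 \<Longrightarrow> x \<in> Fil (Suc 0)"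
  by (simp add: Fil_1_iff eps_gr)

lemma decomposables_Fil: "decomposables A \<subseteq> Fil 2"
  unfolding decomposables_def
proof (rule vs.span_minimal)
  show "vs.subspace (Fil 2)" unfolding Fil_def by simp
  show "{x \<odot> y |x y p q. 0 < p \<and> 0 < q \<and> x \<in> gr p \<and> y \<in> gr q} \<subseteq> Fil 2"
  proof clarify
    fix x y p q assume "0 < p" "0 < q" "x \<in> gr p" "y \<in> gr q"
    then have "x \<odot> y \<in> Fil (Suc 0 + Suc 0)" by (intro Fil_mul gr_Fil[of _ p] gr_Fil[of _ q]) auto
    then show "x \<odot> y \<in> Fil 2" by (simp add: numeral_2_eq_2)
  qed
qed

lemma d_val: "w \<in> LW \<Longrightarrow> d (val w) \<in> Fil (Suc (length w))"
proof (induct w)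
  case (Cons x w)
  then obtain p where p: "x \<in> V p" and w: "w \<in> LW" by (auto simp: LW_Cons)
  have "d x \<odot> val w \<in> Fil (2 + length w)"
    using V_decomposable[OF p] decomposables_Fil val_Fil[OF w] by (blast intro: Fil_mul)
  moreover have "tau x \<odot> d (val w) \<in> Fil (Suc 0 + Suc (length w))"
    using Cons(1)[OF w] V_Fil[OF tau_V[OF p]] by (blast intro: Fil_mul)
  ultimately show ?case by (simp add: d_mul Fil_add)
qed simp

lemma d_Fil: "x \<in> Fil m \<Longrightarrow> d x \<in> Fil (Suc m)"
proof (induct rule: Fil_induct)
  case (word r w y)
  then have "d (val w) \<in> Fil (Suc m)" using d_val[of w] Fil_mono[of "Suc m" "Suc (length w)"] by auto
  then show ?case using word by (simp add: d_add Fil_add Fil_scale)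
qed simp

lemma d_Fil_2: "d x \<in> Fil 2"
proof -
  have "d x = d (x - sm (eps x) one)"
    using d_add[of "x - sm (eps x) one" "sm (eps x) one"] by simp
  then show ?thesis using d_Fil[OF reduce_Fil[of x]] by (simp add: numeral_2_eq_2)
qed

lemma eps_d [simp]: "eps (d x) = 0"
  using d_Fil_2[of x] Fil_mono[of "Suc 0" 2] eps_Fil by auto

lemma eps_tau [simp]: "eps (tau x) = eps x"
proof (induct x rule: hom_induct)
  case (hom p x)
  then show ?case by (cases "p = 0") (simp_all add: tau_gr eps_gr koszul_def)
qed (simp add: tau_add eps_add)

lemma eps_mor: "cdga_mor A ground_cdga eps"
  unfolding cdga_mor_def using eps_spec by (auto simp: eps_mul eps_gr)

lemma aug_eps: "aug A = eps"
  unfolding aug_def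
proof (rule the_equality)
  fix e assume e: "cdga_mor A ground_cdga e"
  have add: "e (x + y) = e x + e y" and scale: "e (sm r x) = r * e x"
    and mul: "e (x \<odot> y) = e x * e y" and one: "e one = 1" for x y r
    using e unfolding cdga_mor_def by (simp_all add: Vector_Spaces.linear_iff)
  have zero: "e x = 0" if "x \<in> gr p" "p \<noteq> 0" for x p
    using e that unfolding cdga_mor_def by (auto split: if_splits)
  show "e = eps"
  proof
    fix x show "e x = eps x"
    proof (induct x rule: word_induct)
      case (word r w)
      show ?case
      proof (cases "w = []")
        case False
        obtain q where q: "2 * int (length w) \<le> q" "val w \<in> gr q" using val_gr[OF word] by blast
        then have "q \<noteq> 0" using False by (cases w) auto
        then show ?thesis using zero[OF q(2)] eps_gr[OF q(2)] by (simp add: scale)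
      qed (simp add: scale one)
    qed (simp add: add eps_add)
  qed
qed (rule eps_mor)

lemma wdel_Fil: "w \<in> LW \<Longrightarrow> (\<epsilon>, c, v) \<in> set (wdel w) \<Longrightarrow> c \<in> Fil (length w - 1) \<and> (\<exists>p. v \<in> V p)"
proof (induct w arbitrary: c)
  case (Cons x w)
  then obtain p where p: "x \<in> V p" and w: "w \<in> LW" by (auto simp: LW_Cons)
  consider "v = x" "c = tw (par x) (val w)" | c' where "(\<epsilon>, c', v) \<in> set (wdel w)" "c = x \<odot> c'"
    using Cons(3) by auto
  then show ?case
  proof cases
    case 1
    then show ?thesis using val_Fil[OF w, of "length w"] tau_Fil p by auto
  next
    case 2
    then have "w \<noteq> []" by auto
    then have "Suc 0 + (length w - 1) = length (x # w) - 1" by (cases w) auto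
    moreover have "c \<in> Fil (Suc 0 + (length w - 1))"
      unfolding 2(2) using Cons(1)[OF w 2(1)] by (intro Fil_mul V_Fil[OF p]) blast
    ultimately show ?thesis
      using Cons(1)[OF w 2(1)] by simp
  qed
qed simp

text \<open>Removing a letter costs one unit of word length, so only coefficients in
  \<open>Fil (m - 1)\<close> are ever fed to F.\<close>

lemma del_Fil:
  fixes s :: "rat \<Rightarrow> 'y::ab_group_add \<Rightarrow> 'y"
  assumes s: "vector_space s" and F: "bil s F" and c: "c \<in> Fil m"
    and 0: "\<And>\<epsilon> c' v p. c' \<in> Fil (m - 1) \<Longrightarrow> v \<in> V p \<Longrightarrow> F \<epsilon> c' v = 0"
  shows "del F c = 0"
proof -
  interpret s: vector_space s by fact
  show ?thesis
    using c
  proof (induct rule: Fil_induct)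
    case zero
    show ?case using del_arg_scale[OF s F, of 0 0] by simp
  next
    case (word r w y)
    have "F \<epsilon> c v = 0" if t: "(\<epsilon>, c, v) \<in> set (wdel w)" for \<epsilon> c v
    proof -
      obtain p where p: "v \<in> V p" and c: "c \<in> Fil (length w - 1)"
        using wdel_Fil[OF word(1) t] by blast
      have "m - 1 \<le> length w - 1" using word(2) by simp
      then have "c \<in> Fil (m - 1)" using Fil_mono c by blast
      then show ?thesis by (rule 0[OF _ p])
    qed
    then have "map (\<lambda>(\<epsilon>, c, v). F \<epsilon> c v) (wdel w) = map (\<lambda>t. 0) (wdel w)"
      by (intro list.map_cong0) auto
    then have "wsum F w = 0" by (simp add: wsum_def del: map_eq_conv)
    then show ?case
      using word by (simp add: del_arg_add[OF s F] del_arg_scale[OF s F] del_val[OF s F])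
  qed
qed

lemma del_V:
  fixes s :: "rat \<Rightarrow> 'y::ab_group_add \<Rightarrow> 'y"
  assumes "vector_space s" "bil s F" "v \<in> V p"
  shows "del F v = F (odd p) one v"
proof -
  have "[v] \<in> LW" using assms(3) by (auto simp: LW_Cons)
  then show ?thesis
    using del_val[OF assms(1,2), of "[v]"] bil_par[OF assms(2,3), of one]
    by (simp only: wsum_Cons wsum_Nil val_Nil val_Cons mul_one tau_one if_cancel add_0_right)
qed

lemma wsum_tau:
  assumes "bil s F" "w \<in> LW"
  shows "wsum F (map tau w) = wsum (\<lambda>\<epsilon> c v. F \<epsilon> (tau c) (tau v)) w"
  using assms
proof (induct w arbitrary: F)
  case (Cons x w)
  obtain p where p: "x \<in> V p" using Cons(3) by (auto simp: LW_Cons)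
  have "par (tau x) = par x"
  proof (cases "x = 0")
    case False
    then have "tau x \<noteq> 0" by (metis tau_tau tau_zero)
    then show ?thesis using par_V[OF p False] par_V[OF tau_V[OF p]] by simp
  qed simp
  then show ?case
    using Cons(1)[OF bil_mul[OF Cons(2)]] Cons(3) by (simp add: wsum_Cons LW_Cons tau_mul tau_val)
qed simp

text \<open>The involution acts on the removed generator as well as on the coefficient; on an odd
  generator this is a sign.\<close>

lemma del_tau:
  fixes s :: "rat \<Rightarrow> 'y::ab_group_add \<Rightarrow> 'y"
  assumes s: "vector_space s" and F: "bil s F"
  shows "del F (tau c) = del (\<lambda>\<epsilon> c v. if \<epsilon> then - F \<epsilon> (tau c) v else F \<epsilon> (tau c) v) c"
proof -
  have b: "bil s (\<lambda>\<epsilon> c v. F \<epsilon> (tau c) (tau v))"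
    using F by (simp add: bil_def tau_add)
  have "del F (tau c) = del (\<lambda>\<epsilon> c v. F \<epsilon> (tau c) (tau v)) c"
  proof (induct c rule: word_induct)
    case (word r w)
    then show ?case
      using wsum_tau[OF F word] tau_LW[OF word]
      by (simp add: tau_val del_arg_scale[OF s F] del_arg_scale[OF s b] del_val[OF s F] del_val[OF s b])
  qed (simp add: tau_add del_arg_add[OF s F] del_arg_add[OF s b])
  also have "\<dots> = del (\<lambda>\<epsilon> c v. if \<epsilon> then - F \<epsilon> (tau c) v else F \<epsilon> (tau c) v) c"
  proof (rule del_cong)
    fix \<epsilon> c v p assume v: "v \<in> V p" "odd p = \<epsilon>"
    have "tau v = (if \<epsilon> then - v else v)"
      using tau_gr[OF V_gr[OF v(1)]] v(2) by (auto simp: koszul_def)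
    moreover have "F \<epsilon> c (- v) = - F \<epsilon> c v" for c
      using bilD(3)[OF F, of \<epsilon> c v "- v"] bilD(6)[OF F] by (simp add: minus_unique)
    ultimately show "F \<epsilon> (tau c) (tau v) = (if \<epsilon> then - F \<epsilon> (tau c) v else F \<epsilon> (tau c) v)"
      by (cases \<epsilon>) (simp_all only: if_True if_False)
  qed
  finally show ?thesis .
qed

text \<open>Multiplying each removed generator back reproduces a word once for every letter. This is
  the derivation that multiplies by the word length (\<open>euler_val\<close>), and on the quotients
  of successive \<open>Fil m\<close> it is the scalar m (\<open>euler_Fil\<close>).\<close>

definition euler :: "'a \<Rightarrow> 'a" where
  "euler = del (\<lambda>\<epsilon> c v. c \<odot> v)"

lemma bil_euler: "bil sm (\<lambda>\<epsilon> c v. c \<odot> v)"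
  by (simp add: bil_def mul_add_left mul_add_right)

lemma euler_add: "euler (x + y) = euler x + euler y"
  and euler_scale: "euler (sm r x) = sm r (euler x)"
  using del_arg_add[OF vs bil_euler] del_arg_scale[OF vs bil_euler] by (simp_all add: euler_def)

lemma euler_val: "w \<in> LW \<Longrightarrow> euler (val w) = sm (of_nat (length w)) (val w)"
proof -
  have "wsum (\<lambda>\<epsilon> c v. c \<odot> v) w = sm (of_nat (length w)) (val w)" if "w \<in> LW" for w
    using that
  proof (induct w)
    case (Cons x w)
    then obtain p where p: "x \<in> V p" by (auto simp: LW_Cons)
    have 1: "tw (par x) c \<odot> x = x \<odot> c" for c
      using par_V[OF p] mul_comm_odd[OF V_gr[OF p], of c] mul_comm_even[OF V_gr[OF p], of c]
      by (cases "x = 0") auto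
    have 2: "wsum (\<lambda>\<epsilon> c v. x \<odot> c \<odot> v) w = x \<odot> wsum (\<lambda>\<epsilon> c v. c \<odot> v) w"
    proof -
      have "(\<Sum>(\<epsilon>::bool, c, v)\<leftarrow>L. x \<odot> c \<odot> v) = x \<odot> (\<Sum>(\<epsilon>, c, v)\<leftarrow>L. c \<odot> v)" for L
        by (induct L) (auto simp: mul_add_right mul_assoc)
      then show ?thesis by (simp add: wsum_def)
    qed
    show ?case
      using Cons by (simp only: wsum_Cons 1 2 LW_Cons) (simp add: vs.scale_left_distrib)
  qed simp
  then show "w \<in> LW \<Longrightarrow> euler (val w) = sm (of_nat (length w)) (val w)"
    by (simp add: euler_def del_val[OF vs bil_euler])
qed

lemma euler_Fil: "c \<in> Fil m \<Longrightarrow> euler c - sm (of_nat m) c \<in> Fil (Suc m)"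
proof (induct rule: Fil_induct)
  case zero
  then show ?case using euler_scale[of 0 0] by simp
next
  case (word r w y)
  have "euler (val w) - sm (of_nat m) (val w) = sm (of_nat (length w) - of_nat m) (val w)"
    by (simp only: euler_val[OF word(1)] vs.scale_left_diff_distrib)
  moreover have "sm (of_nat (length w) - of_nat m) (val w) \<in> Fil (Suc m)"
    using word by (cases "length w = m") (simp_all add: Fil_scale val_Fil)
  ultimately have "sm r (euler (val w) - sm (of_nat m) (val w)) \<in> Fil (Suc m)"
    by (simp only: Fil_scale)
  from Fil_add[OF this word(3)]
  have "sm r (euler (val w) - sm (of_nat m) (val w)) + (euler y - sm (of_nat m) y) \<in> Fil (Suc m)" .
  also have "sm r (euler (val w) - sm (of_nat m) (val w)) + (euler y - sm (of_nat m) y) =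
      euler (sm r (val w) + y) - sm (of_nat m) (sm r (val w) + y)"
    by (simp add: euler_add euler_scale vs.scale_right_distrib vs.scale_right_diff_distrib mult.commute)
  finally show ?case .
qed

section \<open>The bar construction\<close>

definition multilin :: "('a list \<Rightarrow> rat) \<Rightarrow> bool" where
  "multilin F \<longleftrightarrow> (\<forall>xs x y ys. F (xs @ (x + y) # ys) = F (xs @ x # ys) + F (xs @ y # ys)) \<and>
     (\<forall>xs r x ys. F (xs @ sm r x # ys) = r * F (xs @ x # ys))"

lemma multilin_add: "multilin F \<Longrightarrow> F (xs @ (x + y) # ys) = F (xs @ x # ys) + F (xs @ y # ys)"
  and multilin_scale: "multilin F \<Longrightarrow> F (xs @ sm r x # ys) = r * F (xs @ x # ys)"
  by (simp_all add: multilin_def)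

lemma multilin_hd_add: "multilin F \<Longrightarrow> F ((x + y) # ys) = F (x # ys) + F (y # ys)"
  and multilin_hd_scale: "multilin F \<Longrightarrow> F (sm r x # ys) = r * F (x # ys)"
  using multilin_add[of F "[]"] multilin_scale[of F "[]"] by auto

lemma multilin_hd_zero: "multilin F \<Longrightarrow> F (0 # ys) = 0"
  using multilin_hd_add[of F 0 0 ys] by simp

lemma multilin_hd_uminus: "multilin F \<Longrightarrow> F (- x # ys) = - F (x # ys)"
  using multilin_hd_add[of F x "- x" ys] multilin_hd_zero[of F ys] by simp

lemma multilin_hd_diff: "multilin F \<Longrightarrow> F ((x - y) # ys) = F (x # ys) - F (y # ys)"
  using multilin_hd_add[of F x "- y" ys] multilin_hd_uminus[of F y ys] by simp

lemma multilin_Cons: "multilin F \<Longrightarrow> multilin (\<lambda>y. F (c # y))"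
  unfolding multilin_def by (metis append_Cons)

lemma multilinI:
  assumes "\<And>x y ys. F ((x + y) # ys) = F (x # ys) + F (y # ys)"
    "\<And>r x ys. F (sm r x # ys) = r * F (x # ys)" "\<And>c. multilin (\<lambda>y. F (c # y))"
  shows "multilin F"
  unfolding multilin_def
proof (intro conjI allI)
  show "F (xs @ (x + y) # ys) = F (xs @ x # ys) + F (xs @ y # ys)" for xs x y ys
    using assms(1) multilin_add[OF assms(3)] by (cases xs) auto
  show "F (xs @ sm r x # ys) = r * F (xs @ x # ys)" for xs r x ys
    using assms(2) multilin_scale[OF assms(3)] by (cases xs) auto
qed

text \<open>For operators given by transposes, \<open>O1 x (\<lambda>y. O2 y F)\<close> is the value
  of F on the image of x under O1 followed by O2, so O1 acts on words first. Linearity in F is what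
  allows such composites to be expanded.\<close>

definition lin :: "(('a list \<Rightarrow> rat) \<Rightarrow> rat) \<Rightarrow> bool" where
  "lin O' \<longleftrightarrow> (\<forall>F G. O' (\<lambda>y. F y + G y) = O' F + O' G) \<and> (\<forall>r F. O' (\<lambda>y. r * F y) = r * O' F)"

lemma lin_add: "lin O' \<Longrightarrow> O' (\<lambda>y. F y + G y) = O' F + O' G"
  and lin_scale: "lin O' \<Longrightarrow> O' (\<lambda>y. r * F y) = r * O' F"
  by (simp_all add: lin_def)

lemma lin_uminus: "lin O' \<Longrightarrow> O' (\<lambda>y. - F y) = - O' F"
  using lin_scale[of O' "-1" F] by simp

lemma lin_diff: "lin O' \<Longrightarrow> O' (\<lambda>y. F y - G y) = O' F - O' G"
  using lin_add[of O' F "\<lambda>y. - G y"] by (simp add: lin_uminus)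

lemma lin_del: "lin O' \<Longrightarrow> O' (\<lambda>y. del (\<lambda>\<epsilon> c v. K \<epsilon> c v y) c) = del (\<lambda>\<epsilon> c v. O' (K \<epsilon> c v)) c"
  by (rule del_commute) (rule lin_add)

lemma del_scale: "del (\<lambda>\<epsilon> c v. (r::rat) * F \<epsilon> c v) c = r * del F c"
  by (simp add: del_def case_prod_unfold sum_list_const_mult)

text \<open>The sign for moving \<open>[v]\<close> past \<open>[c]\<close>. Letters of bar words
  have their degrees shifted by one: there is no sign if v is odd, and the sign is (-1)^(|c| - 1) if
  v is even.\<close>

definition th :: "bool \<Rightarrow> 'a \<Rightarrow> 'a" where "th \<epsilon> c = (if \<epsilon> then c else - tau c)"

lemma th_add: "th \<epsilon> (x + y) = th \<epsilon> x + th \<epsilon> y" and th_scale: "th \<epsilon> (sm r x) = sm r (th \<epsilon> x)"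
  and tau_th: "tau (th \<epsilon> c) = th \<epsilon> (tau c)" and th_th: "th \<epsilon> (th \<epsilon>' c) = th \<epsilon>' (th \<epsilon> c)"
  by (simp_all add: th_def tau_add)

text \<open>The projection to the augmentation ideal, where the letters of bar words live.\<close>

definition red :: "'a \<Rightarrow> 'a" where "red c = c - sm (eps c) one"

lemma red_add: "red (x + y) = red x + red y" and red_scale: "red (sm r x) = sm r (red x)"
  by (simp_all add: red_def eps_add vs.scale_left_distrib vs.scale_right_diff_distrib)

lemma red_Fil: "red c \<in> Fil (Suc 0)"
  unfolding red_def by (rule reduce_Fil)

lemma red_id: "c \<in> Fil (Suc 0) \<Longrightarrow> red c = c"
  by (simp add: red_def Fil_1_iff)

text \<open>
  A word \<open>[c\<^sub>1|...|c\<^sub>k]\<close> in the bar construction of \<open>\<Lambda>V\<close> is the list of its letters. Linear operators on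
  the bar construction are represented by their transposes, acting on multilinear functions of words:
  \<open>bar_S\<close> is the shuffle product with the one-letter word \<open>[v]\<close>, \<open>bar_B\<close> and \<open>bar_D\<close> are the two parts
  of the bar differential \<open>bar_d\<close>, and \<open>bar_X\<close> splits a generator off a letter and shuffles it
  into the letters to the right.
\<close>

primrec bar_S :: "bool \<Rightarrow> 'a \<Rightarrow> 'a list \<Rightarrow> ('a list \<Rightarrow> rat) \<Rightarrow> rat" where
  "bar_S \<epsilon> v [] F = F [v]"
| "bar_S \<epsilon> v (c # x) F = F (v # c # x) + bar_S \<epsilon> v x (\<lambda>y. F (th \<epsilon> c # y))"

primrec bar_mu :: "'a \<Rightarrow> 'a list \<Rightarrow> ('a list \<Rightarrow> rat) \<Rightarrow> rat" where
  "bar_mu c [] F = 0"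
| "bar_mu c (c2 # x) F = F ((c \<odot> c2) # x)"

primrec bar_B :: "'a list \<Rightarrow> ('a list \<Rightarrow> rat) \<Rightarrow> rat" where
  "bar_B [] F = 0"
| "bar_B (c # x) F = bar_mu (tau c) x F - bar_B x (\<lambda>y. F (tau c # y))"

primrec bar_D :: "'a list \<Rightarrow> ('a list \<Rightarrow> rat) \<Rightarrow> rat" where
  "bar_D [] F = 0"
| "bar_D (c # x) F = F (d c # x) - bar_D x (\<lambda>y. F (tau c # y))"

primrec bar_d :: "'a list \<Rightarrow> ('a list \<Rightarrow> rat) \<Rightarrow> rat" where
  "bar_d [] F = 0"
| "bar_d (c # x) F = F (d c # x) + bar_mu (tau c) x F - bar_d x (\<lambda>y. F (tau c # y))"

primrec bar_X :: "'a list \<Rightarrow> ('a list \<Rightarrow> rat) \<Rightarrow> rat" where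
  "bar_X [] F = 0"
| "bar_X (c # x) F =
     del (\<lambda>\<epsilon> c' v. bar_S \<epsilon> v x (\<lambda>y. F (tau (red c') # y))) c - bar_X x (\<lambda>y. F (tau c # y))"

text \<open>The top-to-random shuffle: the linear part of the first letter is shuffled into the rest
  of the word. It is the defect of \<open>bar_X\<close> as a contraction, see
  \<open>X_B\<close>.\<close>

primrec bar_P :: "'a list \<Rightarrow> ('a list \<Rightarrow> rat) \<Rightarrow> rat" where
  "bar_P [] F = 0"
| "bar_P (c # x) F = del (\<lambda>\<epsilon> c' v. eps c' * bar_S \<epsilon> v x F) c"

text \<open>The extension of \<open>euler\<close> to words as a derivation; when the letters are
  products of generators and F is multilinear, it counts all generators in the word.\<close>

primrec bar_W :: "'a list \<Rightarrow> ('a list \<Rightarrow> rat) \<Rightarrow> rat" where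
  "bar_W [] F = 0"
| "bar_W (c # x) F = F (euler c # x) + bar_W x (\<lambda>y. F (c # y))"

section \<open>Linearity and multilinearity of the bar operators\<close>

lemma lin_S: "lin (bar_S \<epsilon> v x)"
proof -
  have "bar_S \<epsilon> v x (\<lambda>y. F y + G y) = bar_S \<epsilon> v x F + bar_S \<epsilon> v x G" for F G
    by (induct x arbitrary: F G) simp_all
  moreover have "bar_S \<epsilon> v x (\<lambda>y. r * F y) = r * bar_S \<epsilon> v x F" for r F
    by (induct x arbitrary: F) (simp_all add: algebra_simps)
  ultimately show ?thesis by (simp add: lin_def)
qed

lemma lin_mu: "lin (bar_mu c x)"
  by (cases x) (simp_all add: lin_def)

lemma lin_B: "lin (bar_B x)"
proof -
  have "bar_B x (\<lambda>y. F y + G y) = bar_B x F + bar_B x G" for F G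
    by (induct x arbitrary: F G) (simp_all add: lin_add[OF lin_mu])
  moreover have "bar_B x (\<lambda>y. r * F y) = r * bar_B x F" for r F
    by (induct x arbitrary: F) (simp_all add: algebra_simps lin_scale[OF lin_mu])
  ultimately show ?thesis by (simp add: lin_def)
qed

lemma lin_D: "lin (bar_D x)"
proof -
  have "bar_D x (\<lambda>y. F y + G y) = bar_D x F + bar_D x G" for F G
    by (induct x arbitrary: F G) simp_all
  moreover have "bar_D x (\<lambda>y. r * F y) = r * bar_D x F" for r F
    by (induct x arbitrary: F) (simp_all add: algebra_simps)
  ultimately show ?thesis by (simp add: lin_def)
qed

lemma bar_d_eq: "bar_d x F = bar_B x F + bar_D x F"
  by (induct x arbitrary: F) simp_all

lemma lin_d: "lin (bar_d x)"
  using lin_B[of x] lin_D[of x] by (simp add: lin_def bar_d_eq algebra_simps)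

lemma lin_X: "lin (bar_X x)"
proof -
  have "bar_X x (\<lambda>y. F y + G y) = bar_X x F + bar_X x G" for F G
    by (induct x arbitrary: F G) (simp_all add: lin_add[OF lin_S] del_add)
  moreover have "bar_X x (\<lambda>y. r * F y) = r * bar_X x F" for r F
    by (induct x arbitrary: F) (simp_all add: algebra_simps lin_scale[OF lin_S] del_scale)
  ultimately show ?thesis by (simp add: lin_def)
qed

lemma lin_P: "lin (bar_P x)"
proof -
  have "bar_P x (\<lambda>y. F y + G y) = bar_P x F + bar_P x G" for F G
    by (cases x) (simp_all add: lin_add[OF lin_S] distrib_left del_add)
  moreover have "bar_P x (\<lambda>y. r * F y) = r * bar_P x F" for r F
    by (cases x) (simp_all add: lin_scale[OF lin_S] mult.left_commute[of _ r] del_scale)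
  ultimately show ?thesis by (simp add: lin_def)
qed

lemma S_multilin_arg:
  assumes "multilin F"
  shows "bar_S \<epsilon> (v + w) x F = bar_S \<epsilon> v x F + bar_S \<epsilon> w x F"
    and "bar_S \<epsilon> (sm r v) x F = r * bar_S \<epsilon> v x F"
  using assms
proof (induct x arbitrary: F)
  case (Cons c x)
  { case 1 then show ?case by (simp add: Cons(1)[OF multilin_Cons] multilin_hd_add) }
  { case 2 then show ?case by (simp add: Cons(2)[OF multilin_Cons] multilin_hd_scale distrib_left) }
qed (simp_all add: multilin_hd_add multilin_hd_scale)

lemma multilin_S: "multilin F \<Longrightarrow> multilin (\<lambda>x. bar_S \<epsilon> v x F)"
proof -
  have "bar_S \<epsilon> v (xs @ (x + y) # ys) F = bar_S \<epsilon> v (xs @ x # ys) F + bar_S \<epsilon> v (xs @ y # ys) F"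
    if "multilin F" for xs x y ys F
    using that
  proof (induct xs arbitrary: F)
    case Nil
    then show ?case
      by (simp add: th_add multilin_hd_add lin_add[OF lin_S] multilin_hd_add[OF multilin_Cons[OF Nil]])
  next
    case (Cons a xs)
    then show ?case
      using multilin_add[OF Cons(2), of "v # a # xs"] Cons(1)[OF multilin_Cons[OF Cons(2)]] by simp
  qed
  moreover have "bar_S \<epsilon> v (xs @ sm r x # ys) F = r * bar_S \<epsilon> v (xs @ x # ys) F"
    if "multilin F" for xs x r ys F
    using that
  proof (induct xs arbitrary: F)
    case Nil
    then show ?case
      by (simp add: th_scale multilin_hd_scale lin_scale[OF lin_S] multilin_hd_scale[OF multilin_Cons[OF Nil]]
          distrib_left)
  next
    case (Cons a xs)
    then show ?case
      using multilin_scale[OF Cons(2), of "v # a # xs"] Cons(1)[OF multilin_Cons[OF Cons(2)]]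
      by (simp add: distrib_left)
  qed
  ultimately show "multilin F \<Longrightarrow> multilin (\<lambda>x. bar_S \<epsilon> v x F)" by (simp add: multilin_def)
qed

lemma bil_X: "multilin F \<Longrightarrow> bil (*) (\<lambda>\<epsilon> c v. bar_S \<epsilon> v x (\<lambda>y. F (tau (red c) # y)))"
  unfolding bil_def
  by (simp add: red_add red_scale tau_add multilin_hd_add multilin_hd_scale lin_add[OF lin_S]
      lin_scale[OF lin_S] S_multilin_arg[OF multilin_Cons])

lemma bil_P: "multilin F \<Longrightarrow> bil (*) (\<lambda>\<epsilon> c v. eps c * bar_S \<epsilon> v x F)"
  unfolding bil_def by (simp add: eps_add S_multilin_arg algebra_simps)

lemmas del_rat_add = del_arg_add[OF vector_space_rat]
  and del_rat_scale = del_arg_scale[OF vector_space_rat]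
  and del_rat_mul = del_mul[OF vector_space_rat]
  and del_rat_tau = del_tau[OF vector_space_rat]
  and del_rat_V = del_V[OF vector_space_rat]
  and del_rat_Fil = del_Fil[OF vector_space_rat]

lemma del_hd: "multilin F \<Longrightarrow> del (\<lambda>\<epsilon> c v. F ((c \<odot> v) # x)) c = F (euler c # x)"
proof -
  assume F: "multilin F"
  have "(\<Sum>(\<epsilon>::bool, c, v)\<leftarrow>L. F ((c \<odot> v) # x)) = F ((\<Sum>(\<epsilon>, c, v)\<leftarrow>L. c \<odot> v) # x)" for L
    by (induct L) (auto simp: multilin_hd_add[OF F] multilin_hd_zero[OF F])
  then show ?thesis by (simp add: euler_def del_def)
qed

lemma multilin_X: "multilin F \<Longrightarrow> multilin (\<lambda>x. bar_X x F)"
proof -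
  have "bar_X (xs @ (x + y) # ys) F = bar_X (xs @ x # ys) F + bar_X (xs @ y # ys) F"
    if "multilin F" for xs x y ys F
    using that
  proof (induct xs arbitrary: F)
    case Nil
    then show ?case
      by (simp add: tau_add multilin_hd_add lin_add[OF lin_X] del_rat_add[OF bil_X[OF Nil]])
  next
    case (Cons a xs)
    then show ?case
      using multilin_add[OF multilin_S[OF multilin_Cons[OF Cons(2)]]] Cons(1)[OF multilin_Cons[OF Cons(2)]]
      by (simp add: del_add)
  qed
  moreover have "bar_X (xs @ sm r x # ys) F = r * bar_X (xs @ x # ys) F"
    if "multilin F" for xs x r ys F
    using that
  proof (induct xs arbitrary: F)
    case Nil
    then show ?case
      by (simp add: multilin_hd_scale lin_scale[OF lin_X] del_rat_scale[OF bil_X[OF Nil]] algebra_simps)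
  next
    case (Cons a xs)
    then show ?case
      using multilin_scale[OF multilin_S[OF multilin_Cons[OF Cons(2)]]] Cons(1)[OF multilin_Cons[OF Cons(2)]]
      by (simp add: del_scale algebra_simps)
  qed
  ultimately show "multilin F \<Longrightarrow> multilin (\<lambda>x. bar_X x F)" by (simp add: multilin_def)
qed

lemma multilin_mu: "multilin F \<Longrightarrow> multilin (\<lambda>x. bar_mu c x F)"
  by (rule multilinI) (simp_all add: mul_add_right multilin_hd_add multilin_hd_scale multilin_Cons)

lemma mu_arg: "multilin F \<Longrightarrow> bar_mu (x + y) w F = bar_mu x w F + bar_mu y w F"
  "multilin F \<Longrightarrow> bar_mu (sm r x) w F = r * bar_mu x w F"
  by (cases w; simp add: mul_add_left multilin_hd_add multilin_hd_scale)+

lemma multilin_d: "multilin F \<Longrightarrow> multilin (\<lambda>x. bar_d x F)"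
proof -
  have "bar_d (xs @ (x + y) # ys) F = bar_d (xs @ x # ys) F + bar_d (xs @ y # ys) F"
    if "multilin F" for xs x y ys F
    using that
  proof (induct xs arbitrary: F)
    case Nil
    then show ?case
      by (simp add: tau_add d_add multilin_hd_add lin_add[OF lin_d] mu_arg)
  next
    case (Cons a xs)
    then show ?case
      using multilin_add[OF multilin_Cons[OF Cons(2)]] multilin_add[OF multilin_mu[OF Cons(2)]]
        Cons(1)[OF multilin_Cons[OF Cons(2)]]
      by simp
  qed
  moreover have "bar_d (xs @ sm r x # ys) F = r * bar_d (xs @ x # ys) F"
    if "multilin F" for xs x r ys F
    using that
  proof (induct xs arbitrary: F)
    case Nil
    then show ?case
      by (simp add: multilin_hd_scale lin_scale[OF lin_d] mu_arg algebra_simps)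
  next
    case (Cons a xs)
    then show ?case
      using multilin_scale[OF multilin_Cons[OF Cons(2)]] multilin_scale[OF multilin_mu[OF Cons(2)]]
        Cons(1)[OF multilin_Cons[OF Cons(2)]]
      by (simp add: algebra_simps)
  qed
  ultimately show "multilin F \<Longrightarrow> multilin (\<lambda>x. bar_d x F)" by (simp add: multilin_def)
qed


section \<open>Commutation relations of the bar operators\<close>

lemma multilin_th: "multilin F \<Longrightarrow> odd p = \<epsilon> \<Longrightarrow> v \<in> V p \<Longrightarrow> F (tau v # y) = (if \<epsilon> then - F (v # y) else F (v # y))"
  using tau_gr[OF V_gr, of v p] multilin_hd_uminus[of F v y] by (auto simp: koszul_def)

lemma tau_V_th: "odd p = \<epsilon> \<Longrightarrow> v \<in> V p \<Longrightarrow> tau v \<odot> c + tau (th \<epsilon> c) \<odot> v = 0"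
  using tau_gr[OF V_gr, of v p] mul_comm_odd[OF V_gr, of v p c] mul_comm_even[OF V_gr, of v p c]
  by (cases "odd p") (auto simp: koszul_def th_def)

text \<open>In the shuffles, v stands once to the left and once to the right of each letter. The two
  products of v with that letter cancel by graded commutativity (\<open>tau_V_th\<close>), so only
  products of the original letters survive.\<close>

lemma S_B:
  assumes v: "v \<in> V p" "odd p = \<epsilon>" and F: "multilin F"
  shows "bar_S \<epsilon> v x (\<lambda>y. bar_B y F) = (if \<epsilon> then 1 else -1) * bar_B x (\<lambda>y. bar_S \<epsilon> v y F)"
  using F
proof (induct x arbitrary: F)
  case (Cons c x)
  note F = Cons(2)
  note tv = multilin_th[OF _ v(2,1)]
  define s :: rat where "s = (if \<epsilon> then 1 else -1)"
  have tv: "F' (tau v # y) = - s * F' (v # y)" if "multilin F'" for F' y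
    using multilin_th[OF that v(2,1), of y] by (simp add: s_def)
  have IH: "bar_S \<epsilon> v x (\<lambda>y. bar_B y (\<lambda>z. F (th \<epsilon> (tau c) # z))) =
      s * bar_B x (\<lambda>y. bar_S \<epsilon> v y (\<lambda>z. F (th \<epsilon> (tau c) # z)))"
    using Cons(1)[OF multilin_Cons[OF F]] by (simp only: s_def)
  have tv2: "bar_B x (\<lambda>y. F (tau v # tau c # y)) = - s * bar_B x (\<lambda>y. F (v # tau c # y))"
    by (simp only: tv[OF F] lin_scale[OF lin_B])
  have L: "bar_S \<epsilon> v (c # x) (\<lambda>y. bar_B y F) =
      F ((tau v \<odot> c) # x) - bar_mu (tau c) x (\<lambda>y. F (tau v # y)) - s * bar_B x (\<lambda>y. F (v # tau c # y))
      + bar_S \<epsilon> v x (\<lambda>y. bar_mu (th \<epsilon> (tau c)) y F)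
      - s * bar_B x (\<lambda>y. bar_S \<epsilon> v y (\<lambda>z. F (th \<epsilon> (tau c) # z)))"
    by (simp add: lin_diff[OF lin_S] IH tv2 tau_th)
  have R: "bar_B (c # x) (\<lambda>y. bar_S \<epsilon> v y F) =
      bar_mu (tau c) x (\<lambda>y. bar_S \<epsilon> v y F) - bar_B x (\<lambda>y. F (v # tau c # y))
      - bar_B x (\<lambda>y. bar_S \<epsilon> v y (\<lambda>z. F (th \<epsilon> (tau c) # z)))"
    by (simp add: lin_add[OF lin_B])
  have "F ((tau v \<odot> c) # x) - bar_mu (tau c) x (\<lambda>y. F (tau v # y))
      + bar_S \<epsilon> v x (\<lambda>y. bar_mu (th \<epsilon> (tau c)) y F) = s * bar_mu (tau c) x (\<lambda>y. bar_S \<epsilon> v y F)"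
  proof -
    have 0: "F ((tau v \<odot> c) # y) + F ((th \<epsilon> (tau c) \<odot> v) # y) = 0" for y
      using tau_V_th[OF v(2,1), of c] multilin_hd_zero[OF F, of y] by (simp add: tau_th flip: multilin_hd_add[OF F])
    show ?thesis
    proof (cases x)
      case Nil
      then show ?thesis using 0[of "[]"] by simp
    next
      case (Cons c2 y)
      have "th \<epsilon> (tau c) \<odot> th \<epsilon> c2 = sm s (th \<epsilon> (tau c \<odot> c2))"
        by (simp add: s_def th_def tau_mul)
      then have "bar_S \<epsilon> v y (\<lambda>z. F ((th \<epsilon> (tau c) \<odot> th \<epsilon> c2) # z)) =
          s * bar_S \<epsilon> v y (\<lambda>z. F (th \<epsilon> (tau c \<odot> c2) # z))"
        by (simp only: multilin_hd_scale[OF F] lin_scale[OF lin_S])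
      then show ?thesis
        using 0[of "c2 # y"] tv[OF F] by (simp add: Cons algebra_simps)
    qed
  qed
  then show ?case unfolding L R s_def[symmetric] by (simp add: algebra_simps)
qed simp

text \<open>Graded commutativity of the shuffle product. With degrees shifted by one,
  \<open>[v]\<close> and \<open>[v']\<close> anticommute exactly when v and v' are both
  even.\<close>

lemma S_S:
  assumes v: "v \<in> V p" "odd p = \<epsilon>" and v': "v' \<in> V p'" "odd p' = \<epsilon>'" and F: "multilin F"
  shows "bar_S \<epsilon> v x (\<lambda>y. bar_S \<epsilon>' v' y F) =
    (if \<epsilon> \<or> \<epsilon>' then 1 else -1) * bar_S \<epsilon>' v' x (\<lambda>y. bar_S \<epsilon> v y F)"
proof -
  have th: "F' (th \<epsilon>' v # y) = (if \<epsilon> \<or> \<epsilon>' then 1 else -1) * F' (v # y)"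
    "F' (th \<epsilon> v' # y) = (if \<epsilon> \<or> \<epsilon>' then 1 else -1) * F' (v' # y)" if "multilin F'" for F' y
    using multilin_th[OF that v(2,1), of y] multilin_th[OF that v'(2,1), of y] multilin_hd_uminus[OF that, of _ y]
    by (auto simp: th_def)
  show ?thesis
    using F
  proof (induct x arbitrary: F)
    case Nil
    then show ?case by (simp add: th)
  next
    case (Cons c x)
    note IH = Cons(1)[OF multilin_Cons[OF Cons(2)]]
    show ?case
      by (simp add: lin_add[OF lin_S] IH th[OF Cons(2)] lin_scale[OF lin_S] th_th[of \<epsilon> \<epsilon>']
          lin_uminus[OF lin_S])
  qed
qed

text \<open>If v comes first in a shuffle, P takes it off and shuffles it in again, which gives the
  first summand. Otherwise P moves the first letter of x, and the two shuffles commute by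
  \<open>S_S\<close>. Thus shuffling with \<open>[v]\<close> raises the eigenvalues of P by
  one.\<close>

lemma S_P:
  assumes v: "v \<in> V p" "odd p = \<epsilon>" and F: "multilin F"
  shows "bar_S \<epsilon> v x (\<lambda>y. bar_P y F) = bar_S \<epsilon> v x F + bar_P x (\<lambda>y. bar_S \<epsilon> v y F)"
proof -
  have PV: "bar_P (v # y) F = bar_S \<epsilon> v y F" for y
    using del_rat_V[OF bil_P[OF F] v(1)] v(2) by simp
  show ?thesis
  proof (cases x)
    case Nil
    then show ?thesis using PV[of "[]"] by simp
  next
    case (Cons c y)
    have "bar_S \<epsilon> v y (\<lambda>z. bar_P (th \<epsilon> c # z) F) =
        del (\<lambda>\<epsilon>' c' v'. eps c' * bar_S \<epsilon> v y (\<lambda>z. bar_S \<epsilon>' v' z F)) (th \<epsilon> c)"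
      by (simp add: lin_del[OF lin_S] lin_scale[OF lin_S])
    also have "\<dots> = del (\<lambda>\<epsilon>' c' v'. eps c' * ((if \<epsilon> \<or> \<epsilon>' then 1 else -1) *
        bar_S \<epsilon>' v' y (\<lambda>z. bar_S \<epsilon> v z F))) (th \<epsilon> c)"
      by (rule del_cong) (simp only: S_S[OF v _ _ F])
    also have "\<dots> = bar_P (c # y) (\<lambda>z. bar_S \<epsilon> v z F)"
    proof (cases \<epsilon>)
      case False
      have b: "bil (*) (\<lambda>\<epsilon>' c' v'. eps c' * ((if \<epsilon>' then 1 else -1) *
          bar_S \<epsilon>' v' y (\<lambda>z. bar_S \<epsilon> v z F)))"
        unfolding bil_def using S_multilin_arg[OF multilin_S[OF F]]
        by (simp add: eps_add algebra_simps)
      have "del (\<lambda>\<epsilon>' c' v'. eps c' * ((if \<epsilon>' then 1 else -1) *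
          bar_S \<epsilon>' v' y (\<lambda>z. bar_S \<epsilon> v z F))) (- tau c) =
          - del (\<lambda>\<epsilon>' c' v'. eps c' * ((if \<epsilon>' then 1 else -1) *
          bar_S \<epsilon>' v' y (\<lambda>z. bar_S \<epsilon> v z F))) (tau c)"
        using del_rat_scale[OF b, of "-1" "tau c"] by simp
      also have "\<dots> = - del (\<lambda>\<epsilon>' c' v'. - (eps c' * bar_S \<epsilon>' v' y (\<lambda>z. bar_S \<epsilon> v z F))) c"
        unfolding del_rat_tau[OF b] by (intro arg_cong[of _ _ uminus] del_cong) auto
      finally show ?thesis using False by (simp add: th_def del_uminus)
    qed (simp add: th_def)
    finally show ?thesis
      unfolding Cons bar_S.simps(2)[of \<epsilon> v c y "\<lambda>y. bar_P y F"] PV by (simp only:)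
  qed
qed

text \<open>X contracts the multiplication part of the bar differential. A generator multiplied back
  into the letter it came from contributes \<open>euler\<close>; products with other letters cancel
  by the derivation rule and graded commutativity, except for the scalar coefficients dropped by
  \<open>red\<close>. These defects telescope along the word and leave \<open>bar_P\<close>, which
  sees only the first letter.\<close>

lemma X_B:
  assumes "\<forall>c\<in>set w. c \<in> Fil (Suc 0)" "multilin F"
  shows "bar_X w (\<lambda>y. bar_B y F) + bar_B w (\<lambda>y. bar_X y F) = bar_W w F - bar_P w F"
  using assms
proof (induct w arbitrary: F)
  case (Cons c x)
  note F = Cons(3)
  have c: "c \<in> Fil (Suc 0)" and x: "\<forall>c\<in>set x. c \<in> Fil (Suc 0)" using Cons(2) by auto
  define Fc where "Fc = (\<lambda>z. F (c # z))"
  have Fc: "multilin Fc" unfolding Fc_def by (rule multilin_Cons[OF F])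
  define K where "K y \<epsilon> c' v = bar_S \<epsilon> v y (\<lambda>z. F (tau (red c') # z))" for y \<epsilon> c' v
  have K: "bil (*) (K y)" for y unfolding K_def by (rule bil_X[OF F])
  have red_tau: "red (tau c') = tau (red c')" for c' by (simp add: red_def tau_add[of _ "- z" for z, simplified])
  \<comment> \<open>\<open>T1\<close> collects the products of the coefficient left in the first
    place with the letter that follows it after the shuffle; \<open>T2\<close> collects the products
    inside the shuffled tail and cancels by \<open>S_B\<close>.\<close>
  define T1 where "T1 = del (\<lambda>\<epsilon> c' v. bar_S \<epsilon> v x (\<lambda>y. bar_mu (red c') y F)) c"
  define T2 where "T2 = del (\<lambda>\<epsilon> c' v. bar_S \<epsilon> v x (\<lambda>y. bar_B y (\<lambda>z. F (red c' # z)))) c"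
  have "bar_X (c # x) (\<lambda>y. bar_B y F) = T1 - T2 - bar_X x (\<lambda>y. bar_mu c y F) + bar_X x (\<lambda>y. bar_B y Fc)"
    by (simp add: T1_def T2_def Fc_def lin_diff[OF lin_S] lin_diff[OF lin_X] del_diff)
  moreover have "bar_B (c # x) (\<lambda>y. bar_X y F) =
      bar_mu (tau c) x (\<lambda>y. bar_X y F) + T2 + bar_B x (\<lambda>y. bar_X y Fc)"
  proof -
    have "del (K y) (tau c) = del (\<lambda>\<epsilon> c' v. (if \<epsilon> then -1 else 1) * bar_S \<epsilon> v y (\<lambda>z. F (red c' # z))) c" for y
      unfolding del_rat_tau[OF K] by (rule del_cong) (simp add: K_def red_tau)
    then have "bar_B x (\<lambda>y. del (K y) (tau c)) =
        del (\<lambda>\<epsilon> c' v. (if \<epsilon> then -1 else 1) * bar_B x (\<lambda>y. bar_S \<epsilon> v y (\<lambda>z. F (red c' # z)))) c"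
      by (simp add: lin_del[OF lin_B] lin_scale[OF lin_B])
    also have "\<dots> = del (\<lambda>\<epsilon> c' v. - bar_S \<epsilon> v x (\<lambda>y. bar_B y (\<lambda>z. F (red c' # z)))) c"
      by (rule del_cong) (simp add: S_B[OF _ _ multilin_Cons[OF F]])
    also have "\<dots> = - T2" by (simp add: T2_def del_uminus)
    finally have "bar_B x (\<lambda>y. del (K y) (tau c)) = - T2" .
    then show ?thesis by (simp add: K_def[abs_def] Fc_def lin_diff[OF lin_B])
  qed
  moreover have "bar_X x (\<lambda>y. bar_B y Fc) + bar_B x (\<lambda>y. bar_X y Fc) = bar_W x Fc - bar_P x Fc"
    by (rule Cons(1)[OF x Fc])
  moreover have "T1 - bar_X x (\<lambda>y. bar_mu c y F) + bar_mu (tau c) x (\<lambda>y. bar_X y F) =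
      F (euler c # x) - bar_P (c # x) F + bar_P x Fc"
  proof (cases x)
    case Nil
    have "T1 = del (\<lambda>\<epsilon> c' v. F [c' \<odot> v] - eps c' * F [v]) c"
      unfolding T1_def Nil
      by (rule del_cong) (simp add: red_def mul_add_left[of _ "- z" for z, simplified]
          multilin_hd_diff[OF F] multilin_hd_scale[OF F])
    then show ?thesis using del_hd[OF F, of "[]" c] by (simp add: Nil del_diff)
  next
    case (Cons c2 y)
    have c2: "c2 \<in> Fil (Suc 0)" using x Cons by simp
    define U where "U = del (\<lambda>\<epsilon> c' v. bar_S \<epsilon> v y (\<lambda>z. F ((c' \<odot> th \<epsilon> c2) # z))) c"
    have "T1 = del (\<lambda>\<epsilon> c' v. F ((c' \<odot> v) # x) + bar_S \<epsilon> v y (\<lambda>z. F ((c' \<odot> th \<epsilon> c2) # z))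
        - eps c' * bar_S \<epsilon> v x F) c"
      unfolding T1_def Cons
      by (rule del_cong) (simp add: red_def mul_add_left[of _ "- z" for z, simplified]
          multilin_hd_diff[OF F] multilin_hd_scale[OF F] lin_diff[OF lin_S] lin_scale[OF lin_S] algebra_simps)
    then have T1: "T1 = F (euler c # x) + U - bar_P (c # x) F"
      by (simp add: U_def del_add del_diff del_hd[OF F])
    have X: "bar_X x (\<lambda>y. bar_mu c y F) =
        del (\<lambda>\<epsilon> c' v. bar_S \<epsilon> v y (\<lambda>z. F ((c \<odot> tau (red c')) # z))) c2
        - bar_X y (\<lambda>z. F ((c \<odot> tau c2) # z))"
      by (simp add: Cons)
    have "bar_mu (tau c) x (\<lambda>y. bar_X y F) = del (K y) (tau c \<odot> c2) - bar_X y (\<lambda>z. F ((c \<odot> tau c2) # z))"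
      by (simp add: Cons K_def[abs_def] tau_mul)
    \<comment> \<open>A generator split off the product comes from c2 or from c. The former matches
      \<open>bar_X\<close> of the tail up to scalar coefficients; the latter matches
      \<open>U\<close>, where it is shuffled in behind c2.\<close>
    also have "del (K y) (tau c \<odot> c2) = del (\<lambda>\<epsilon> c' v. K y \<epsilon> (tau c \<odot> c') v) c2
        + del (\<lambda>\<epsilon> c' v. K y \<epsilon> (c' \<odot> tw \<epsilon> c2) v) (tau c)"
      by (rule del_rat_mul[OF K])
    also have "del (\<lambda>\<epsilon> c' v. K y \<epsilon> (tau c \<odot> c') v) c2 =
        del (\<lambda>\<epsilon> c' v. bar_S \<epsilon> v y (\<lambda>z. F ((c \<odot> tau (red c')) # z)) + eps c' * bar_S \<epsilon> v y Fc) c2"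
    proof (rule del_cong)
      fix \<epsilon> c' v
      have "red (tau c \<odot> c') = tau c \<odot> c'"
        using Fil_mul[OF tau_Fil[OF c] Fil_0[of c']] by (intro red_id) simp
      moreover have "c \<odot> tau c' = c \<odot> tau (red c') + sm (eps c') c"
        by (simp add: red_def tau_add[of _ "- z" for z, simplified] mul_add_right[of _ _ "- z" for z, simplified])
      ultimately show "K y \<epsilon> (tau c \<odot> c') v =
          bar_S \<epsilon> v y (\<lambda>z. F ((c \<odot> tau (red c')) # z)) + eps c' * bar_S \<epsilon> v y Fc"
        by (simp add: K_def tau_mul Fc_def multilin_hd_add[OF F] multilin_hd_scale[OF F] lin_add[OF lin_S] lin_scale[OF lin_S])
    qed
    also have "del (\<lambda>\<epsilon> c' v. K y \<epsilon> (c' \<odot> tw \<epsilon> c2) v) (tau c) = - U"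
    proof -
      have b: "bil (*) (\<lambda>\<epsilon> c' v. K y \<epsilon> (c' \<odot> tw \<epsilon> c2) v)"
        using K[of y] by (simp add: bil_def mul_add_left)
      have "red (c' \<odot> tau c2) = c' \<odot> tau c2" "red (c' \<odot> c2) = c' \<odot> c2" for c'
        using Fil_mul[OF Fil_0[of c'] tau_Fil[OF c2]] Fil_mul[OF Fil_0[of c'] c2]
        by (auto intro: red_id)
      then show ?thesis
        unfolding del_rat_tau[OF b] U_def del_uminus[symmetric]
        by (intro del_cong) (auto simp: K_def tau_mul th_def multilin_hd_uminus[OF F] lin_uminus[OF lin_S])
    qed
    finally show ?thesis
      unfolding T1 X by (simp add: del_add) (simp add: Cons Fc_def)
  qed
  ultimately show ?case by (simp add: Fc_def)
qed simp

lemma d_sq: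
  assumes "multilin F" shows "bar_d x (\<lambda>y. bar_d y F) = 0"
  using assms
proof (induct x arbitrary: F)
  case (Cons c x)
  note F = Cons(2)
  have IH: "bar_d x (\<lambda>y. bar_d y (\<lambda>z. F (c # z))) = 0" by (rule Cons(1)[OF multilin_Cons[OF F]])
  have t: "d (tau c) = - tau (d c)" by (simp add: tau_d)
  have "bar_d (c # x) (\<lambda>y. bar_d y F) = bar_mu (tau (d c)) x F
      + bar_mu (tau c) x (\<lambda>y. bar_d y F) - bar_d x (\<lambda>y. bar_mu c y F)"
    by (simp add: t multilin_hd_zero[OF F] multilin_hd_uminus[OF F] lin_diff[OF lin_d] lin_add[OF lin_d]
        lin_uminus[OF lin_d] IH)
  also have "\<dots> = 0"
  proof (cases x)
    case (Cons c2 y)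
    have "d (tau c \<odot> c2) = - (tau (d c) \<odot> c2) + c \<odot> d c2"
      by (simp add: d_mul t)
    then show ?thesis
      by (simp add: Cons tau_mul mul_assoc multilin_hd_diff[OF F] lin_diff[OF lin_d]) (cases y; simp add: mul_assoc)
  qed simp
  finally show ?case .
qed simp

lemma multilin_P: "multilin F \<Longrightarrow> multilin (\<lambda>x. bar_P x F)"
proof (rule multilinI)
  assume F: "multilin F"
  show "bar_P ((x + y) # ys) F = bar_P (x # ys) F + bar_P (y # ys) F" for x y ys
    by (simp add: del_rat_add[OF bil_P[OF F]])
  show "bar_P (sm r x # ys) F = r * bar_P (x # ys) F" for r x ys
    by (simp add: del_rat_scale[OF bil_P[OF F]])
  show "multilin (\<lambda>y. bar_P (c # y) F)" for c
    unfolding multilin_def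
    by (simp add: multilin_add[OF multilin_S[OF F]] multilin_scale[OF multilin_S[OF F]] distrib_left del_add
        mult.left_commute[of _ r for r] del_scale)
qed

lemma multilin_D: "multilin F \<Longrightarrow> multilin (\<lambda>x. bar_D x F)"
proof -
  have "bar_D (xs @ (x + y) # ys) F = bar_D (xs @ x # ys) F + bar_D (xs @ y # ys) F"
    if "multilin F" for xs x y ys F
    using that
  proof (induct xs arbitrary: F)
    case Nil
    then show ?case
      by (simp add: tau_add d_add multilin_hd_add lin_add[OF lin_D])
  next
    case (Cons a xs)
    then show ?case
      using multilin_add[OF multilin_Cons[OF Cons(2)]] Cons(1)[OF multilin_Cons[OF Cons(2)]] by simp
  qed
  moreover have "bar_D (xs @ sm r x # ys) F = r * bar_D (xs @ x # ys) F"
    if "multilin F" for xs x r ys F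
    using that
  proof (induct xs arbitrary: F)
    case Nil
    then show ?case
      by (simp add: multilin_hd_scale lin_scale[OF lin_D] algebra_simps)
  next
    case (Cons a xs)
    then show ?case
      using multilin_scale[OF multilin_Cons[OF Cons(2)]] Cons(1)[OF multilin_Cons[OF Cons(2)]]
      by (simp add: algebra_simps)
  qed
  ultimately show "multilin F \<Longrightarrow> multilin (\<lambda>x. bar_D x F)" by (simp add: multilin_def)
qed

section \<open>Eigenvalues of the top-to-random shuffle\<close>

lemma multilin_comb: "multilin F \<Longrightarrow> multilin G \<Longrightarrow> multilin (\<lambda>x. F x - r * G x)"
  by (simp add: multilin_def algebra_simps)

text \<open>The product (P - s) (P - s - 1) ... (P - s - m + 1) applied to F, with m
  factors.\<close>

primrec falling :: "nat \<Rightarrow> nat \<Rightarrow> ('a list \<Rightarrow> rat) \<Rightarrow> 'a list \<Rightarrow> rat" where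
  "falling s 0 F = F"
| "falling s (Suc m) F =
     (\<lambda>x. bar_P x (falling (Suc s) m F) - of_nat s * falling (Suc s) m F x)"

lemma multilin_falling: "multilin F \<Longrightarrow> multilin (falling s m F)"
  by (induct m arbitrary: s) (simp_all add: multilin_comb multilin_P)

text \<open>By \<open>S_P\<close>, shuffling with \<open>[v]\<close> shifts P by one and so lowers
  every root of the product by one.\<close>

lemma S_falling:
  assumes v: "v \<in> V p" "odd p = \<epsilon>" and F: "multilin F"
  shows "bar_S \<epsilon> v x (falling (Suc s) m F) = falling s m (\<lambda>y. bar_S \<epsilon> v y F) x"
proof (induct m arbitrary: s x)
  case (Suc m)
  define G where "G = falling (Suc (Suc s)) m F"
  have G: "multilin G" unfolding G_def by (rule multilin_falling[OF F])
  have IH: "(\<lambda>x. bar_S \<epsilon> v x G) = falling (Suc s) m (\<lambda>y. bar_S \<epsilon> v y F)"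
    unfolding G_def using Suc by auto
  have "bar_S \<epsilon> v x (falling (Suc s) (Suc m) F) =
      bar_P x (\<lambda>x. bar_S \<epsilon> v x G) - of_nat s * bar_S \<epsilon> v x G"
    by (simp add: lin_diff[OF lin_S] lin_scale[OF lin_S] S_P[OF v G] flip: G_def)
      (simp add: algebra_simps)
  also have "\<dots> = falling s (Suc m) (\<lambda>y. bar_S \<epsilon> v y F) x"
    using fun_cong[OF IH, of x] by (simp add: IH)
  finally show ?case .
qed simp

text \<open>The factor with root 0 is P itself, which replaces a word by shuffles of a generator
  into its shorter tail. \<open>S_falling\<close> lowers the remaining roots 1, 2, ... to 0, 1, ...,
  and induction applies to the tail. Hence P (P - 1) ... (P - k) vanishes on words of length
  k.\<close>

lemma falling_short: "length w < m \<Longrightarrow> multilin F \<Longrightarrow> falling 0 m F w = 0"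
proof (induct w arbitrary: m F)
  case Nil
  then show ?case by (cases m) simp_all
next
  case (Cons c x)
  then obtain m' where m: "m = Suc m'" "length x < m'" by (cases m) auto
  have "falling 0 m F (c # x) = del (\<lambda>\<epsilon> c' v. eps c' * bar_S \<epsilon> v x (falling (Suc 0) m' F)) c"
    by (simp add: m)
  also have "\<dots> = del (\<lambda>\<epsilon> c' v. 0) c"
    by (rule del_cong) (simp add: S_falling[OF _ _ Cons(3)] Cons(1)[OF m(2) multilin_S[OF Cons(3)]])
  finally show ?case by simp
qed

text \<open>A relation rather than a function, because the letters lie in a decreasing filtration: a
  word of weight t also has every smaller weight down to its length.\<close>

primrec weight :: "'a list \<Rightarrow> nat \<Rightarrow> bool" where
  "weight [] s = (s = 0)"
| "weight (c # x) s = (\<exists>m t. s = m + t \<and> Suc 0 \<le> m \<and> c \<in> Fil m \<and> weight x t)"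

definition vanish :: "nat \<Rightarrow> nat \<Rightarrow> ('a list \<Rightarrow> rat) \<Rightarrow> bool" where
  "vanish L s F \<longleftrightarrow> (\<forall>w t. length w = L \<longrightarrow> weight w t \<longrightarrow> s \<le> t \<longrightarrow> F w = 0)"

lemma vanishD: "vanish L s F \<Longrightarrow> length w = L \<Longrightarrow> weight w t \<Longrightarrow> s \<le> t \<Longrightarrow> F w = 0"
  by (auto simp: vanish_def)

lemma weight_Cons: "c \<in> Fil m \<Longrightarrow> Suc 0 \<le> m \<Longrightarrow> weight x t \<Longrightarrow> weight (c # x) (m + t)"
  by auto

lemma vanish_Cons:
  assumes "vanish (Suc L) s F" "c \<in> Fil m" "Suc 0 \<le> m" "s \<le> m + t"
  shows "vanish L t (\<lambda>y. F (c # y))"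
  unfolding vanish_def
proof (intro allI impI)
  fix w t' assume w: "length w = L" "weight w t'" "t \<le> t'"
  show "F (c # w) = 0"
    by (rule vanishD[OF assms(1) _ weight_Cons[OF assms(2,3) w(2)]]) (use w assms(4) in auto)
qed

section \<open>Effect of the bar operators on length and weight\<close>

lemma th_Fil: "c \<in> Fil m \<Longrightarrow> th \<epsilon> c \<in> Fil m"
  by (auto simp: th_def intro: Fil_uminus tau_Fil)

text \<open>Shuffling in a generator adds one letter and one unit of weight.\<close>

lemma vanish_S: "vanish (Suc (length w)) (Suc t) F \<Longrightarrow> weight w t \<Longrightarrow> v \<in> V p \<Longrightarrow> bar_S \<epsilon> v w F = 0"
proof (induct w arbitrary: F t)
  case Nil
  then show ?case using vanishD[OF Nil(1), of "[v]" 1] V_Fil[of v p] by auto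
next
  case (Cons c x)
  obtain m t' where m: "t = m + t'" "Suc 0 \<le> m" "c \<in> Fil m" "weight x t'" using Cons(3) by auto
  have "F (v # c # x) = 0"
    by (rule vanishD[OF Cons(2) _ weight_Cons[OF V_Fil[OF Cons(4)] _ Cons(3)]]) auto
  moreover have "bar_S \<epsilon> v x (\<lambda>y. F (th \<epsilon> c # y)) = 0"
    by (rule Cons(1)[OF vanish_Cons[OF _ th_Fil[OF m(3)] m(2)] m(4) Cons(4)]) (use Cons(2) m in auto)
  ultimately show ?case by simp
qed

lemma vanish_X: "vanish (Suc (length w)) t F \<Longrightarrow> weight w t \<Longrightarrow> multilin F \<Longrightarrow> bar_X w F = 0"
proof (induct w arbitrary: F t)
  case (Cons c x)
  obtain m t' where m: "t = m + t'" "Suc 0 \<le> m" "c \<in> Fil m" "weight x t'" using Cons(3) by auto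
  have "del (\<lambda>\<epsilon> c' v. bar_S \<epsilon> v x (\<lambda>y. F (tau (red c') # y))) c = 0"
  proof (rule del_rat_Fil[OF bil_X[OF Cons(4)] m(3)])
    fix \<epsilon> c' v p assume c': "c' \<in> Fil (m - 1)" and v: "v \<in> V p"
    \<comment> \<open>For m = 1 the coefficient c' may have a scalar part, but \<open>red\<close>
      drops it, so at least one unit of weight stays behind. Together with the generator the weight
      never falls below t.\<close>
    define m' where "m' = max (Suc 0) (m - 1)"
    have "red c' \<in> Fil m'"
    proof (cases "m = 1")
      case False
      then have "m' = m - 1" "Suc 0 \<le> m - 1" using m(2) by (auto simp: m'_def)
      then show ?thesis using c' Fil_mono[of "Suc 0" "m - 1"] red_id[of c'] by auto
    qed (simp add: m'_def red_Fil)
    note r = tau_Fil[OF this]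
    have "vanish (Suc (Suc (length x))) t F" using Cons(2) by simp
    from vanish_S[OF vanish_Cons[OF this r] m(4) v]
    show "bar_S \<epsilon> v x (\<lambda>y. F (tau (red c') # y)) = 0"
      using m by (auto simp: m'_def)
  qed
  moreover have "bar_X x (\<lambda>y. F (tau c # y)) = 0"
    by (rule Cons(1)[OF vanish_Cons[OF _ tau_Fil[OF m(3)] m(2)] m(4) multilin_Cons[OF Cons(4)]])
      (use Cons(2) m in auto)
  ultimately show ?case by simp
qed simp

text \<open>By minimality d lengthens words, so the inner part of the bar differential raises the
  weight while keeping the number of letters.\<close>

lemma vanish_D: "vanish (length w) (Suc t) F \<Longrightarrow> weight w t \<Longrightarrow> bar_D w F = 0"
proof (induct w arbitrary: F t)
  case (Cons c x)
  obtain m t' where m: "t = m + t'" "Suc 0 \<le> m" "c \<in> Fil m" "weight x t'" using Cons(3) by auto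
  have "F (d c # x) = 0"
    by (rule vanishD[OF Cons(2) _ weight_Cons[OF d_Fil[OF m(3)] _ m(4)]]) (use m in auto)
  moreover have "bar_D x (\<lambda>y. F (tau c # y)) = 0"
    by (rule Cons(1)[OF vanish_Cons[OF _ tau_Fil[OF m(3)] m(2)] m(4)]) (use Cons(2) m in auto)
  ultimately show ?case by simp
qed simp

lemma vanish_W: "vanish (length w) (Suc t) F \<Longrightarrow> weight w t \<Longrightarrow> multilin F \<Longrightarrow> bar_W w F = of_nat t * F w"
proof (induct w arbitrary: F t)
  case (Cons c x)
  obtain m t' where m: "t = m + t'" "Suc 0 \<le> m" "c \<in> Fil m" "weight x t'" using Cons(3) by auto
  have "F ((euler c - sm (of_nat m) c) # x) = 0"
    by (rule vanishD[OF Cons(2) _ weight_Cons[OF euler_Fil[OF m(3)] _ m(4)]]) (use m in auto)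
  then have "F (euler c # x) = of_nat m * F (c # x)"
    by (simp add: multilin_hd_diff[OF Cons(4)] multilin_hd_scale[OF Cons(4)])
  moreover have "bar_W x (\<lambda>y. F (c # y)) = of_nat t' * F (c # x)"
    by (rule Cons(1)[OF vanish_Cons[OF _ m(3) m(2)] m(4) multilin_Cons[OF Cons(4)]]) (use Cons(2) m in auto)
  ultimately show ?case by (simp add: m(1) algebra_simps)
qed simp

text \<open>P keeps length and weight: a first letter in \<open>Fil 2\<close> has no linear part and
  contributes nothing, and a first letter of weight 1 is traded for a generator.\<close>

lemma vanish_P: "vanish (length w) t F \<Longrightarrow> weight w t \<Longrightarrow> multilin F \<Longrightarrow> bar_P w F = 0"
proof (cases w)
  case (Cons c x)
  assume h: "vanish (length w) t F" "weight w t" "multilin F"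
  obtain m t' where m: "t = m + t'" "Suc 0 \<le> m" "c \<in> Fil m" "weight x t'" using h Cons by auto
  have "del (\<lambda>\<epsilon> c' v. eps c' * bar_S \<epsilon> v x F) c = 0"
  proof (rule del_rat_Fil[OF bil_P[OF h(3)] m(3)])
    fix \<epsilon> c' v p assume c': "c' \<in> Fil (m - 1)" and v: "v \<in> V p"
    show "eps c' * bar_S \<epsilon> v x F = 0"
    proof (cases "m = 1")
      case True
      then have "bar_S \<epsilon> v x F = 0"
        using vanish_S[OF _ m(4) v] h(1) by (simp add: Cons m(1))
      then show ?thesis by simp
    next
      case False
      then have "Suc 0 \<le> m - 1" using m(2) by auto
      then show ?thesis using c' Fil_mono[of "Suc 0" "m - 1"] eps_Fil by auto
    qed
  qed
  then show "bar_P w F = 0" by (simp add: Cons)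
qed simp

text \<open>Words of one letter are left out, so F \<open>[d c]\<close> may be nonzero. Since X
  lengthens words, \<open>Theta_eq\<close> meets only words with two or more letters.\<close>

definition bar_closed :: "('a list \<Rightarrow> rat) \<Rightarrow> bool" where
  "bar_closed F \<longleftrightarrow> (\<forall>w. (\<forall>c\<in>set w. c \<in> Fil (Suc 0)) \<longrightarrow> 2 \<le> length w \<longrightarrow> bar_d w F = 0)"

text \<open>The condition \<open>length w < t\<close> leaves out words of minimal weight, on which P
  may have the eigenvalue t, so that W - P need not be invertible.\<close>

definition vanish_above :: "nat \<Rightarrow> ('a list \<Rightarrow> rat) \<Rightarrow> bool" where
  "vanish_above l F \<longleftrightarrow> (\<forall>w t. weight w t \<longrightarrow> l < t \<longrightarrow> length w < t \<longrightarrow> F w = 0)"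

lemma vanish_above_vanish: "vanish_above l F \<Longrightarrow> l < s \<Longrightarrow> L < s \<Longrightarrow> vanish L s F"
  by (auto simp: vanish_above_def vanish_def)

text \<open>One half of the anticommutator of the bar differential with X. On a cocycle the other
  half vanishes, so this half is the whole null-homotopic operator.\<close>

definition Theta :: "('a list \<Rightarrow> rat) \<Rightarrow> 'a list \<Rightarrow> rat" where
  "Theta F w = bar_d w (\<lambda>y. bar_X y F)"

lemma multilin_Theta: "multilin F \<Longrightarrow> multilin (Theta F)"
  unfolding Theta_def[abs_def] by (intro multilin_d multilin_X)

lemma closed_Theta: "multilin F \<Longrightarrow> bar_closed (Theta F)"
  unfolding bar_closed_def Theta_def[abs_def] using d_sq[OF multilin_X] by blast

section \<open>The null-homotopic operator on leading weights\<close>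

lemma weight_letters: "weight w t \<Longrightarrow> \<forall>c\<in>set w. c \<in> Fil (Suc 0)"
proof (induct w arbitrary: t)
  case (Cons c x)
  then obtain m t' where m: "Suc 0 \<le> m" "c \<in> Fil m" "weight x t'" by auto
  then show ?case using Fil_mono[OF m(1)] Cons(1)[OF m(3)] by auto
qed simp

lemma weight_length: "\<forall>c\<in>set w. c \<in> Fil (Suc 0) \<Longrightarrow> weight w (length w)"
proof (induct w)
  case (Cons c x)
  then show ?case using weight_Cons[of c "Suc 0" x "length x"] by simp
qed simp

lemma Theta_eq:
  assumes F: "multilin F" "bar_closed F" and w: "\<forall>c\<in>set w. c \<in> Fil (Suc 0)" "w \<noteq> []"
  shows "Theta F w = bar_W w F - bar_P w F
    + (bar_D w (\<lambda>y. bar_X y F) + bar_X w (\<lambda>y. bar_D y F))"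
proof -
  have "bar_X w (\<lambda>y. bar_d y F) = 0"
  proof (rule vanish_X[OF _ weight_length[OF w(1)] multilin_d[OF F(1)]])
    show "vanish (Suc (length w)) (length w) (\<lambda>y. bar_d y F)"
      unfolding vanish_def
    proof (intro allI impI)
      fix y t assume y: "length y = Suc (length w)" "weight y t"
      have "2 \<le> length y" using y(1) w(2) by (cases w) auto
      then show "bar_d y F = 0" using F(2) weight_letters[OF y(2)] by (simp add: bar_closed_def)
    qed
  qed
  then have "bar_X w (\<lambda>y. bar_B y F) + bar_X w (\<lambda>y. bar_D y F) = 0"
    by (simp add: bar_d_eq lin_add[OF lin_X])
  then show ?thesis using X_B[OF w(1) F(1)] by (simp add: Theta_def bar_d_eq)
qed

text \<open>Both terms with \<open>bar_D\<close> in \<open>Theta_eq\<close> raise the weight above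
  l, where F vanishes, and on the leading weight W is the scalar t.\<close>

lemma Theta_leading:
  assumes F: "multilin F" "bar_closed F" "vanish_above l F" and w: "weight w t" "l \<le> t" "length w < t"
  shows "Theta F w = of_nat t * F w - bar_P w F"
proof -
  have ne: "w \<noteq> []" using w by auto
  have "bar_D w (\<lambda>y. bar_X y F) = 0"
  proof (rule vanish_D[OF _ w(1)])
    show "vanish (length w) (Suc t) (\<lambda>y. bar_X y F)"
      unfolding vanish_def
    proof (intro allI impI)
      fix y t' assume y: "length y = length w" "weight y t'" "Suc t \<le> t'"
      show "bar_X y F = 0"
        by (rule vanish_X[OF vanish_above_vanish[OF F(3)] y(2) F(1)]) (use y w in auto)
    qed
  qed
  moreover have "bar_X w (\<lambda>y. bar_D y F) = 0"
  proof (rule vanish_X[OF _ w(1) multilin_D[OF F(1)]])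
    show "vanish (Suc (length w)) t (\<lambda>y. bar_D y F)"
      unfolding vanish_def
    proof (intro allI impI)
      fix y t' assume y: "length y = Suc (length w)" "weight y t'" "t \<le> t'"
      show "bar_D y F = 0"
        by (rule vanish_D[OF vanish_above_vanish[OF F(3)] y(2)]) (use y w in auto)
    qed
  qed
  moreover have "bar_W w F = of_nat t * F w"
    by (rule vanish_W[OF vanish_above_vanish[OF F(3)] w(1) F(1)]) (use w in auto)
  ultimately show ?thesis using Theta_eq[OF F(1,2) weight_letters[OF w(1)] ne] by simp
qed

lemma vanish_above_P: "multilin F \<Longrightarrow> vanish_above l F \<Longrightarrow> vanish_above l (\<lambda>w. bar_P w F)"
  unfolding vanish_above_def[of l "\<lambda>w. bar_P w F"]
  by (intro allI impI, rule vanish_P[OF vanish_above_vanish]) auto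

lemma vanish_above_falling: "multilin F \<Longrightarrow> vanish_above l F \<Longrightarrow> vanish_above l (falling s m F)"
proof (induct m arbitrary: s)
  case (Suc m)
  then have "vanish_above l (falling (Suc s) m F)" by blast
  moreover from this have "vanish_above l (\<lambda>w. bar_P w (falling (Suc s) m F))"
    by (rule vanish_above_P[OF multilin_falling[OF Suc(2)]])
  ultimately show ?case by (simp add: vanish_above_def)
qed simp

lemma vanish_above_Theta: "multilin F \<Longrightarrow> bar_closed F \<Longrightarrow> vanish_above l F \<Longrightarrow> vanish_above l (Theta F)"
proof -
  assume F: "multilin F" "bar_closed F" "vanish_above l F"
  show "vanish_above l (Theta F)"
    unfolding vanish_above_def
  proof (intro allI impI)
    fix w t assume w: "weight w t" "l < t" "length w < t"
    have "F w = 0" "bar_P w F = 0"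
      using F(3) vanish_above_P[OF F(1,3)] w unfolding vanish_above_def by blast+
    then show "Theta F w = 0" using Theta_leading[OF F w(1) _ w(3)] w(2) by simp
  qed
qed

text \<open>The product (Theta - 1) ... (Theta - m) applied to F. It starts at 1 because Theta
  vanishes at a one-letter cocycle \<open>[u]\<close>: each of these factors acts there by a nonzero
  scalar, whereas a factor Theta would lose F \<open>[u]\<close>.\<close>

primrec Kseq :: "nat \<Rightarrow> ('a list \<Rightarrow> rat) \<Rightarrow> 'a list \<Rightarrow> rat" where
  "Kseq 0 F = F"
| "Kseq (Suc m) F = (\<lambda>w. Theta (Kseq m F) w - of_nat (Suc m) * Kseq m F w)"

lemma Kseq_props:
  assumes F: "multilin F" "bar_closed F" "vanish_above l F"
  shows "multilin (Kseq m F) \<and> bar_closed (Kseq m F) \<and> vanish_above l (Kseq m F)"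
proof (induct m)
  case (Suc m)
  note h = Suc[THEN conjunct1] Suc[THEN conjunct2, THEN conjunct1] Suc[THEN conjunct2, THEN conjunct2]
  have "bar_closed (Kseq (Suc m) F)"
    using closed_Theta[OF h(1)] h(2)
    by (simp add: bar_closed_def lin_diff[OF lin_d] lin_scale[OF lin_d] del: of_nat_Suc)
  moreover have "vanish_above l (Kseq (Suc m) F)"
    using vanish_above_Theta[OF h] h(3) by (simp add: vanish_above_def)
  moreover have "multilin (Kseq (Suc m) F)"
    unfolding Kseq.simps by (intro multilin_comb multilin_Theta h(1))
  ultimately show ?case by blast
qed (use F in simp)

text \<open>On weight l the factor Theta - j acts as (l - j) - P, so j = 1, ..., m produces the
  roots l - 1, ..., l - m of P, up to the sign.\<close>

lemma Kseq_falling: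
  assumes F: "multilin F" "bar_closed F" "vanish_above l F" and "m \<le> l" "weight w t" "l \<le> t" "length w < t"
  shows "Kseq m F w = (-1) ^ m * falling (l - m) m F w"
  using assms(4-)
proof (induct m arbitrary: w t)
  case (Suc m)
  note K = Kseq_props[OF F]
  show ?case
  proof (cases "l < t")
    case True
    then show ?thesis
      using K[of "Suc m"] vanish_above_falling[OF F(1,3), of "l - Suc m" "Suc m"] Suc(3,5)
      unfolding vanish_above_def by (metis mult_zero_right)
  next
    case False
    then have t: "t = l" using Suc(4) by simp
    define G where "G = falling (l - m) m F"
    have IH: "Kseq m F y = (-1) ^ m * G y" if "weight y t'" "l \<le> t'" "length y < t'" for y t'
      using Suc(1)[OF _ that] Suc(2) by (simp add: G_def)
    \<comment> \<open>The induction hypothesis compares the two functions only on words of weight at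
      least l; this suffices because P keeps length and weight.\<close>
    have "bar_P w (\<lambda>y. Kseq m F y - (-1) ^ m * G y) = 0"
    proof (rule vanish_P[of w l])
      show "multilin (\<lambda>y. Kseq m F y - (-1) ^ m * G y)"
        using K[of m] by (intro multilin_comb) (simp_all add: G_def multilin_falling[OF F(1)])
      show "vanish (length w) l (\<lambda>y. Kseq m F y - (-1) ^ m * G y)"
        unfolding vanish_def using IH Suc(5) t by simp
    qed (use Suc t in simp)
    then have P: "bar_P w (Kseq m F) = (-1) ^ m * bar_P w G"
      by (simp add: lin_diff[OF lin_P] lin_scale[OF lin_P])
    have "Theta (Kseq m F) w = of_nat l * Kseq m F w - bar_P w (Kseq m F)"
      using Theta_leading[of "Kseq m F" l w l] K[of m] Suc t by auto
    then have "Kseq (Suc m) F w = (-1) ^ Suc m * (bar_P w G - (of_nat l - of_nat (Suc m)) * G w)"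
      using IH[OF Suc(3) Suc(4,5)] by (simp add: P algebra_simps)
    moreover have "Suc (l - Suc m) = l - m" using Suc(2) by simp
    ultimately show ?thesis
      using Suc(2) by (simp add: G_def of_nat_diff)
  qed
qed simp

text \<open>
  A decomposable cocycle bounds in the bar construction, evaluated on bar cocycles: \<open>Theta\<close> is
  null-homotopic and acts on the part of weight \<open>l\<close> as \<open>l - P\<close>, where the eigenvalues of \<open>P\<close> on words
  of length less than \<open>l\<close> are less than \<open>l\<close>.
\<close>

theorem bar_decomposable:
  assumes "multilin F" "bar_closed F" "vanish_above l F" "u \<in> Fil 2" "d u = 0"
  shows "F [u] = 0"
  using assms(1-3)
proof (induct l arbitrary: F)
  case 0
  \<comment> \<open>The word \<open>[u]\<close> has length 1 and weight 2, so it falls under the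
    vanishing hypothesis.\<close>
  have "weight [u] (2 + 0)" by (rule weight_Cons[OF assms(4)]) auto
  then show ?case using 0(3) unfolding vanish_above_def by fastforce
next
  case (Suc l)
  note K = Kseq_props[OF Suc(2-)]
  have "Theta G [u] = 0" if "multilin G" for G
  proof -
    \<comment> \<open>A one-letter word has no products, so its bar differential is
      \<open>[d u]\<close>, which is zero.\<close>
    have "Theta G [u] = bar_X [d u] G" by (simp add: Theta_def del: bar_X.simps)
    then show ?thesis using multilin_hd_zero[OF multilin_X[OF that], of "[]"] by (simp only: assms(5))
  qed
  then have u: "Kseq (Suc m) F [u] = - of_nat (Suc m) * Kseq m F [u]" for m
    using K[of m] by (simp del: of_nat_Suc)
  have nz: "Kseq m F [u] = 0 \<Longrightarrow> F [u] = 0" for m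
    by (induct m) (use u in \<open>simp_all del: of_nat_Suc Kseq.simps(2)\<close>)
  have "vanish_above l (Kseq (Suc l) F)"
    unfolding vanish_above_def
  proof (intro allI impI)
    fix w t assume w: "weight w t" "l < t" "length w < t"
    show "Kseq (Suc l) F w = 0"
    proof (cases "Suc l < t")
      case True
      then show ?thesis using K[of "Suc l"] w unfolding vanish_above_def by blast
    next
      case False
      \<comment> \<open>The weight is exactly \<open>Suc l\<close> here. The \<open>Suc l\<close>
        factors of \<open>Kseq\<close> exhaust the possible eigenvalues 0, ..., l of P on words of
        length at most l.\<close>
      then have "length w < Suc l" using w by simp
      then show ?thesis
        using Kseq_falling[OF Suc(2-) order_refl w(1) _ w(3)] w(2)
          falling_short[OF _ Suc(2), of w "Suc l"] by simp
    qed
  qed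
  then have "Kseq (Suc l) F [u] = 0" using Suc(1) K[of "Suc l"] by blast
  then show ?case by (rule nz)
qed

end

section \<open>Derivations\<close>

lemma ex_separating_functional:
  fixes s :: "rat \<Rightarrow> 'y::ab_group_add \<Rightarrow> 'y"
  assumes s: "vector_space s" and S: "module.subspace s S" and z: "z \<notin> S"
  shows "\<exists>g. Vector_Spaces.linear s (*) g \<and> g z = (1::rat) \<and> (\<forall>x\<in>S. g x = 0)"
proof -
  interpret s: vector_space s by fact
  interpret r: vector_space "(*) :: rat \<Rightarrow> rat \<Rightarrow> rat" by (rule vector_space_rat)
  interpret p: vector_space_pair s "(*) :: rat \<Rightarrow> rat \<Rightarrow> rat" ..
  obtain B where B: "B \<subseteq> S" "s.independent B" "S \<subseteq> s.span B"
    using s.maximal_independent_subset[of S] by blast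
  have "s.span B \<subseteq> S" using B(1) S by (rule s.span_minimal)
  then have "z \<notin> s.span B" using z by blast
  then have "s.independent (insert z B)" using B(2) by (rule s.independent_insertI)
  then obtain g where g: "Vector_Spaces.linear s (*) g"
      "\<forall>x\<in>insert z B. g x = (if x = z then 1 else 0::rat)"
    using p.linear_independent_extend[of "insert z B" "\<lambda>x. if x = z then 1 else 0"] by blast
  have "g x = 0" if "x \<in> B" for x using g(2) that B(1) z by auto
  then have "g x = 0" if "x \<in> S" for x
    using p.linear_eq_0_on_span[OF g(1), of B x] B(3) that by blast
  then show ?thesis using g by auto
qed

context cdga
begin

abbreviation Der where "Der \<equiv> derivations A"
abbreviation DD where "DD \<equiv> der_diff A"
abbreviation fs :: "rat \<Rightarrow> ('a \<Rightarrow> 'a) \<Rightarrow> 'a \<Rightarrow> 'a" where "fs \<equiv> (\<lambda>c \<theta> x. sm c (\<theta> x))"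

definition cm :: "'a \<Rightarrow> ('a \<Rightarrow> 'a) \<Rightarrow> 'a \<Rightarrow> 'a" where "cm c \<theta> = (\<lambda>x. c \<odot> \<theta> x)"

lemma vs_fs: "vector_space fs"
  by (rule vector_space_fun[OF vs])

sublocale fs: vector_space fs
  by (rule vs_fs)

lemma DerD:
  assumes "\<theta> \<in> Der k"
  shows Der_add: "\<theta> (x + y) = \<theta> x + \<theta> y" and Der_scale: "\<theta> (sm r x) = sm r (\<theta> x)"
    and Der_gr: "x \<in> gr p \<Longrightarrow> \<theta> x \<in> gr (p - k)"
    and Der_mul: "x \<in> gr p \<Longrightarrow> \<theta> (x \<odot> y) = \<theta> x \<odot> y + sm (koszul k p) (x \<odot> \<theta> y)"
    and Der_zero: "\<theta> 0 = 0" and Der_uminus: "\<theta> (- x) = - \<theta> x"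
proof -
  show 1: "\<theta> (x + y) = \<theta> x + \<theta> y" "\<theta> (sm r x) = sm r (\<theta> x)" for x y r
    using assms unfolding derivations_def by (simp_all add: Vector_Spaces.linear_iff)
  show "x \<in> gr p \<Longrightarrow> \<theta> x \<in> gr (p - k)"
    "x \<in> gr p \<Longrightarrow> \<theta> (x \<odot> y) = \<theta> x \<odot> y + sm (koszul k p) (x \<odot> \<theta> y)"
    using assms unfolding derivations_def by blast+
  show 0: "\<theta> 0 = 0" using 1(1)[of 0 0] by simp
  show "\<theta> (- x) = - \<theta> x"
    by (rule minus_unique[symmetric]) (simp add: 0 flip: 1(1))
qed

lemma DerI:
  assumes "\<And>x y. \<theta> (x + y) = \<theta> x + \<theta> y" "\<And>r x. \<theta> (sm r x) = sm r (\<theta> x)"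
    "\<And>p x. x \<in> gr p \<Longrightarrow> \<theta> x \<in> gr (p - k)"
    "\<And>p x y. x \<in> gr p \<Longrightarrow> \<theta> (x \<odot> y) = \<theta> x \<odot> y + sm (koszul k p) (x \<odot> \<theta> y)"
  shows "\<theta> \<in> Der k"
  unfolding derivations_def using assms linearI[OF vs vs, of \<theta>] by blast

lemma Der_subspace: "fs.subspace (Der k)"
proof (rule fs.subspaceI)
  show "0 \<in> Der k" by (rule DerI) simp_all
  show "\<theta> + \<eta> \<in> Der k" if "\<theta> \<in> Der k" "\<eta> \<in> Der k" for \<theta> \<eta>
    by (rule DerI) (simp_all add: DerD(1,2,3)[OF that(1)] DerD(1,2,3)[OF that(2)] DerD(4)[OF that(1)]
        DerD(4)[OF that(2)] gr_add mul_add_left mul_add_right vs.scale_right_distrib)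
  show "fs c \<theta> \<in> Der k" if "\<theta> \<in> Der k" for c \<theta>
    by (rule DerI) (simp_all add: DerD(1,2,3)[OF that] DerD(4)[OF that] gr_scale
        vs.scale_right_distrib mult.commute)
qed

lemma Der_0 [simp]: "0 \<in> Der k"
  using Der_subspace fs.subspace_0 by blast

lemma DD_apply: "DD k \<theta> x = d (\<theta> x) - sm (koszul 1 k) (\<theta> (d x))"
  by (simp add: der_diff_def der_bracket_def koszul_minus1)

lemma DD_linear: "Vector_Spaces.linear fs fs (DD k)"
  by (rule linearI[OF vs_fs vs_fs])
    (simp_all add: fun_eq_iff DD_apply d_add vs.scale_right_distrib vs.scale_right_diff_distrib
      mult.commute)

lemma DD_DD: "\<theta> \<in> Der k \<Longrightarrow> DD (k - 1) (DD k \<theta>) = 0"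
proof -
  assume t: "\<theta> \<in> Der k"
  have "koszul 1 (k - 1) = - koszul 1 k" by (auto simp: koszul_def)
  then show ?thesis
    by (simp add: fun_eq_iff DD_apply Der_zero[OF t] d_add[of _ "- z" for z, simplified])
qed

lemma DD_add: "DD k (\<theta> + \<eta>) = DD k \<theta> + DD k \<eta>" and DD_scale: "DD k (fs r \<theta>) = fs r (DD k \<theta>)"
  and DD_diff: "DD k (\<theta> - \<eta>) = DD k \<theta> - DD k \<eta>"
proof -
  interpret l: Vector_Spaces.linear fs fs "DD k" by (rule DD_linear)
  show "DD k (\<theta> + \<eta>) = DD k \<theta> + DD k \<eta>" "DD k (fs r \<theta>) = fs r (DD k \<theta>)"
    "DD k (\<theta> - \<eta>) = DD k \<theta> - DD k \<eta>"
    by (rule l.add l.scale l.diff)+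
qed

lemma DD_Der:
  assumes "\<theta> \<in> Der k" shows "DD k \<theta> \<in> Der (k - 1)"
proof (rule DerI)
  note t = assms
  show "DD k \<theta> (x + y) = DD k \<theta> x + DD k \<theta> y" "DD k \<theta> (sm r x) = sm r (DD k \<theta> x)" for x y r
    by (simp_all add: DD_apply d_add Der_add[OF t] Der_scale[OF t] vs.scale_right_distrib
        vs.scale_right_diff_distrib mult.commute)
  show "DD k \<theta> x \<in> gr (p - (k - 1))" if "x \<in> gr p" for x p
  proof -
    have e: "p - (k - 1) = p - k + 1" "p - k + 1 = p + 1 - k" by simp_all
    show ?thesis
      unfolding DD_apply e(1)
      by (intro gr_diff gr_scale d_gr[OF Der_gr[OF t that]] Der_gr[OF t d_gr[OF that], folded e(2)])
  qed
  show "DD k \<theta> (x \<odot> y) = DD k \<theta> x \<odot> y + sm (koszul (k - 1) p) (x \<odot> DD k \<theta> y)"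
    if x: "x \<in> gr p" for x y p
  proof -
    have k: "koszul (k - 1) p = koszul 1 p * koszul k p" "koszul 1 (p - k) = koszul 1 p * koszul 1 k"
      "koszul k (p + 1) = koszul k p * koszul 1 k"
      by (auto simp: koszul_def)
    have m: "a \<odot> (b - c) = a \<odot> b - a \<odot> c" "(a - b) \<odot> c = a \<odot> c - b \<odot> c" for a b c
      using mul_add_right[of a b "- c"] mul_add_left[of a "- b" c] by simp_all
    have "\<theta> (d (x \<odot> y)) = \<theta> (d x) \<odot> y + sm (koszul k (p + 1)) (d x \<odot> \<theta> y)
        + sm (koszul 1 p) (\<theta> x \<odot> d y + sm (koszul k p) (x \<odot> \<theta> (d y)))"
      by (simp add: d_mul_gr[OF x] Der_add[OF t] Der_scale[OF t] Der_mul[OF t d_gr[OF x]] Der_mul[OF t x])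
    moreover have "d (\<theta> (x \<odot> y)) = d (\<theta> x) \<odot> y + sm (koszul 1 (p - k)) (\<theta> x \<odot> d y)
        + sm (koszul k p) (d x \<odot> \<theta> y + sm (koszul 1 p) (x \<odot> d (\<theta> y)))"
      by (simp add: Der_mul[OF t x] d_add d_mul_gr[OF Der_gr[OF t x]] d_mul_gr[OF x])
    ultimately show ?thesis
      by (simp add: DD_apply m k vs.scale_right_distrib vs.scale_right_diff_distrib mult_ac)
  qed
qed

lemma cm_Der: "c \<in> gr q \<Longrightarrow> \<theta> \<in> Der k \<Longrightarrow> cm c \<theta> \<in> Der (k - q)"
proof (rule DerI)
  assume c: "c \<in> gr q" and t: "\<theta> \<in> Der k"
  show "cm c \<theta> (x + y) = cm c \<theta> x + cm c \<theta> y" "cm c \<theta> (sm r x) = sm r (cm c \<theta> x)" for x y r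
    by (simp_all add: cm_def DerD(1,2)[OF t] mul_add_right)
  show "cm c \<theta> x \<in> gr (p - (k - q))" if "x \<in> gr p" for x p
    using mul_gr[OF c DerD(3)[OF t that]] by (simp add: cm_def algebra_simps)
  show "cm c \<theta> (x \<odot> y) = cm c \<theta> x \<odot> y + sm (koszul (k - q) p) (x \<odot> cm c \<theta> y)"
    if x: "x \<in> gr p" for x y p
  proof -
    have "koszul (k - q) p = koszul k p * koszul q p" by (auto simp: koszul_def)
    moreover have "c \<odot> x \<odot> \<theta> y = sm (koszul q p) (x \<odot> c \<odot> \<theta> y)"
      using mul_comm[OF c x] by simp
    ultimately show ?thesis
      by (simp add: cm_def DerD(4)[OF t x] mul_add_right flip: mul_assoc)
  qed
qed

lemma DD_cm: "c \<in> gr q \<Longrightarrow> DD (k - q) (cm c \<theta>) = cm (d c) \<theta> + cm (tau c) (DD k \<theta>)"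
proof -
  assume c: "c \<in> gr q"
  have "koszul 1 (k - q) = koszul 1 q * koszul 1 k" by (auto simp: koszul_def)
  then show ?thesis
    by (simp add: fun_eq_iff DD_apply cm_def d_mul tau_gr[OF c]
        mul_add_right[of _ _ "- z" for z, simplified] vs.scale_right_diff_distrib)
qed

lemma cm_linear: "cm (x + y) \<theta> = cm x \<theta> + cm y \<theta>" "cm (sm r x) \<theta> = fs r (cm x \<theta>)"
  "cm c (\<theta> + \<eta>) = cm c \<theta> + cm c \<eta>" "cm c (fs r \<theta>) = fs r (cm c \<theta>)" "cm c (\<theta> - \<eta>) = cm c \<theta> - cm c \<eta>"
  "cm c 0 = 0" "cm (a \<odot> b) \<theta> = cm a (cm b \<theta>)"
  by (simp_all add: fun_eq_iff cm_def mul_add_left mul_add_right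
      mul_add_right[of _ _ "- z" for z, simplified] mul_assoc)

text \<open>The part of degree k of an arbitrary map. It turns operators that are given degree by
  degree on derivations into linear operators on all maps, as inhomogeneous letters require.\<close>

definition dcomp :: "int \<Rightarrow> ('a \<Rightarrow> 'a) \<Rightarrow> 'a \<Rightarrow> 'a" where
  "dcomp k \<theta> x = (\<Sum>p | hcomp gr x p \<noteq> 0. hcomp gr (\<theta> (hcomp gr x p)) (p - k))"

lemma dcomp_linear: "Vector_Spaces.linear fs fs (dcomp k)"
  by (rule linearI[OF vs_fs vs_fs])
    (simp_all add: fun_eq_iff dcomp_def hcomp_add hcomp_scale sum.distrib vs.scale_sum_right)

lemma dcomp_Der: "\<theta> \<in> Der k \<Longrightarrow> dcomp j \<theta> = (if j = k then \<theta> else 0)"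
proof
  fix x assume t: "\<theta> \<in> Der k"
  have "hcomp gr (\<theta> (hcomp gr x p)) (p - j) = (if j = k then \<theta> (hcomp gr x p) else 0)" for p
    using hcomp_hom[OF DerD(3)[OF t hcomp_gr[of x p]]] by simp
  moreover have "(\<Sum>p\<in>S. \<theta> (f p)) = \<theta> (sum f S)" if "finite S" for f and S :: "int set"
    using that by induct (simp_all add: Der_zero[OF t] DerD(1)[OF t])
  ultimately show "dcomp j \<theta> x = (if j = k then \<theta> else 0) x"
    by (simp add: dcomp_def hcomp_sum)
qed

end

section \<open>Derivations of a minimal model\<close>

context sullivan
begin

text \<open>Applied to a product of at least two generators, the Leibniz rule leaves a factor in the
  augmentation ideal in every term.\<close>

lemma Der_eps_Fil_2:
  assumes t: "\<theta> \<in> Der k" and x: "x \<in> Fil 2"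
  shows "eps (\<theta> x) = 0"
  using x
proof (induct rule: Fil_induct)
  case (word r w y)
  obtain x w' where w: "w = x # w'" "w' \<noteq> []" using word(2) by (cases w) (auto simp: Suc_le_eq)
  obtain p where p: "x \<in> V p" and w': "w' \<in> LW" using word(1) w by (auto simp: LW_Cons)
  have "eps x = 0" using V_Fil[OF p] by (rule eps_Fil)
  then have "eps (\<theta> (val w)) = 0"
    using w eps_val[OF w'] by (simp add: Der_mul[OF t V_gr[OF p]] eps_add eps_mul)
  then show ?case using word by (simp add: Der_add[OF t] Der_scale[OF t] eps_add)
qed (simp add: Der_zero[OF t])

lemma eps_DD: "\<theta> \<in> Der k \<Longrightarrow> eps (DD k \<theta> x) = 0"
  by (simp add: DD_apply eps_diff Der_eps_Fil_2 d_Fil_2)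

lemma Der_one: "\<theta> \<in> Der k \<Longrightarrow> \<theta> one = 0"
  using Der_mul[of \<theta> k one 0 one] one_gr by (simp add: koszul_def)

lemma Der_eq_0I:
  assumes t: "\<theta> \<in> Der k" and V: "\<And>p v. v \<in> V p \<Longrightarrow> \<theta> v = 0"
  shows "\<theta> = 0"
proof
  fix x
  have "\<theta> (val w) = 0" if "w \<in> LW" for w
    using that
  proof (induct w)
    case (Cons x w)
    then obtain p where "x \<in> V p" "w \<in> LW" by (auto simp: LW_Cons)
    then show ?case using Cons(1) V Der_mul[OF t V_gr] by auto
  qed (simp add: Der_one[OF t])
  then show "\<theta> x = 0 x"
    by (induct x rule: word_induct) (simp_all add: Der_add[OF t] Der_scale[OF t])
qed

text \<open>A homogeneous substitute for \<open>weight\<close>: an element of \<open>Fil m\<close>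
  has components only in degrees at least 2 m, so a bound on the degree takes the place of word
  length.\<close>

primrec hwt :: "'a list \<Rightarrow> nat \<Rightarrow> bool" where
  "hwt [] s = (s = 0)"
| "hwt (c # x) s = (\<exists>q m t. s = m + t \<and> Suc 0 \<le> m \<and> c \<in> gr q \<and> 2 * int m \<le> q \<and> hwt x t)"

lemma multilin_homogeneous:
  assumes "multilin F" "weight w t" "\<And>y. hwt y t \<Longrightarrow> length y = length w \<Longrightarrow> F y = 0"
  shows "F w = 0"
  using assms
proof (induct w arbitrary: F t)
  case (Cons c x)
  note F = Cons(2)
  obtain m t' where m: "t = m + t'" "Suc 0 \<le> m" "c \<in> Fil m" "weight x t'" using Cons(3) by auto
  have "F (hcomp gr c p # x) = 0" for p
  proof (cases "p < 2 * int m")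
    case True
    then show ?thesis using Fil_hcomp[OF m(3)] multilin_hd_zero[OF F] by simp
  next
    case False
    show ?thesis
    proof (rule Cons(1)[OF multilin_Cons[OF F] m(4)])
      fix y assume y: "hwt y t'" "length y = length x"
      have "hwt (hcomp gr c p # y) t"
        unfolding hwt.simps using m(1,2) False y(1) hcomp_gr[of c p]
        by (intro exI[of _ p] exI[of _ m] exI[of _ t']) auto
      then show "F (hcomp gr c p # y) = 0" using Cons(4) y(2) by simp
    qed
  qed
  moreover have "F (sum f S # x) = (\<Sum>p\<in>S. F (f p # x))" if "finite S" for f and S :: "int set"
    using that by induct (simp_all add: multilin_hd_zero[OF F] multilin_hd_add[OF F])
  ultimately have "F ((\<Sum>p | hcomp gr c p \<noteq> 0. hcomp gr c p) # x) = 0" by simp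
  then show ?case by (simp only: hcomp_sum)
qed simp

end

section \<open>Cocycles acting on a cycle of derivations\<close>

text \<open>
  \<open>s k\<close> is a linear section of \<open>D\<close> over the boundaries of degree \<open>k\<close>; in the degrees
  where the homology of the derivations vanishes it gives a contraction \<open>sig\<close>, and the iterated operators
  \<open>hh [c\<^sub>1, ..., c\<^sub>k] = sig (c\<^sub>1 sig (c\<^sub>2 ... sig (c\<^sub>k \<alpha>)))\<close> are a homotopy for the action on \<open>\<alpha>\<close>.
\<close>

locale derivation_contraction = sullivan A V for A :: "'a::ab_group_add cdga" and V +
  fixes \<alpha> :: "'a \<Rightarrow> 'a" and N m :: int and s :: "int \<Rightarrow> ('a \<Rightarrow> 'a) \<Rightarrow> 'a \<Rightarrow> 'a"
    and \<Lambda> :: "('a \<Rightarrow> 'a) \<Rightarrow> rat"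
  assumes alpha: "\<alpha> \<in> Der N" "DD N \<alpha> = 0"
    and s_linear: "Vector_Spaces.linear fs fs (s k)"
    and s_Der: "s k \<theta> \<in> Der (k + 1)"
    and s_inv: "\<theta> \<in> Der (k + 1) \<Longrightarrow> DD (k + 1) (s k (DD (k + 1) \<theta>)) = DD (k + 1) \<theta>"
    and acyclic: "N - m + 2 \<le> k \<Longrightarrow> k < N \<Longrightarrow> \<theta> \<in> Der k \<Longrightarrow> DD k \<theta> = 0 \<Longrightarrow>
      \<exists>\<eta>\<in>Der (k + 1). \<theta> = DD (k + 1) \<eta>"
    and Lam_linear: "Vector_Spaces.linear fs (*) \<Lambda>"
    and Lam_zero: "2 \<le> q \<Longrightarrow> q \<le> m - 2 \<Longrightarrow> c \<in> gr q \<Longrightarrow> \<theta> \<in> Der (N - m + 1 + q) \<Longrightarrow>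
      \<Lambda> (DD (N - m + 1) (cm c \<theta>)) = 0"
begin

lemma s_add: "s k (\<theta> + \<eta>) = s k \<theta> + s k \<eta>" and s_scale: "s k (fs r \<theta>) = fs r (s k \<theta>)"
  and s_zero: "s k 0 = 0"
proof -
  interpret l: Vector_Spaces.linear fs fs "s k" by (rule s_linear)
  show "s k (\<theta> + \<eta>) = s k \<theta> + s k \<eta>" "s k (fs r \<theta>) = fs r (s k \<theta>)"
    "s k 0 = 0"
    by (rule l.add l.scale l.zero)+
qed

text \<open>The section s inverts D only on boundaries. Subtracting
  \<open>s (k - 1) (DD k \<theta>)\<close> first leaves a cycle, which bounds in the acyclic
  range.\<close>

definition sigk :: "int \<Rightarrow> ('a \<Rightarrow> 'a) \<Rightarrow> 'a \<Rightarrow> 'a" where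
  "sigk k \<theta> = s k (\<theta> - s (k - 1) (DD k \<theta>))"

text \<open>The sum starts one degree below the acyclic range: in its lowest degree the identity
  \<open>contraction\<close> evaluates \<open>sig\<close> on a boundary one degree further down,
  where s alone inverts D.\<close>

definition sig :: "('a \<Rightarrow> 'a) \<Rightarrow> 'a \<Rightarrow> 'a" where
  "sig \<theta> = (\<Sum>k\<in>{N - m + 1..<N}. sigk k (dcomp k \<theta>))"

lemma sigk_linear: "sigk k (\<theta> + \<eta>) = sigk k \<theta> + sigk k \<eta>" "sigk k (fs r \<theta>) = fs r (sigk k \<theta>)"
proof -
  have "\<theta> + \<eta> - (a + b) = (\<theta> - a) + (\<eta> - b)" for a b by simp
  then show "sigk k (\<theta> + \<eta>) = sigk k \<theta> + sigk k \<eta>"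
    by (simp only: sigk_def DD_add s_add)
  have "fs r \<theta> - fs r a = fs r (\<theta> - a)" for a
    by (rule fs.scale_right_diff_distrib[symmetric])
  then show "sigk k (fs r \<theta>) = fs r (sigk k \<theta>)"
    by (simp only: sigk_def DD_scale s_scale)
qed

lemma sig_add: "sig (\<theta> + \<eta>) = sig \<theta> + sig \<eta>" and sig_scale: "sig (fs r \<theta>) = fs r (sig \<theta>)"
proof -
  interpret l: Vector_Spaces.linear fs fs "dcomp k" for k by (rule dcomp_linear)
  show "sig (\<theta> + \<eta>) = sig \<theta> + sig \<eta>"
    by (simp only: sig_def l.add sigk_linear sum.distrib)
  show "sig (fs r \<theta>) = fs r (sig \<theta>)"
    by (simp only: sig_def l.scale sigk_linear fs.scale_sum_right)
qed

lemma sigk_zero [simp]: "sigk k 0 = 0"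
  using sigk_linear(1)[of k 0 0] by simp

lemma sig_Der: "\<theta> \<in> Der k \<Longrightarrow> sig \<theta> = (if N - m + 1 \<le> k \<and> k < N then sigk k \<theta> else 0)"
proof -
  assume t: "\<theta> \<in> Der k"
  have "sig \<theta> = (\<Sum>j\<in>{N - m + 1..<N}. if j = k then sigk k \<theta> else 0)"
    unfolding sig_def by (rule sum.cong) (simp_all add: dcomp_Der[OF t])
  then show ?thesis by simp
qed

lemma sig_in_Der: "\<theta> \<in> Der k \<Longrightarrow> sig \<theta> \<in> Der (k + 1)"
  by (simp add: sig_Der sigk_def s_Der)

lemma contraction:
  assumes k: "N - m + 2 \<le> k" "k < N" and t: "\<theta> \<in> Der k"
  shows "DD (k + 1) (sig \<theta>) = \<theta> - sig (DD k \<theta>)"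
proof -
  have Dt: "DD k \<theta> \<in> Der (k - 1)" by (rule DD_Der[OF t])
  have "DD k (\<theta> - s (k - 1) (DD k \<theta>)) = 0"
    using s_inv[of \<theta> "k - 1"] t by (simp add: DD_diff)
  moreover have in_Der: "\<theta> - s (k - 1) (DD k \<theta>) \<in> Der k"
    using fs.subspace_diff[OF Der_subspace t, of "s (k - 1) (DD k \<theta>)"] s_Der[of "k - 1"] by simp
  ultimately obtain \<eta> where \<eta>: "\<eta> \<in> Der (k + 1)" "\<theta> - s (k - 1) (DD k \<theta>) = DD (k + 1) \<eta>"
    using acyclic[OF k] by blast
  have "sig \<theta> = s k (DD (k + 1) \<eta>)"
    using k \<eta>(2) by (simp add: sig_Der[OF t] sigk_def)
  then have "DD (k + 1) (sig \<theta>) = \<theta> - s (k - 1) (DD k \<theta>)"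
    using s_inv[OF \<eta>(1)] \<eta>(2) by simp
  moreover have "sig (DD k \<theta>) = s (k - 1) (DD k \<theta>)"
    using k by (simp add: sig_Der[OF Dt] sigk_def DD_DD[OF t] s_zero)
  ultimately show ?thesis by simp
qed

primrec hh :: "'a list \<Rightarrow> 'a \<Rightarrow> 'a" where
  "hh [] = \<alpha>"
| "hh (c # x) = sig (cm c (hh x))"

text \<open>The degree of the derivation \<open>hh w\<close>: it starts at N, the degree of
  \<alpha>, and a letter of degree q lowers it by q - 1.\<close>

primrec hwd :: "'a list \<Rightarrow> int \<Rightarrow> bool" where
  "hwd [] k = (k = N)"
| "hwd (c # x) k = (\<exists>q j. k = j - q + 1 \<and> 2 \<le> q \<and> c \<in> gr q \<and> hwd x j)"

lemma hh_Der: "hwd w k \<Longrightarrow> hh w \<in> Der k"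
proof (induct w arbitrary: k)
  case (Cons c x)
  then obtain q j where q: "k = j - q + 1" "c \<in> gr q" "hwd x j" by auto
  show ?case using sig_in_Der[OF cm_Der[OF q(2) Cons(1)[OF q(3)]]] q(1) by simp
qed (simp add: alpha)

lemma hwd_le: "hwd w k \<Longrightarrow> k \<le> N - int (length w)"
  by (induct w arbitrary: k) fastforce+

text \<open>A letter of weight m has degree q \<ge> 2 m, hence lowers the degree of
  \<open>hh\<close> by q - 1 \<ge> m.\<close>

lemma hwt_hwd: "hwt w t \<Longrightarrow> \<exists>k \<le> N - int t. hwd w k"
proof (induct w arbitrary: t)
  case (Cons c x)
  then obtain q m t' where q: "t = m + t'" "Suc 0 \<le> m" "c \<in> gr q" "2 * int m \<le> q" "hwt x t'" by auto
  then have "\<exists>k \<le> N - int t'. hwd x k" using Cons(1) by blast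
  then obtain k where k: "k \<le> N - int t'" "hwd x k" by blast
  have "hwd (c # x) (k - q + 1)"
    unfolding hwd.simps using q k by (intro exI[of _ q] exI[of _ k]) auto
  then show ?case using q k by (intro exI[of _ "k - q + 1"]) auto
qed auto

lemma functional_cm_sig:
  "Vector_Spaces.linear fs (*) \<mu> \<Longrightarrow> Vector_Spaces.linear fs (*) (\<lambda>\<theta>. \<mu> (cm c \<theta>))"
  "Vector_Spaces.linear fs (*) \<mu> \<Longrightarrow> Vector_Spaces.linear fs (*) (\<lambda>\<theta>. \<mu> (sig (cm c \<theta>)))"
  by (rule linearI[OF vs_fs vector_space_rat];
      simp add: cm_linear(3,4) sig_add sig_scale Vector_Spaces.linear_iff)+

text \<open>The contraction gives D sig (c hh x) = c hh x - sig (D (c hh x)). Expanding D (c hh x)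
  by the Leibniz rule and iterating produces the terms of the bar differential. The functional is
  arbitrary so that the induction can absorb the outer operator sig (c -).\<close>

lemma DD_hh:
  assumes "hwd (c # x) k" "N - m + 3 \<le> k" "Vector_Spaces.linear fs (*) \<mu>"
  shows "\<mu> (DD k (hh (c # x))) = \<mu> (cm c (hh x)) - bar_d (c # x) (\<lambda>y. \<mu> (hh y))"
  using assms
proof (induct x arbitrary: c k \<mu>)
  case Nil
  interpret \<mu>: Vector_Spaces.linear fs "(*)" \<mu> by (rule Nil(3))
  obtain q where q: "k = N - q + 1" "2 \<le> q" "c \<in> gr q" using Nil(1) by auto
  have t: "cm c \<alpha> \<in> Der (N - q)" by (rule cm_Der[OF q(3) alpha(1)])
  have "DD (N - q) (cm c \<alpha>) = cm (d c) \<alpha>"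
    by (simp add: DD_cm[OF q(3)] alpha cm_linear)
  then have "DD k (hh [c]) = cm c \<alpha> - sig (cm (d c) \<alpha>)"
    using contraction[OF _ _ t] q Nil(2) by simp
  then have "\<mu> (DD k (hh [c])) = \<mu> (cm c \<alpha>) - \<mu> (sig (cm (d c) \<alpha>))"
    by (simp only: \<mu>.diff)
  then show ?case by simp
next
  case (Cons c2 y)
  interpret \<mu>: Vector_Spaces.linear fs "(*)" \<mu> by (rule Cons(4))
  define x where "x = c2 # y"
  obtain q j where q: "k = j - q + 1" "2 \<le> q" "c \<in> gr q" "hwd x j" using Cons(2) unfolding x_def by auto
  have j: "j \<le> N - 1" using hwd_le[OF q(4)] by (simp add: x_def)
  have t: "cm c (hh x) \<in> Der (j - q)" by (rule cm_Der[OF q(3) hh_Der[OF q(4)]])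
  have "DD k (hh (c # x)) = cm c (hh x) - (sig (cm (d c) (hh x)) + sig (cm (tau c) (DD j (hh x))))"
    using contraction[OF _ _ t] q j Cons(3) by (simp add: DD_cm[OF q(3)] sig_add)
  then have "\<mu> (DD k (hh (c # x))) =
      \<mu> (cm c (hh x)) - (\<mu> (sig (cm (d c) (hh x))) + \<mu> (sig (cm (tau c) (DD j (hh x)))))"
    by (simp only: \<mu>.diff \<mu>.add)
  moreover have "\<mu> (sig (cm (tau c) (DD j (hh x)))) =
      \<mu> (sig (cm (tau c) (cm c2 (hh y)))) - bar_d x (\<lambda>z. \<mu> (hh (tau c # z)))"
    using Cons(1)[of c2 j "\<lambda>\<theta>. \<mu> (sig (cm (tau c) \<theta>))"] q Cons(3) functional_cm_sig(2)[OF Cons(4)]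
    by (simp add: x_def)
  ultimately show ?case by (simp add: x_def cm_linear(7))
qed

text \<open>The restriction to degree N - m makes \<open>GG\<close> vanish on homogeneous words of
  the wrong degree; without it, \<Lambda> is uncontrolled there.\<close>

definition \<Lambda>' :: "('a \<Rightarrow> 'a) \<Rightarrow> rat" where "\<Lambda>' \<theta> = \<Lambda> (dcomp (N - m) \<theta>)"

lemma Lam'_linear: "Vector_Spaces.linear fs (*) \<Lambda>'"
proof -
  interpret l: Vector_Spaces.linear fs fs "dcomp k" for k by (rule dcomp_linear)
  interpret \<Lambda>: Vector_Spaces.linear fs "(*)" \<Lambda> by (rule Lam_linear)
  show ?thesis
    unfolding \<Lambda>'_def[abs_def]
    by (rule linearI[OF vs_fs vector_space_rat]) (simp_all only: l.add l.scale \<Lambda>.add \<Lambda>.scale)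
qed

lemma Lam'_Der: "\<theta> \<in> Der k \<Longrightarrow> \<Lambda>' \<theta> = (if k = N - m then \<Lambda> \<theta> else 0)"
proof -
  interpret \<Lambda>: Vector_Spaces.linear fs "(*)" \<Lambda> by (rule Lam_linear)
  show "\<theta> \<in> Der k \<Longrightarrow> \<Lambda>' \<theta> = (if k = N - m then \<Lambda> \<theta> else 0)"
    using \<Lambda>.zero by (auto simp: \<Lambda>'_def dcomp_Der)
qed

text \<open>The bar cochain attached to \<Lambda>. The first letter acts without a contraction, so
  that \<open>GG [u]\<close> is \<Lambda> (u \<alpha>) for u of degree m.\<close>

primrec GG :: "'a list \<Rightarrow> rat" where
  "GG [] = 0"
| "GG (c # x) = \<Lambda>' (cm c (hh x))"

lemma hh_multilin: "hh (xs @ (x + y) # ys) = hh (xs @ x # ys) + hh (xs @ y # ys)"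
  "hh (xs @ sm r x # ys) = fs r (hh (xs @ x # ys))"
  by (induct xs) (simp_all add: cm_linear(1-4) sig_add sig_scale)

lemma multilin_GG: "multilin GG"
proof -
  interpret \<Lambda>': Vector_Spaces.linear fs "(*)" \<Lambda>' by (rule Lam'_linear)
  show ?thesis
    unfolding multilin_def
  proof (intro conjI allI)
    show "GG (xs @ (x + y) # ys) = GG (xs @ x # ys) + GG (xs @ y # ys)" for xs x y ys
      by (cases xs) (simp_all add: cm_linear(1-4) hh_multilin \<Lambda>'.add)
    show "GG (xs @ sm r x # ys) = r * GG (xs @ x # ys)" for xs r x ys
      by (cases xs) (simp_all add: cm_linear(1-4) hh_multilin \<Lambda>'.scale)
  qed
qed

lemma GG_degree: "hwd w k \<Longrightarrow> k \<noteq> N - m + 1 \<Longrightarrow> GG w = 0"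
proof (cases w)
  case (Cons c x)
  assume h: "hwd w k" "k \<noteq> N - m + 1"
  then obtain q j where q: "k = j - q + 1" "c \<in> gr q" "hwd x j" using Cons by auto
  show "GG w = 0"
    using Lam'_Der[OF cm_Der[OF q(2) hh_Der[OF q(3)]]] h(2) q(1) by (simp add: Cons)
qed simp

lemma bar_d_degree:
  assumes "hwd w k" "\<And>y. hwd y (k - 1) \<Longrightarrow> F y = 0"
  shows "bar_d w F = 0"
  using assms
proof (induct w arbitrary: k F)
  case (Cons c x)
  obtain q j where q: "k = j - q + 1" "2 \<le> q" "c \<in> gr q" "hwd x j" using Cons(2) by auto
  note F = Cons(3)
  have "hwd (d c # x) (k - 1)"
    unfolding hwd.simps using q d_gr[OF q(3)] by (intro exI[of _ "q + 1"] exI[of _ j]) auto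
  then have "F (d c # x) = 0" by (rule Cons(3))
  moreover have "bar_mu (tau c) x F = 0"
  proof (cases x)
    case (Cons c2 y)
    then obtain q2 j2 where q2: "j = j2 - q2 + 1" "2 \<le> q2" "c2 \<in> gr q2" "hwd y j2" using q(4) by auto
    have "hwd ((tau c \<odot> c2) # y) (k - 1)"
      unfolding hwd.simps using q q2 mul_gr[OF tau_gr_closed[OF q(3)] q2(3)]
      by (intro exI[of _ "q + q2"] exI[of _ j2]) auto
    then have "F ((tau c \<odot> c2) # y) = 0" by (rule F)
    then show ?thesis by (simp add: Cons)
  qed simp
  moreover have "bar_d x (\<lambda>y. F (tau c # y)) = 0"
  proof (rule Cons(1)[OF q(4)])
    fix y assume "hwd y (j - 1)"
    then have "hwd (tau c # y) (k - 1)"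
      unfolding hwd.simps using q tau_gr_closed[OF q(3)] by (intro exI[of _ q] exI[of _ "j - 1"]) auto
    then show "F (tau c # y) = 0" by (rule F)
  qed
  ultimately show ?case by simp
qed simp

text \<open>Degree reasons settle every case except k = N - m + 2. There \<Lambda> vanishes on D (c
  hh x), and \<open>DD_hh\<close> expands this into the bar differential of the whole word. Since x
  is not empty, hh x has degree at most N - 1, which forces |c| \<le> m - 2: this is the source of
  the bound in \<open>Lam_zero\<close>.\<close>

lemma bar_d_GG:
  assumes "hwd (c # x) k" "x \<noteq> []"
  shows "bar_d (c # x) GG = 0"
proof (cases "k = N - m + 2")
  case False
  show ?thesis
    by (rule bar_d_degree[OF assms(1)], rule GG_degree) (use False in auto)
next
  case True
  interpret \<Lambda>': Vector_Spaces.linear fs "(*)" \<Lambda>' by (rule Lam'_linear)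
  obtain c2 y where x: "x = c2 # y" using assms(2) by (cases x) auto
  obtain q j where q: "k = j - q + 1" "2 \<le> q" "c \<in> gr q" "hwd x j" using assms(1) by auto
  have j: "j = N - m + 1 + q" using q(1) True by simp
  have "j \<le> N - 1" using hwd_le[OF q(4)] by (simp add: x)
  then have "q \<le> m - 2" using j by simp
  have t: "cm c (hh x) \<in> Der (N - m + 1)"
    using cm_Der[OF q(3) hh_Der[OF q(4)]] j by simp
  have "\<Lambda> (DD (N - m + 1) (cm c (hh x))) = 0"
    using Lam_zero[OF q(2) \<open>q \<le> m - 2\<close> q(3)] hh_Der[OF q(4)] j by blast
  then have "\<Lambda>' (DD (N - m + 1) (cm c (hh x))) = 0"
    using Lam'_Der[OF DD_Der[OF t]] by simp
  moreover have "DD (N - m + 1) (cm c (hh x)) = cm (d c) (hh x) + cm (tau c) (DD j (hh x))"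
    using DD_cm[OF q(3), of j] j by simp
  ultimately have 0: "\<Lambda>' (cm (d c) (hh x)) + \<Lambda>' (cm (tau c) (DD j (hh x))) = 0"
    by (simp add: \<Lambda>'.add)
  have "\<Lambda>' (cm (tau c) (DD j (hh x))) =
      \<Lambda>' (cm (tau c) (cm c2 (hh y))) - bar_d x (\<lambda>z. \<Lambda>' (cm (tau c) (hh z)))"
    unfolding x by (rule DD_hh[OF _ _ functional_cm_sig(1)[OF Lam'_linear]]) (use q j x in auto)
  then show ?thesis
    using 0 by (simp add: x cm_linear(7))
qed

lemma closed_GG: "bar_closed GG"
  unfolding bar_closed_def
proof (intro allI impI)
  fix w assume w: "\<forall>c\<in>set w. c \<in> Fil (Suc 0)" "2 \<le> length w"
  show "bar_d w GG = 0"
  proof (rule multilin_homogeneous[OF multilin_d[OF multilin_GG] weight_length[OF w(1)]])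
    fix y assume y: "hwt y (length w)" "length y = length w"
    obtain k where "hwd y k" using hwt_hwd[OF y(1)] by blast
    moreover obtain c x where "y = c # x" "x \<noteq> []" using y(2) w(2) by (cases y; cases "tl y") auto
    ultimately show "bar_d y GG = 0" using bar_d_GG by blast
  qed
qed

text \<open>Weight t > m pushes the degree of \<open>hh\<close> on a homogeneous word down to at
  most N - t, below the degree N - m + 1 on which \<open>GG\<close> is supported.\<close>

lemma vanish_above_GG: "0 \<le> m \<Longrightarrow> vanish_above (nat m) GG"
  unfolding vanish_above_def
proof (intro allI impI)
  fix w t assume m: "0 \<le> m" and w: "weight w t" "nat m < t"
  show "GG w = 0"
  proof (rule multilin_homogeneous[OF multilin_GG w(1)])
    fix y assume "hwt y t"
    then obtain k where k: "k \<le> N - int t" "hwd y k" using hwt_hwd by blast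
    then have "k \<noteq> N - m + 1" using w(2) m by linarith
    then show "GG y = 0" using GG_degree[OF k(2)] by blast
  qed
qed

lemma Lam_decomposable:
  assumes "0 \<le> m" "u \<in> gr m" "u \<in> Fil 2" "d u = 0"
  shows "\<Lambda> (cm u \<alpha>) = 0"
proof -
  have "GG [u] = 0"
    by (rule bar_decomposable[OF multilin_GG closed_GG vanish_above_GG[OF assms(1)] assms(3,4)])
  then show ?thesis using Lam'_Der[OF cm_Der[OF assms(2) alpha(1)]] by simp
qed

end

context sullivan
begin

text \<open>In the application N = 2 e and m = e + 1, so the solution has degree e and the acyclic
  degrees are those strictly between e and 2 e.\<close>

theorem decomposable_cocycle_bounds:
  assumes alpha: "\<alpha> \<in> Der N" "DD N \<alpha> = 0"
    and acyclic: "\<And>k \<theta>. N - m + 2 \<le> k \<Longrightarrow> k < N \<Longrightarrow> \<theta> \<in> Der k \<Longrightarrow> DD k \<theta> = 0 \<Longrightarrow>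
      \<exists>\<eta>\<in>Der (k + 1). \<theta> = DD (k + 1) \<eta>"
    and u: "0 \<le> m" "u \<in> gr m" "u \<in> Fil 2" "d u = 0"
  shows "\<exists>\<eta>. \<eta> \<in> fs.span {cm c \<theta> | c q \<theta>. 2 \<le> q \<and> q \<le> m - 2 \<and> c \<in> gr q \<and> \<theta> \<in> Der (N - m + 1 + q)}
    \<and> DD (N - m + 1) \<eta> = cm u \<alpha>"
proof (rule ccontr)
  let ?T = "{cm c \<theta> | c q \<theta>. 2 \<le> q \<and> q \<le> m - 2 \<and> c \<in> gr q \<and> \<theta> \<in> Der (N - m + 1 + q)}"
  let ?S = "DD (N - m + 1) ` fs.span ?T"
  interpret p: vector_space_pair fs fs ..
  assume neg: "\<not> ?thesis"
  have "cm u \<alpha> \<notin> ?S"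
  proof
    assume "cm u \<alpha> \<in> ?S"
    then obtain \<eta> where "cm u \<alpha> = DD (N - m + 1) \<eta>" "\<eta> \<in> fs.span ?T" by (rule imageE)
    then have "\<eta> \<in> fs.span ?T \<and> DD (N - m + 1) \<eta> = cm u \<alpha>" by simp
    with neg show False by (elim notE) (rule exI)
  qed
  moreover have "fs.subspace ?S"
    by (rule p.linear_subspace_image[OF DD_linear fs.subspace_span])
  ultimately obtain \<Lambda> where L: "Vector_Spaces.linear fs (*) \<Lambda>" "\<Lambda> (cm u \<alpha>) = (1::rat)" "\<forall>x\<in>?S. \<Lambda> x = 0"
    using ex_separating_functional[OF vs_fs] by blast
  have "\<exists>g. g ` UNIV \<subseteq> Der (k + 1) \<and> Vector_Spaces.linear fs fs g \<and>
      (\<forall>v\<in>DD (k + 1) ` Der (k + 1). DD (k + 1) (g v) = v)" for k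
    by (rule p.linear_exists_right_inverse_on[OF DD_linear Der_subspace])
  then obtain s where s: "s k ` UNIV \<subseteq> Der (k + 1)" "Vector_Spaces.linear fs fs (s k)"
      "\<forall>v\<in>DD (k + 1) ` Der (k + 1). DD (k + 1) (s k v) = v" for k
    by metis
  interpret derivation_contraction A V \<alpha> N m s \<Lambda>
  proof (intro derivation_contraction.intro derivation_contraction_axioms.intro)
    show "sullivan A V" by (rule sullivan_axioms)
    show "\<alpha> \<in> Der N" "DD N \<alpha> = 0" by (rule alpha)+
    show "Vector_Spaces.linear fs fs (s k)" for k by (rule s(2))
    show "s k \<theta> \<in> Der (k + 1)" for k \<theta>
      using s(1)[of k] by (simp add: image_subset_iff)
    show "DD (k + 1) (s k (DD (k + 1) \<theta>)) = DD (k + 1) \<theta>" if "\<theta> \<in> Der (k + 1)" for k \<theta>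
      by (rule s(3)[rule_format, OF imageI[OF that]])
    show "\<exists>\<eta>\<in>Der (k + 1). \<theta> = DD (k + 1) \<eta>"
      if "N - m + 2 \<le> k" "k < N" "\<theta> \<in> Der k" "DD k \<theta> = 0" for k \<theta>
      by (rule acyclic[OF that])
    show "Vector_Spaces.linear fs (*) \<Lambda>" by (rule L(1))
    show "\<Lambda> (DD (N - m + 1) (cm c \<theta>)) = 0"
      if "2 \<le> q" "q \<le> m - 2" "c \<in> gr q" "\<theta> \<in> Der (N - m + 1 + q)" for q c \<theta>
    proof -
      have "cm c \<theta> \<in> ?T" using that by blast
      from fs.span_base[OF this] show ?thesis by (intro L(3)[rule_format] imageI)
    qed
  qed
  show False using Lam_decomposable[OF u] L(2) by simp
qed

end

section \<open>Homology of dg Lie algebras\<close>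

locale dgl =
  fixes L :: "'a::ab_group_add dgl"
  assumes dgl: "is_dgl L"
begin

lemmas dgl' = dgl[unfolded is_dgl_def]

lemma vs_L: "vector_space (lsmul L)"
  using dgl' by (rule conjunct1)

sublocale vl: vector_space "lsmul L"
  by (rule vs_L)

lemmas dgl_laws = dgl'[THEN conjunct2]

lemma lgr_subspace: "vl.subspace (lgr L k)"
  using dgl_laws[THEN conjunct1] by (rule spec)

lemma br_gr: "x \<in> lgr L i \<Longrightarrow> y \<in> lgr L j \<Longrightarrow> lbr L i j x y \<in> lgr L (i + j)"
  and br_sym: "x \<in> lgr L i \<Longrightarrow> y \<in> lgr L j \<Longrightarrow> lbr L i j x y = - lsmul L (koszul i j) (lbr L j i y x)"
  using dgl_laws[THEN conjunct2, THEN conjunct2, THEN conjunct1] by blast+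

lemma br_add: "x \<in> lgr L i \<Longrightarrow> y \<in> lgr L j \<Longrightarrow> z \<in> lgr L j \<Longrightarrow>
    lbr L i j x (y + z) = lbr L i j x y + lbr L i j x z"
  using dgl_laws[THEN conjunct2, THEN conjunct2, THEN conjunct2, THEN conjunct1] by blast

lemma ld_gr: "x \<in> lgr L k \<Longrightarrow> ldiff L k x \<in> lgr L (k - 1)"
  and ld_add: "x \<in> lgr L k \<Longrightarrow> y \<in> lgr L k \<Longrightarrow> ldiff L k (x + y) = ldiff L k x + ldiff L k y"
  and ld_scale: "x \<in> lgr L k \<Longrightarrow> ldiff L k (lsmul L c x) = lsmul L c (ldiff L k x)"
  and ld_ld: "x \<in> lgr L k \<Longrightarrow> ldiff L (k - 1) (ldiff L k x) = 0"
  using dgl_laws[THEN conjunct2, THEN conjunct2, THEN conjunct2, THEN conjunct2, THEN conjunct2,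
      THEN conjunct1] by blast+

lemma ld_br: "x \<in> lgr L i \<Longrightarrow> y \<in> lgr L j \<Longrightarrow> ldiff L (i + j) (lbr L i j x y) =
    lbr L (i - 1) j (ldiff L i x) y + lsmul L (koszul 1 i) (lbr L i (j - 1) x (ldiff L j y))"
  using dgl_laws[THEN conjunct2, THEN conjunct2, THEN conjunct2, THEN conjunct2, THEN conjunct2,
      THEN conjunct2] by blast

lemmas lgr_add = vl.subspace_add[OF lgr_subspace]
  and lgr_scale = vl.subspace_scale[OF lgr_subspace]
  and lgr_diff = vl.subspace_diff[OF lgr_subspace]
  and lgr_0 [simp] = vl.subspace_0[OF lgr_subspace]

lemma ld_0: "ldiff L k 0 = 0"
  using ld_add[of 0 k 0] by simp

lemma br_0: "x \<in> lgr L i \<Longrightarrow> lbr L i j x 0 = 0" "y \<in> lgr L j \<Longrightarrow> lbr L i j 0 y = 0"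
proof -
  show 1: "lbr L i j x 0 = 0" if "x \<in> lgr L i" for x i j
    using br_add[OF that, of 0 j 0] by simp
  show "lbr L i j 0 y = 0" if "y \<in> lgr L j" for y
    using br_sym[of 0 i y j] that 1[OF that, of i] by simp
qed

lemma br_add_left: "x \<in> lgr L i \<Longrightarrow> y \<in> lgr L i \<Longrightarrow> z \<in> lgr L j \<Longrightarrow>
    lbr L i j (x + y) z = lbr L i j x z + lbr L i j y z"
  using br_sym[of "x + y" i z j] br_sym[of x i z j] br_sym[of y i z j]
  by (simp add: br_add lgr_add vl.scale_right_distrib)

lemma cyclesD: "x \<in> lcycles L k \<Longrightarrow> x \<in> lgr L k" "x \<in> lcycles L k \<Longrightarrow> ldiff L k x = 0"
  by (simp_all add: lcycles_def)

lemma bd_subspace: "vl.subspace (lboundaries L k)"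
proof (rule vl.subspaceI)
  show "0 \<in> lboundaries L k"
    unfolding lboundaries_def using ld_0 by (intro image_eqI[of _ _ 0]) simp_all
  show "x + y \<in> lboundaries L k" if xy: "x \<in> lboundaries L k" "y \<in> lboundaries L k" for x y
  proof -
    obtain a b where "a \<in> lgr L (k + 1)" "x = ldiff L (k + 1) a" "b \<in> lgr L (k + 1)" "y = ldiff L (k + 1) b"
      using xy unfolding lboundaries_def by blast
    then show ?thesis
      unfolding lboundaries_def using ld_add[of a "k + 1" b] lgr_add[of a "k + 1" b]
      by (intro image_eqI[of _ _ "a + b"]) simp_all
  qed
  show "lsmul L c x \<in> lboundaries L k" if x: "x \<in> lboundaries L k" for x c
  proof -
    obtain a where "a \<in> lgr L (k + 1)" "x = ldiff L (k + 1) a"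
      using x unfolding lboundaries_def by blast
    then show ?thesis
      unfolding lboundaries_def using ld_scale[of a "k + 1" c] lgr_scale[of a "k + 1" c]
      by (intro image_eqI[of _ _ "lsmul L c a"]) simp_all
  qed
qed

lemmas bd_add = vl.subspace_add[OF bd_subspace]
  and bd_scale = vl.subspace_scale[OF bd_subspace]
  and bd_diff = vl.subspace_diff[OF bd_subspace]
  and bd_neg = vl.subspace_neg[OF bd_subspace]
  and bd_0 [simp] = vl.subspace_0[OF bd_subspace]

lemma bd_cycle: "x \<in> lboundaries L k \<Longrightarrow> x \<in> lcycles L k"
  unfolding lboundaries_def lcycles_def using ld_gr[of _ "k + 1"] ld_ld[of _ "k + 1"] by fastforce

lemma cycle_add: "x \<in> lcycles L k \<Longrightarrow> y \<in> lcycles L k \<Longrightarrow> x + y \<in> lcycles L k"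
  by (simp add: lcycles_def lgr_add ld_add)
lemma cycle_scale: "x \<in> lcycles L k \<Longrightarrow> lsmul L c x \<in> lcycles L k"
  by (simp add: lcycles_def lgr_scale ld_scale)

lemma br_cycle: "x \<in> lcycles L e \<Longrightarrow> lbr L e e x x \<in> lcycles L (2 * e)"
  using br_gr[of x e x e] ld_br[of x e x e] br_0[of x e] by (simp add: lcycles_def)

lemma br_bd:
  assumes x: "x \<in> lcycles L i" and b: "b \<in> lboundaries L j"
  shows "lbr L i j x b \<in> lboundaries L (i + j)"
proof -
  obtain a where a: "a \<in> lgr L (j + 1)" "b = ldiff L (j + 1) a"
    using b unfolding lboundaries_def by blast
  have "ldiff L (i + (j + 1)) (lbr L i (j + 1) x a) = lsmul L (koszul 1 i) (lbr L i j x b)"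
    using ld_br[OF cyclesD(1)[OF x] a(1)] br_0(2)[OF a(1)] cyclesD(2)[OF x] a(2) by simp
  moreover have "lbr L i (j + 1) x a \<in> lgr L (i + j + 1)"
    using br_gr[OF cyclesD(1)[OF x] a(1)] by (simp add: add.assoc)
  ultimately have "lsmul L (koszul 1 i) (lbr L i j x b) \<in> lboundaries L (i + j)"
    unfolding lboundaries_def by (metis add.assoc imageI)
  from bd_scale[OF this, of "koszul 1 i"] show ?thesis by simp
qed

lemma br_bd_left:
  assumes x: "x \<in> lcycles L i" and b: "b \<in> lboundaries L j"
  shows "lbr L j i b x \<in> lboundaries L (j + i)"
  using br_sym[OF cyclesD(1)[OF bd_cycle[OF b]] cyclesD(1)[OF x]] br_bd[OF x b]
  by (simp add: add.commute bd_neg bd_scale)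

lemma br_homologous:
  assumes x: "x \<in> lcycles L e" and b: "b \<in> lboundaries L e"
  shows "lbr L e e (x + b) (x + b) - lbr L e e x x \<in> lboundaries L (2 * e)"
proof -
  note g = cyclesD(1)[OF x] cyclesD(1)[OF bd_cycle[OF b]]
  have "lbr L e e (x + b) (x + b) - lbr L e e x x = lbr L e e x b + (lbr L e e b x + lbr L e e b b)"
    using g by (simp add: br_add br_add_left lgr_add algebra_simps)
  moreover have "\<dots> \<in> lboundaries L (e + e)"
    by (intro bd_add br_bd br_bd_left x b bd_cycle)
  ultimately show ?thesis by simp
qed

end

text \<open>The free graded Lie algebra on one generator \<open>x\<close> of odd degree has the basis \<open>x\<close>, \<open>[x, x]\<close>.\<close>

definition lie_sphere_homology :: "int \<Rightarrow> 'a::ab_group_add dgl \<Rightarrow> bool" where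
  "lie_sphere_homology e L \<longleftrightarrow> (\<exists>x\<in>lcycles L e.
     (\<forall>k. k \<noteq> e \<longrightarrow> k \<noteq> 2 * e \<longrightarrow> lcycles L k \<subseteq> lboundaries L k) \<and>
     (\<forall>z\<in>lcycles L e. \<exists>c. z - lsmul L c x \<in> lboundaries L e) \<and>
     (\<forall>z\<in>lcycles L (2 * e). \<exists>c. z - lsmul L c (lbr L e e x x) \<in> lboundaries L (2 * e)) \<and>
     lbr L e e x x \<notin> lboundaries L (2 * e))"

locale dgl_qiso = L: dgl L + M: dgl M
  for L :: "'a::ab_group_add dgl" and M :: "'b::ab_group_add dgl" +
  fixes f
  assumes mor: "dgl_mor L M f"
    and inj: "x \<in> lcycles L k \<Longrightarrow> f k x \<in> lboundaries M k \<Longrightarrow> x \<in> lboundaries L k"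
    and surj: "y \<in> lcycles M k \<Longrightarrow> \<exists>x\<in>lcycles L k. f k x - y \<in> lboundaries M k"
begin

lemma f_gr: "x \<in> lgr L k \<Longrightarrow> f k x \<in> lgr M k"
  and f_add: "x \<in> lgr L k \<Longrightarrow> y \<in> lgr L k \<Longrightarrow> f k (x + y) = f k x + f k y"
  and f_scale: "x \<in> lgr L k \<Longrightarrow> f k (lsmul L c x) = lsmul M c (f k x)"
  and f_ld: "x \<in> lgr L k \<Longrightarrow> f (k - 1) (ldiff L k x) = ldiff M k (f k x)"
  and f_br: "x \<in> lgr L i \<Longrightarrow> y \<in> lgr L j \<Longrightarrow> f (i + j) (lbr L i j x y) = lbr M i j (f i x) (f j y)"
  using mor unfolding dgl_mor_def by blast+

lemma f_diff: "x \<in> lgr L k \<Longrightarrow> y \<in> lgr L k \<Longrightarrow> f k (x - y) = f k x - f k y"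
  using f_add[of "x - y" k y] L.lgr_diff[of x k y] by simp

lemma f_0: "f k 0 = 0"
  using f_diff[of 0 k 0] by simp

lemma f_cycle: "x \<in> lcycles L k \<Longrightarrow> f k x \<in> lcycles M k"
  using f_ld[of x k] f_gr[of x k] f_0[of "k - 1"] by (simp add: lcycles_def)

lemma f_bd: "x \<in> lboundaries L k \<Longrightarrow> f k x \<in> lboundaries M k"
proof -
  assume "x \<in> lboundaries L k"
  then obtain a where "a \<in> lgr L (k + 1)" "x = ldiff L (k + 1) a" unfolding lboundaries_def by blast
  then show ?thesis using f_ld[of a "k + 1"] f_gr[of a "k + 1"] unfolding lboundaries_def by simp
qed

lemma forward: "lie_sphere_homology e L \<Longrightarrow> lie_sphere_homology e M"
proof -
  assume "lie_sphere_homology e L"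
  then obtain x where x: "x \<in> lcycles L e"
    and 1: "\<And>k. k \<noteq> e \<Longrightarrow> k \<noteq> 2 * e \<Longrightarrow> lcycles L k \<subseteq> lboundaries L k"
    and 2: "\<And>z. z \<in> lcycles L e \<Longrightarrow> \<exists>c. z - lsmul L c x \<in> lboundaries L e"
    and 3: "\<And>z. z \<in> lcycles L (2 * e) \<Longrightarrow> \<exists>c. z - lsmul L c (lbr L e e x x) \<in> lboundaries L (2 * e)"
    and 4: "lbr L e e x x \<notin> lboundaries L (2 * e)"
    unfolding lie_sphere_homology_def by blast
  note xg = L.cyclesD(1)[OF x]
  have br: "f (2 * e) (lbr L e e x x) = lbr M e e (f e x) (f e x)"
    using f_br[OF xg xg] by simp
  have brg: "lbr L e e x x \<in> lgr L (2 * e)" using L.br_cycle[OF x] by (rule L.cyclesD)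
  have approx: "\<exists>c. z - lsmul M c (f k b) \<in> lboundaries M k"
    if z: "z \<in> lcycles M k" and b: "b \<in> lgr L k"
      and h: "\<And>z. z \<in> lcycles L k \<Longrightarrow> \<exists>c. z - lsmul L c b \<in> lboundaries L k" for z k b
  proof -
    obtain y where y: "y \<in> lcycles L k" "f k y - z \<in> lboundaries M k" using surj[OF z] by blast
    obtain c where "y - lsmul L c b \<in> lboundaries L k" using h[OF y(1)] by blast
    from f_bd[OF this] have "f k y - lsmul M c (f k b) \<in> lboundaries M k"
      using f_diff[OF L.cyclesD(1)[OF y(1)] L.lgr_scale[OF b]] f_scale[OF b] by simp
    from M.bd_diff[OF this y(2)] show ?thesis by auto
  qed
  show ?thesis
    unfolding lie_sphere_homology_def
  proof (intro bexI[of _ "f e x"] conjI allI impI ballI subsetI)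
    show "f e x \<in> lcycles M e" by (rule f_cycle[OF x])
    \<comment> \<open>Approximating by multiples of b = 0 says that z itself bounds.\<close>
    show "z \<in> lboundaries M k" if "k \<noteq> e" "k \<noteq> 2 * e" "z \<in> lcycles M k" for z k
      using approx[OF that(3) L.lgr_0] 1[OF that(1,2)] by (auto simp: f_0)
    show "\<exists>c. z - lsmul M c (f e x) \<in> lboundaries M e" if "z \<in> lcycles M e" for z
      by (rule approx[OF that xg 2])
    show "\<exists>c. z - lsmul M c (lbr M e e (f e x) (f e x)) \<in> lboundaries M (2 * e)"
      if "z \<in> lcycles M (2 * e)" for z
      using approx[OF that brg 3] by (simp add: br)
    show "lbr M e e (f e x) (f e x) \<notin> lboundaries M (2 * e)"
      using inj[OF L.br_cycle[OF x]] 4 by (auto simp: br)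
  qed
qed

text \<open>Quasi-isomorphisms in a zigzag point both ways, so the property is also pulled back. A
  preimage of the class x' maps to x' only up to a boundary, and \<open>br_homologous\<close>
  compares the brackets.\<close>

lemma backward: "lie_sphere_homology e M \<Longrightarrow> lie_sphere_homology e L"
proof -
  assume "lie_sphere_homology e M"
  then obtain x' where x': "x' \<in> lcycles M e"
    and 1: "\<And>k. k \<noteq> e \<Longrightarrow> k \<noteq> 2 * e \<Longrightarrow> lcycles M k \<subseteq> lboundaries M k"
    and 2: "\<And>z. z \<in> lcycles M e \<Longrightarrow> \<exists>c. z - lsmul M c x' \<in> lboundaries M e"
    and 3: "\<And>z. z \<in> lcycles M (2 * e) \<Longrightarrow> \<exists>c. z - lsmul M c (lbr M e e x' x') \<in> lboundaries M (2 * e)"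
    and 4: "lbr M e e x' x' \<notin> lboundaries M (2 * e)"
    unfolding lie_sphere_homology_def by blast
  obtain x where x: "x \<in> lcycles L e" "f e x - x' \<in> lboundaries M e" using surj[OF x'] by blast
  note xg = L.cyclesD(1)[OF x(1)]
  have br: "lbr M e e (f e x) (f e x) - lbr M e e x' x' \<in> lboundaries M (2 * e)"
    using M.br_homologous[OF x' x(2)] by simp
  have fbr: "f (2 * e) (lbr L e e x x) = lbr M e e (f e x) (f e x)"
    using f_br[OF xg xg] by simp
  have approx: "\<exists>c. z - lsmul L c b \<in> lboundaries L k"
    if z: "z \<in> lcycles L k" and b: "b \<in> lcycles L k" and bb: "f k b - b' \<in> lboundaries M k"
      and h: "\<And>z. z \<in> lcycles M k \<Longrightarrow> \<exists>c. z - lsmul M c b' \<in> lboundaries M k" for z k b b'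
  proof -
    obtain c where c: "f k z - lsmul M c b' \<in> lboundaries M k" using h[OF f_cycle[OF z]] by blast
    have "f k z - lsmul M c b' - lsmul M c (f k b - b') \<in> lboundaries M k"
      by (intro M.bd_diff M.bd_scale c bb)
    then have "f k (z - lsmul L c b) \<in> lboundaries M k"
      using f_diff[OF L.cyclesD(1)[OF z] L.lgr_scale[OF L.cyclesD(1)[OF b]]] f_scale[OF L.cyclesD(1)[OF b]]
      by (simp add: M.vl.scale_right_diff_distrib)
    moreover have "z - lsmul L c b \<in> lcycles L k"
      using L.cycle_add[OF z L.cycle_scale[OF b, of "- c"]] by simp
    ultimately show ?thesis using inj by blast
  qed
  show ?thesis
    unfolding lie_sphere_homology_def
  proof (intro bexI[of _ x] conjI allI impI ballI subsetI)
    show "x \<in> lcycles L e" by (rule x)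
    show "z \<in> lboundaries L k" if "k \<noteq> e" "k \<noteq> 2 * e" "z \<in> lcycles L k" for z k
      using inj[OF that(3)] 1[OF that(1,2)] f_cycle[OF that(3)] by blast
    show "\<exists>c. z - lsmul L c x \<in> lboundaries L e" if "z \<in> lcycles L e" for z
      by (rule approx[OF that x 2])
    show "\<exists>c. z - lsmul L c (lbr L e e x x) \<in> lboundaries L (2 * e)"
      if "z \<in> lcycles L (2 * e)" for z
      by (rule approx[OF that L.br_cycle[OF x(1)] _ 3]) (simp_all add: fbr br)
    show "lbr L e e x x \<notin> lboundaries L (2 * e)"
    proof
      assume "lbr L e e x x \<in> lboundaries L (2 * e)"
      from M.bd_diff[OF f_bd[OF this, unfolded fbr] br] show False using 4 by simp
    qed
  qed
qed

end

lemma dgl_quasi_iso_homology: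
  assumes "dgl_quasi_iso L M"
  shows "lie_sphere_homology e L \<longleftrightarrow> lie_sphere_homology e M"
proof -
  obtain f where L: "is_dgl L" and M: "is_dgl M" and f: "dgl_mor L M f"
    "\<forall>k. \<forall>x\<in>lcycles L k. f k x \<in> lboundaries M k \<longrightarrow> x \<in> lboundaries L k"
    "\<forall>k. \<forall>y\<in>lcycles M k. \<exists>x\<in>lcycles L k. f k x - y \<in> lboundaries M k"
    using assms unfolding dgl_quasi_iso_def by blast
  interpret dgl_qiso L M f
    using L M f by unfold_locales blast+
  show ?thesis using forward backward by blast
qed

text \<open>The tensor algebra on one generator is commutative, so a graded commutator is zero
  unless both degrees are odd, when it is twice the product. As 2 e is even, nothing new arises
  beyond [x, x].\<close>

lemma free_lie_gen1_odd:
  assumes "free_lie_gen1 e k p" "odd e"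
  shows "p = 0 \<or> k = e \<and> (\<exists>c. p = [:0, c:]) \<or> k = 2 * e \<and> (\<exists>c. p = [:0, 0, c:])"
  using assms
proof (induct rule: free_lie_gen1.induct)
  case (add k p q)
  have "e \<noteq> 2 * e" using add by auto
  then show ?case using add by fastforce
next
  case (scale k p c)
  then show ?case by fastforce
next
  case (bracket i p j q)
  have comm: "p * q - smult (koszul i j) (q * p) = (if odd i \<and> odd j then smult 2 (p * q) else 0)"
    using smult_add_left[of 1 1 "p * q"] by (simp add: koszul_def mult.commute)
  then show ?case using bracket by (auto simp: comm)
qed auto

lemma sphere_lie_homology:
  assumes "n \<ge> 1"
  shows "lie_sphere_homology (2 * int n - 1) (sphere_lie (2 * n))"
proof -
  let ?e = "2 * int n - 1" and ?L = "sphere_lie (2 * n)"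
  have gr: "lgr ?L k = {p. free_lie_gen1 ?e k p}" for k by (simp add: sphere_lie_def)
  have cyc: "lcycles ?L k = {p. free_lie_gen1 ?e k p}" for k
    by (simp add: lcycles_def gr) (simp add: sphere_lie_def)
  have bd: "lboundaries ?L k = {0}" for k
    using free_lie_gen1.zero[of ?e "k + 1"]
    by (auto simp: lboundaries_def gr) (auto simp: sphere_lie_def)
  have sm: "lsmul ?L = smult" by (simp add: sphere_lie_def)
  have br: "lbr ?L ?e ?e [:0, 1:] [:0, 1:] = [:0, 0, 2:]"
    using assms by (simp add: sphere_lie_def koszul_def numeral_poly)
  have e: "odd ?e" "?e \<noteq> 2 * ?e" using assms by auto
  note free = free_lie_gen1_odd[OF _ e(1)]
  show ?thesis
    unfolding lie_sphere_homology_def cyc bd sm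
  proof (intro bexI[of _ "[:0, 1:]"] conjI allI impI ballI subsetI)
    show "[:0, 1:] \<in> {p. free_lie_gen1 ?e ?e p}" by (simp add: free_lie_gen1.gen)
    show "z \<in> {0}" if "k \<noteq> ?e" "k \<noteq> 2 * ?e" "z \<in> {p. free_lie_gen1 ?e k p}" for z k
      using free[of k z] that by auto
    show "\<exists>c. z - smult c [:0, 1:] \<in> {0}" if "z \<in> {p. free_lie_gen1 ?e ?e p}" for z
    proof -
      have "\<exists>c. z = [:0, c:]" using free[of ?e z] that e(2) by (auto intro: exI[of _ 0])
      then show ?thesis by auto
    qed
    show "\<exists>c. z - smult c (lbr ?L ?e ?e [:0, 1:] [:0, 1:]) \<in> {0}"
      if "z \<in> {p. free_lie_gen1 ?e (2 * ?e) p}" for z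
    proof -
      have "\<exists>c. z = [:0, 0, c:]" using free[of "2 * ?e" z] that e(2) by (auto intro: exI[of _ 0])
      then obtain c where "z = [:0, 0, c:]" by blast
      \<comment> \<open>The factor 1/2 compensates [x, x] = 2 x^2.\<close>
      then show ?thesis unfolding br by (intro exI[of _ "c / 2"]) simp
    qed
    show "lbr ?L ?e ?e [:0, 1:] [:0, 1:] \<notin> {0}" unfolding br by simp
  qed
qed

lemma Baut1_homology:
  fixes T :: "'m::ab_group_add itself"
  assumes "n \<ge> 1" "Baut1_rat_equiv_sphere T A (2 * n)"
  shows "is_dgl (Der' A)" "lie_sphere_homology (2 * int n - 1) (Der' A)"
proof -
  have "\<exists>M N :: 'm dgl. dgl_quasi_iso M (Der' A) \<and> equivclp dgl_quasi_iso M N \<and>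
      dgl_quasi_iso N (sphere_lie (2 * n))"
    using assms(2) by (simp add: Baut1_rat_equiv_sphere_def dgl_quasi_isomorphic_def)
  then obtain M N :: "'m dgl" where M: "dgl_quasi_iso M (Der' A)" and MN: "equivclp dgl_quasi_iso M N"
    and N: "dgl_quasi_iso N (sphere_lie (2 * n))"
    by (elim exE conjE)
  show "is_dgl (Der' A)" using M by (simp add: dgl_quasi_iso_def)
  have "lie_sphere_homology (2 * int n - 1) M \<longleftrightarrow> lie_sphere_homology (2 * int n - 1) N"
    using MN
  proof (induct rule: equivclp_induct)
    case (step y z)
    then show ?case using dgl_quasi_iso_homology[of y z] dgl_quasi_iso_homology[of z y] by blast
  qed simp
  then show "lie_sphere_homology (2 * int n - 1) (Der' A)"
    using dgl_quasi_iso_homology[OF M] dgl_quasi_iso_homology[OF N] sphere_lie_homology[OF assms(1)]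
    by simp
qed

section \<open>Classifying spaces with the rational homotopy of an even sphere\<close>

text \<open>The homology of \<open>Der'\<close> restated for plain derivations. In degrees k \<ge> 1
  the cycles and boundaries of \<open>Der'\<close> are those of \<open>Der\<close>, since the
  boundaries come from degree k + 1 \<ge> 2.\<close>

locale Baut1_even_sphere = sullivan A V for A :: "'a::ab_group_add cdga" and V +
  fixes e :: int and x \<alpha> :: "'a \<Rightarrow> 'a"
  assumes e: "odd e" "1 \<le> e"
    and x: "x \<in> Der e"
    and alpha: "\<alpha> = der_bracket A e e x x" "\<alpha> \<in> Der (2 * e)" "DD (2 * e) \<alpha> = 0"
    and acyclic: "\<theta> \<in> Der k \<Longrightarrow> DD k \<theta> = 0 \<Longrightarrow> 1 \<le> k \<Longrightarrow> k \<noteq> e \<Longrightarrow> k \<noteq> 2 * e \<Longrightarrow>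
      \<exists>\<eta>\<in>Der (k + 1). \<theta> = DD (k + 1) \<eta>"
    and homology_e: "\<theta> \<in> Der e \<Longrightarrow> DD e \<theta> = 0 \<Longrightarrow>
      \<exists>c. \<exists>\<eta>\<in>Der (e + 1). \<theta> = fs c x + DD (e + 1) \<eta>"
    and homology_2e: "\<theta> \<in> Der (2 * e) \<Longrightarrow> DD (2 * e) \<theta> = 0 \<Longrightarrow>
      \<exists>c. \<exists>\<eta>\<in>Der (2 * e + 1). \<theta> = fs c \<alpha> + DD (2 * e + 1) \<eta>"
    and alpha_not_boundary: "\<eta> \<in> Der (2 * e + 1) \<Longrightarrow> \<alpha> \<noteq> DD (2 * e + 1) \<eta>"
    and bracket_boundary: "\<zeta> \<in> Der (e + 1) \<Longrightarrow>
      \<exists>\<eta>\<in>Der (2 * e + 1). der_bracket A e e x (DD (e + 1) \<zeta>) = DD (2 * e + 1) \<eta>"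

lemma (in sullivan) Baut1_even_sphere:
  assumes n: "n \<ge> 1" and S: "Baut1_rat_equiv_sphere T A (2 * n)"
  shows "\<exists>x \<alpha>. Baut1_even_sphere A V (2 * int n - 1) x \<alpha>"
proof -
  let ?e = "2 * int n - 1" and ?L = "Der' A"
  interpret L: dgl "Der' A"
    by (rule dgl.intro) (rule Baut1_homology(1)[OF assms])
  have e: "odd ?e" "1 \<le> ?e" using n by auto
  have cyc: "lcycles ?L k = {\<theta> \<in> Der k. DD k \<theta> = 0}" if "1 \<le> k" for k
    using that by (auto simp: lcycles_def Der'_def)
  have bd: "lboundaries ?L k = DD (k + 1) ` Der (k + 1)" if "1 \<le> k" for k
    using that by (simp add: lboundaries_def Der'_def)
  have sm: "lsmul ?L = fs" and br: "lbr ?L = der_bracket A" by (simp_all add: Der'_def)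
  obtain x where x: "x \<in> lcycles ?L ?e"
    and hom: "(\<forall>k. k \<noteq> ?e \<longrightarrow> k \<noteq> 2 * ?e \<longrightarrow> lcycles ?L k \<subseteq> lboundaries ?L k) \<and>
      (\<forall>z\<in>lcycles ?L ?e. \<exists>c. z - fs c x \<in> lboundaries ?L ?e) \<and>
      (\<forall>z\<in>lcycles ?L (2 * ?e). \<exists>c. z - fs c (der_bracket A ?e ?e x x) \<in> lboundaries ?L (2 * ?e)) \<and>
      der_bracket A ?e ?e x x \<notin> lboundaries ?L (2 * ?e)"
    using Baut1_homology(2)[OF assms] unfolding lie_sphere_homology_def sm br by (rule bexE)
  note 1 = hom[THEN conjunct1, rule_format]
    and 2 = hom[THEN conjunct2, THEN conjunct1, rule_format]
    and 3 = hom[THEN conjunct2, THEN conjunct2, THEN conjunct1, rule_format]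
    and 4 = hom[THEN conjunct2, THEN conjunct2, THEN conjunct2]
  have a: "der_bracket A ?e ?e x x \<in> lcycles ?L (2 * ?e)"
    using L.br_cycle[OF x] by (simp only: br)
  have e2: "1 \<le> 2 * ?e" using n by simp
  note cyc1 = cyc[OF e(2)] and cyc2 = cyc[OF e2] and bd1 = bd[OF e(2)] and bd2 = bd[OF e2]
  have split: "\<exists>c. \<exists>\<eta>\<in>Der k. z = fs c b + DD k \<eta>" if h: "\<exists>c. z - fs c b \<in> DD k ` Der k" for z b k
  proof -
    obtain c \<eta> where "\<eta> \<in> Der k" "z - fs c b = DD k \<eta>" using h by (elim exE imageE)
    moreover from this(2) have "z = fs c b + DD k \<eta>" by (simp only: diff_eq_eq add.commute)
    ultimately show ?thesis by (intro exI bexI)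
  qed
  have "Baut1_even_sphere A V ?e x (der_bracket A ?e ?e x x)"
  proof (intro Baut1_even_sphere.intro Baut1_even_sphere_axioms.intro)
    show "sullivan A V" by (rule sullivan_axioms)
    show "odd ?e" "1 \<le> ?e" by (rule e)+
    show "x \<in> Der ?e" using x by (simp add: cyc1)
    show "der_bracket A ?e ?e x x \<in> Der (2 * ?e)" "DD (2 * ?e) (der_bracket A ?e ?e x x) = 0"
      using a unfolding cyc2 by simp_all
    show "\<exists>\<eta>\<in>Der (k + 1). \<theta> = DD (k + 1) \<eta>"
      if "\<theta> \<in> Der k" "DD k \<theta> = 0" "1 \<le> k" "k \<noteq> ?e" "k \<noteq> 2 * ?e" for \<theta> k
    proof -
      have "\<theta> \<in> DD (k + 1) ` Der (k + 1)"
        by (rule subsetD[OF 1[OF that(4,5), unfolded cyc[OF that(3)] bd[OF that(3)]]]) (intro CollectI conjI that(1,2))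
      then show ?thesis by (rule imageE) (rule bexI)
    qed
    show "\<exists>c. \<exists>\<eta>\<in>Der (?e + 1). \<theta> = fs c x + DD (?e + 1) \<eta>"
      if "\<theta> \<in> Der ?e" "DD ?e \<theta> = 0" for \<theta>
      by (rule split[OF 2[unfolded cyc1 bd1]]) (intro CollectI conjI that)
    show "\<exists>c. \<exists>\<eta>\<in>Der (2 * ?e + 1). \<theta> = fs c (der_bracket A ?e ?e x x) + DD (2 * ?e + 1) \<eta>"
      if "\<theta> \<in> Der (2 * ?e)" "DD (2 * ?e) \<theta> = 0" for \<theta>
      by (rule split[OF 3[unfolded cyc2 bd2]]) (intro CollectI conjI that)
    show "der_bracket A ?e ?e x x \<noteq> DD (2 * ?e + 1) \<eta>" if "\<eta> \<in> Der (2 * ?e + 1)" for \<eta>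
      using 4 imageI[OF that, of "DD (2 * ?e + 1)"] unfolding bd2 by metis
    show "\<exists>\<eta>\<in>Der (2 * ?e + 1). der_bracket A ?e ?e x (DD (?e + 1) \<zeta>) = DD (2 * ?e + 1) \<eta>"
      if "\<zeta> \<in> Der (?e + 1)" for \<zeta>
    proof -
      have "DD (?e + 1) \<zeta> \<in> lboundaries ?L ?e" unfolding bd1 using that by (rule imageI)
      from L.br_bd[OF x this]
      have "der_bracket A ?e ?e x (DD (?e + 1) \<zeta>) \<in> lboundaries ?L (2 * ?e)"
        by (simp only: br mult_2)
      then show ?thesis unfolding bd2 by (rule imageE) (rule bexI)
    qed
  qed (rule refl)
  then show ?thesis by (intro exI)
qed

context Baut1_even_sphere
begin

lemma bracket_apply: "der_bracket A e e x \<theta> v = x (\<theta> v) + \<theta> (x v)"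
  using e(1) by (simp add: der_bracket_def koszul_def)

lemma alpha_apply: "\<alpha> v = sm 2 (x (x v))"
  using vs.scale_left_distrib[of 1 1 "x (x v)"] by (simp add: alpha(1) bracket_apply)

lemma eps_alpha: "v \<in> gr (2 * e) \<Longrightarrow> eps (\<alpha> v) = 0"
proof (rule ccontr)
  assume v0: "v \<in> gr (2 * e)" "eps (\<alpha> v) \<noteq> 0"
  define v' where "v' = sm (1 / eps (\<alpha> v)) v"
  have v: "v' \<in> gr (2 * e)" by (simp add: v'_def gr_scale v0(1))
  have "\<alpha> v \<in> gr 0" using Der_gr[OF alpha(2) v0(1)] by simp
  from gr_0_eq[OF this] have "\<alpha> v' = sm (1 / eps (\<alpha> v)) (sm (eps (\<alpha> v)) one)"
    by (simp only: v'_def Der_scale[OF alpha(2)])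
  then have av: "\<alpha> v' = one" using v0(2) by simp
  define w where "w = x v'"
  have w: "w \<in> gr e" using Der_gr[OF x v] by (simp add: w_def)
  have xw: "eps (x w) = 1 / 2" using arg_cong[OF av, of eps] by (simp add: alpha_apply w_def)
  have u: "0 \<le> e + 1" "d w \<in> gr (e + 1)" "d w \<in> Fil 2" "d (d w) = 0"
    using e(2) d_gr[OF w] d_Fil_2 by simp_all
  have ac: "\<exists>\<eta>\<in>Der (k + 1). \<theta> = DD (k + 1) \<eta>"
    if "2 * e - (e + 1) + 2 \<le> k" "k < 2 * e" "\<theta> \<in> Der k" "DD k \<theta> = 0" for k \<theta>
    using acyclic[OF that(3,4)] that(1,2) e(2) by simp
  have "\<exists>\<eta>. \<eta> \<in> fs.span {cm c \<theta> | c q \<theta>. 2 \<le> q \<and> q \<le> e + 1 - 2 \<and> c \<in> gr q \<and>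
      \<theta> \<in> Der (2 * e - (e + 1) + 1 + q)} \<and> DD (2 * e - (e + 1) + 1) \<eta> = cm (d w) \<alpha>"
    by (rule decomposable_cocycle_bounds[OF alpha(2,3) _ u]) (rule ac)
  then obtain \<eta> where span: "\<eta> \<in> fs.span {cm c \<theta> | c q \<theta>. 2 \<le> q \<and> q \<le> e + 1 - 2 \<and> c \<in> gr q \<and>
      \<theta> \<in> Der (2 * e - (e + 1) + 1 + q)}"
    and "DD (2 * e - (e + 1) + 1) \<eta> = cm (d w) \<alpha>"
    by (elim exE conjE)
  then have eta: "DD e \<eta> = cm (d w) \<alpha>" by simp
  \<comment> \<open>Both scalar conditions are linear in \<eta>, so they are checked on the spanning
    elements c \<theta>; there \<theta> w, x (\<theta> v') and x c all have negative degree.\<close>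
  let ?S = "{\<eta> \<in> Der e. \<eta> w = 0 \<and> eps (x (\<eta> v')) = 0}"
  have "\<eta> \<in> ?S"
  proof (rule subsetD[OF fs.span_minimal span])
    show "fs.subspace ?S"
      by (rule fs.subspaceI)
        (simp_all add: fs.subspace_add[OF Der_subspace] fs.subspace_scale[OF Der_subspace]
          Der_zero[OF x] Der_add[OF x] Der_scale[OF x] eps_add)
    show "{cm c \<theta> | c q \<theta>. 2 \<le> q \<and> q \<le> e + 1 - 2 \<and> c \<in> gr q \<and>
      \<theta> \<in> Der (2 * e - (e + 1) + 1 + q)} \<subseteq> ?S"
    proof clarify
      fix c q \<theta> assume q: "2 \<le> q" "q \<le> e + 1 - 2" and c: "c \<in> gr q"
        and "\<theta> \<in> Der (2 * e - (e + 1) + 1 + q)"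
      then have t: "\<theta> \<in> Der (e + q)" by simp
      have "\<theta> w \<in> gr (- q)" using Der_gr[OF t w] by simp
      then have 1: "\<theta> w = 0" using gr_neg[of "- q"] q by simp
      have "x (\<theta> v') \<in> gr (- q)" using Der_gr[OF x Der_gr[OF t v]] by simp
      then have 2: "x (\<theta> v') = 0" using gr_neg[of "- q"] q by simp
      have 3: "x c = 0" using gr_neg[OF _ Der_gr[OF x c]] q by simp
      show "cm c \<theta> \<in> Der e \<and> cm c \<theta> w = 0 \<and> eps (x (cm c \<theta> v')) = 0"
        using cm_Der[OF c t] by (simp add: cm_def 1 2 3 Der_mul[OF x c])
    qed
  qed
  then have eta': "\<eta> \<in> Der e" "\<eta> w = 0" "eps (x (\<eta> v')) = 0" by simp_all
  define y where "y = cm w \<alpha> - \<eta>"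
  have y: "y \<in> Der e"
    unfolding y_def using cm_Der[OF w alpha(2)] eta'(1)
    by (intro fs.subspace_diff[OF Der_subspace]) simp_all
  have "DD e (cm w \<alpha>) = cm (d w) \<alpha>"
    using DD_cm[OF w, of "2 * e" \<alpha>] by (simp add: alpha(3) cm_linear(6))
  then have dy: "DD e y = 0" by (simp add: y_def DD_diff eta)
  have "\<alpha> w = 0" using gr_neg[OF _ Der_gr[OF alpha(2) w]] e(2) by simp
  then have yw: "y w = 0" by (simp add: y_def cm_def eta'(2))
  have yv: "y v' = w - \<eta> v'" by (simp add: y_def cm_def av)
  obtain c \<zeta> where z: "\<zeta> \<in> Der (e + 1)" "y = fs c x + DD (e + 1) \<zeta>"
    using homology_e[OF y dy] by blast
  \<comment> \<open>Evaluation at w: boundaries have augmentation zero and eps (x w) = 1/2, so y w =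
    0 forces c / 2 = 0.\<close>
  have "c = 0"
    using arg_cong[OF fun_cong[OF z(2), of w], of eps] by (simp add: yw xw eps_add eps_DD[OF z(1)])
  then have "y = DD (e + 1) \<zeta>" using z(2) by (simp add: fun_eq_iff)
  then obtain \<xi> where xi: "\<xi> \<in> Der (2 * e + 1)" "der_bracket A e e x y = DD (2 * e + 1) \<xi>"
    using bracket_boundary[OF z(1)] by blast
  have "eps (der_bracket A e e x y v') = 0" unfolding xi(2) by (rule eps_DD[OF xi(1)])
  moreover have "x (w - \<eta> v') = x w - x (\<eta> v')"
    using Der_add[OF x, of w "- \<eta> v'"] by (simp add: Der_uminus[OF x])
  ultimately show False
    using xw by (simp add: bracket_apply yv yw eps_diff eta'(3) flip: w_def)
qed

lemma eps_cycle:
  assumes t: "\<theta> \<in> Der k" "DD k \<theta> = 0" and k: "e < k"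
  shows "eps (\<theta> y) = 0"
proof (induct y rule: hom_induct)
  case (hom p y)
  have g: "\<theta> y \<in> gr (p - k)" by (rule Der_gr[OF t(1) hom])
  consider "p \<noteq> k" | "p = k" "k \<noteq> 2 * e" | "p = 2 * e" "k = 2 * e" by blast
  then show ?case
  proof cases
    case 1
    then show ?thesis using eps_gr[OF g] by simp
  next
    case 2
    then obtain \<eta> where "\<eta> \<in> Der (k + 1)" "\<theta> = DD (k + 1) \<eta>"
      using acyclic[OF t] k e(2) by auto
    then show ?thesis by (simp add: eps_DD)
  next
    case 3
    obtain c \<eta> where "\<eta> \<in> Der (2 * e + 1)" "\<theta> = fs c \<alpha> + DD (2 * e + 1) \<eta>"
      using homology_2e[OF t[unfolded 3(2)]] by blast
    then show ?thesis using eps_alpha[OF hom[unfolded 3(1)]] by (simp add: eps_add eps_DD)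
  qed
qed (simp add: Der_add[OF t(1)] eps_add)

end

section \<open>Homotopy groups and Gottlieb elements\<close>

text \<open>Makes the sign rules available for the ground field, where \<open>sign_twist\<close>
  enters the product of \<open>sphere_coh k\<close>.\<close>

lemma cdga_ground: "cdga ground_cdga"
proof
  let ?g = "cgr ground_cdga"
  interpret r: vector_space "(*) :: rat \<Rightarrow> rat \<Rightarrow> rat" by (rule vector_space_rat)
  have "is_decomp ?g x (\<lambda>p. if p = 0 then x else 0)" for x
  proof -
    have "{p. (if p = (0::int) then x else 0) \<noteq> 0} \<subseteq> {0}" by auto
    moreover have "(\<Sum>p | (if p = (0::int) then x else 0) \<noteq> 0. if p = 0 then x else 0) =
        (\<Sum>p\<in>{0}. if p = (0::int) then x else 0)"
      by (rule sum.mono_neutral_left) auto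
    ultimately show ?thesis
      unfolding is_decomp_def using finite_subset by fastforce
  qed
  moreover have "f = (\<lambda>p. if p = 0 then x else 0)" if f: "is_decomp ?g x f" for f x
  proof -
    have 0: "f p = 0" if "p \<noteq> 0" for p
    proof -
      have "f p \<in> ?g p" using f by (simp only: is_decomp_def)
      then show ?thesis using that by simp
    qed
    have "x = (\<Sum>p | f p \<noteq> 0. f p)" using f by (simp only: is_decomp_def)
    also have "\<dots> = (\<Sum>p\<in>{0}. f p)"
      by (rule sum.mono_neutral_left) (use 0 in auto)
    finally show ?thesis using 0 by auto
  qed
  ultimately have "\<exists>!f. is_decomp ?g x f" for x by (intro ex1I)
  then have "graded_space (*) ?g"
    by (simp add: graded_space_def vector_space_rat r.subspace_def)
  moreover have "x * y \<in> ?g (p + q) \<and> x * y = koszul p q * (y * x)" if "x \<in> ?g p" "y \<in> ?g q" for x y p q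
    using that by (cases "p = 0"; cases "q = 0") (simp_all add: koszul_def)
  ultimately show "is_cdga ground_cdga"
    unfolding is_cdga_def ground_cdga_simps(1,2,3,5)
    by (intro conjI allI ballI)
      (simp_all add: Vector_Spaces.linear_iff vector_space_rat distrib_left distrib_right)
qed

lemma sign_twist_ground [simp]: "sign_twist ground_cdga k x = x"
  using cdga.sign_twist_gr[OF cdga_ground, of x 0 k] by (simp add: koszul_def)

lemma sphere_tensor_simps [simp]:
  "csmul (sphere_tensor k A) c (a, b) = (csmul A c a, csmul A c b)"
  "cmult (sphere_tensor k A) (a, b) (a', b') =
    (cmult A a a', cmult A b a' + cmult A (sign_twist A (int k) a) b')"
  "cone (sphere_tensor k A) = (cone A, 0)"
  "cgr (sphere_tensor k A) p = cgr A p \<times> cgr A (p - int k)"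
  "cdiff (sphere_tensor k A) (a, b) = (cdiff A a, csmul A (koszul 1 (int k)) (cdiff A b))"
  by (simp_all add: sphere_tensor_def)

lemma vector_space_sphere_tensor:
  assumes "vector_space (csmul A)" shows "vector_space (csmul (sphere_tensor k A))"
proof -
  interpret vector_space "csmul A" by fact
  show ?thesis
    by unfold_locales
      (auto simp: scale_right_distrib scale_left_distrib split: prod.splits)
qed

context sullivan
begin

text \<open>With the augmentation as first component, a morphism into the cohomology of the sphere
  amounts to a derivation g over eps, concentrated in degree k and zero on boundaries.\<close>

lemma sphere_coh_mor:
  assumes g: "\<And>x y. g (x + y) = g x + g y" "\<And>r x. g (sm r x) = r * g x"
    "\<And>p x. x \<in> gr p \<Longrightarrow> p \<noteq> int k \<Longrightarrow> g x = 0"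
    "\<And>x y. g (x \<odot> y) = g x * eps y + eps x * g y" "\<And>x. g (d x) = 0"
  shows "(\<lambda>x. (eps x, g x)) \<in> rat_homotopy_group A k"
proof -
  have "g one = 0" using g(4)[of one one] by simp
  moreover have "vector_space (csmul (sphere_coh k))"
    unfolding sphere_coh_def by (rule vector_space_sphere_tensor) (simp add: vector_space_rat)
  ultimately show ?thesis
    unfolding rat_homotopy_group_def cdga_mor_def
    by (auto simp: Vector_Spaces.linear_iff vs g sphere_coh_def eps_add eps_mul eps_gr)
qed

lemma const_class: "const_class A = (\<lambda>x. (eps x, 0))" "const_class A \<in> rat_homotopy_group A k"
proof -
  show 1: "const_class A = (\<lambda>x. (eps x, 0))" by (simp only: const_class_def aug_eps)
  show "const_class A \<in> rat_homotopy_group A k"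
    unfolding 1 by (rule sphere_coh_mor) simp_all
qed

lemma const_class_gottlieb: "const_class A \<in> rat_gottlieb A k"
  unfolding rat_gottlieb_def
proof (rule CollectI, rule conjI[OF const_class(2)], rule exI[of _ "\<lambda>x. (x, 0)"], intro conjI allI)
  show "cdga_mor A (sphere_tensor k A) (\<lambda>x. (x, 0))"
    unfolding cdga_mor_def
    by (simp add: Vector_Spaces.linear_iff vs vector_space_sphere_tensor[OF vs])
  show "map_prod (aug A) (aug A) (x, 0) = const_class A x" for x
    by (simp add: const_class(1) aug_eps)
qed simp

text \<open>Writing F x = (x, \<theta> x), multiplicativity of F is the Leibniz rule for \<theta>,
  and compatibility with the differentials is D \<theta> = 0.\<close>

lemma gottlieb_derivation:
  assumes "\<beta> \<in> rat_gottlieb A k"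
  shows "\<exists>\<theta>\<in>Der (int k). DD (int k) \<theta> = 0 \<and> \<beta> = (\<lambda>x. (eps x, eps (\<theta> x)))"
proof -
  obtain F where F: "cdga_mor A (sphere_tensor k A) F" and 1: "\<And>x. fst (F x) = x"
    and \<beta>: "\<And>x. map_prod (aug A) (aug A) (F x) = \<beta> x"
    using assms unfolding rat_gottlieb_def by (elim CollectE conjE exE) (rule that; (assumption | erule spec))
  note mor = F[unfolded cdga_mor_def]
  define \<theta> where "\<theta> x = snd (F x)" for x
  have F': "F x = (x, \<theta> x)" for x using 1[of x] by (simp add: \<theta>_def prod_eq_iff)
  have t: "\<theta> \<in> Der (int k)"
  proof (rule DerI)
    have "F (x + y) = F x + F y" "F (sm r x) = csmul (sphere_tensor k A) r (F x)" for x y r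
      using mor[THEN conjunct1] by (simp_all only: Vector_Spaces.linear_iff)
    then show "\<theta> (x + y) = \<theta> x + \<theta> y" "\<theta> (sm r x) = sm r (\<theta> x)" for x y r
      by (simp_all add: F')
    have "F x \<in> cgr (sphere_tensor k A) p" if "x \<in> gr p" for p x
      using mor[THEN conjunct2, THEN conjunct1] that by blast
    then show "\<theta> x \<in> gr (p - int k)" if "x \<in> gr p" for p x
      using that by (simp add: F')
    have "F (x \<odot> y) = cmult (sphere_tensor k A) (F x) (F y)" for x y
      using mor[THEN conjunct2, THEN conjunct2, THEN conjunct1] by blast
    then show "\<theta> (x \<odot> y) = \<theta> x \<odot> y + sm (koszul (int k) p) (x \<odot> \<theta> y)" if "x \<in> gr p" for p x y
      using that by (simp add: F' sign_twist_gr)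
  qed
  have "F (d x) = cdiff (sphere_tensor k A) (F x)" for x
    using mor by (elim conjE) (rule spec)
  then have "DD (int k) \<theta> = 0"
    by (simp add: fun_eq_iff F' DD_apply)
  then show ?thesis
    using t \<beta> by (intro bexI[of _ \<theta>]) (auto simp: F' aug_eps fun_eq_iff)
qed

lemma ex_functional:
  assumes "v \<noteq> 0"
  shows "\<exists>\<psi>. (\<forall>x y. \<psi> (x + y) = \<psi> x + \<psi> y) \<and> (\<forall>r x. \<psi> (sm r x) = r * \<psi> x) \<and> \<psi> v = (1::rat)"
  using ex_separating_functional[OF vs vs.subspace_single_0, of v] assms
  by (auto simp: Vector_Spaces.linear_iff)

text \<open>The class dual to v. The expression \<open>del ?F\<close> extends a functional on
  generators by zero to constants and decomposables; it is a derivation over eps and kills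
  boundaries because d is decomposable.\<close>

lemma nonzero_rat_homotopy:
  assumes v: "v \<in> V p" "v \<noteq> 0"
  shows "rat_homotopy_group A (nat p) \<noteq> {const_class A}"
proof -
  obtain \<psi> where \<psi>: "\<And>x y. \<psi> (x + y) = \<psi> x + \<psi> y" "\<And>r x. \<psi> (sm r x) = r * \<psi> x" "\<psi> v = (1::rat)"
    using ex_functional[OF v(2)] by blast
  let ?F = "\<lambda>(\<epsilon>::bool) c v. eps c * \<psi> v"
  have b: "bil (*) ?F" by (simp add: bil_def eps_add \<psi> algebra_simps)
  note add = del_arg_add[OF vector_space_rat b] and scale = del_arg_scale[OF vector_space_rat b]
  have mul: "del ?F (x \<odot> y) = eps x * del ?F y + eps y * del ?F x" for x y
  proof -
    have "(\<lambda>\<epsilon> c v. eps (x \<odot> c) * \<psi> v) = (\<lambda>\<epsilon> c v. eps x * ?F \<epsilon> c v)"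
      "(\<lambda>\<epsilon> c v. eps (c \<odot> tw \<epsilon> y) * \<psi> v) = (\<lambda>\<epsilon> c v. eps y * ?F \<epsilon> c v)"
      by (simp_all add: fun_eq_iff eps_mul)
    then show ?thesis by (simp only: del_mul[OF vector_space_rat b] del_scale)
  qed
  \<comment> \<open>The functional \<psi> is prescribed only at v, so the result is cut down to
    degree p.\<close>
  define g where "g x = del ?F (hcomp gr x p)" for x
  have p: "int (nat p) = p" "p \<noteq> 0" using V_ge2[OF v] by simp_all
  have g_add: "g (x + y) = g x + g y" for x y by (simp add: g_def hcomp_add add)
  have g_gr: "g x = (if q = p then del ?F x else 0)" if "x \<in> gr q" for x q
    using scale[of 0 0] by (simp add: g_def hcomp_hom[OF that])
  have "(\<lambda>x. (eps x, g x)) \<in> rat_homotopy_group A (nat p)"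
  proof (rule sphere_coh_mor)
    show "g (x + y) = g x + g y" for x y by (rule g_add)
    show "g (sm r x) = r * g x" for r x by (simp add: g_def hcomp_scale scale)
    show "g x = 0" if "x \<in> gr q" "q \<noteq> int (nat p)" for q x using g_gr[OF that(1)] that(2) p by simp
    show "g (x \<odot> y) = g x * eps y + eps x * g y" for x y
    proof (induct x rule: hom_induct)
      case (hom i x)
      note x = this
      show ?case
      proof (induct y rule: hom_induct)
        case (hom j y)
        show ?case
          using eps_gr[OF x] eps_gr[OF hom]
          by (auto simp: g_gr[OF x] g_gr[OF hom] g_gr[OF mul_gr[OF x hom]] mul)
      qed (simp add: mul_add_right g_add eps_add algebra_simps)
    qed (simp add: mul_add_left g_add eps_add algebra_simps)
    show "g (d x) = 0" for x
    proof (induct x rule: hom_induct)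
      case (hom q x)
      have "del ?F (d x) = 0"
        by (rule del_Fil[OF vector_space_rat b d_Fil_2]) (simp add: eps_Fil)
      then show ?case by (simp add: g_gr[OF d_gr[OF hom]])
    qed (simp add: d_add g_add)
  qed
  moreover have "g v = 1"
    using del_V[OF vector_space_rat b v(1)] by (simp add: g_gr[OF V_gr[OF v(1)]] \<psi>)
  ultimately show ?thesis by (auto simp: const_class fun_eq_iff)
qed

lemma pi_finite_generators:
  assumes "pi_finite A" shows "finite {p. V p \<noteq> {0}}"
proof -
  have "{p. V p \<noteq> {0}} \<subseteq> int ` {k. 1 \<le> k \<and> rat_homotopy_group A k \<noteq> {const_class A}}"
  proof
    fix p assume "p \<in> {p. V p \<noteq> {0}}"
    then obtain v where v: "v \<in> V p" "v \<noteq> 0" using V_0[of p] by blast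
    then show "p \<in> int ` {k. 1 \<le> k \<and> rat_homotopy_group A k \<noteq> {const_class A}}"
      using V_ge2[OF v] nonzero_rat_homotopy[OF v] by (intro image_eqI[of _ _ "nat p"]) auto
  qed
  then show ?thesis using assms unfolding pi_finite_def by (rule finite_subset[OF _ finite_imageI])
qed

text \<open>A functional on the top generators extends to a derivation that vanishes on all other
  generators. Its values on the elements d u have degree at most 1, and the only possible scalars
  are excluded by decomposability.\<close>

lemma ex_top_derivation:
  assumes v: "v \<in> V N" "v \<noteq> 0" and top: "\<And>p. N < p \<Longrightarrow> V p = {0}"
  shows "\<exists>\<theta>\<in>Der N. DD N \<theta> = 0 \<and> \<theta> v = one"
proof -
  obtain \<psi>' where \<psi>': "\<And>x y. \<psi>' (x + y) = \<psi>' x + \<psi>' y" "\<And>r x. \<psi>' (sm r x) = r * \<psi>' x" "\<psi>' v = (1::rat)"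
    using ex_functional[OF v(2)] by blast
  define \<psi> where "\<psi> x = \<psi>' (hcomp gr x N)" for x
  have \<psi>: "\<psi> (x + y) = \<psi> x + \<psi> y" "\<psi> (sm r x) = r * \<psi> x" for x y r
    by (simp_all add: \<psi>_def hcomp_add hcomp_scale \<psi>')
  have \<psi>_v: "\<psi> v = 1" by (simp add: \<psi>_def hcomp_hom[OF V_gr[OF v(1)]] \<psi>'(3))
  have \<psi>_V: "\<psi> x = 0" if "x \<in> V p" "p \<noteq> N" for x p
    using \<psi>'(2)[of 0 0] that by (simp add: \<psi>_def hcomp_hom[OF V_gr])
  \<comment> \<open>The universal derivation acts from the right; twisting the coefficient by the
    parity of N turns it into a left derivation of degree N.\<close>
  let ?F = "\<lambda>(\<epsilon>::bool) c v. sm (\<psi> v) (tw (odd N) c)"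
  have b: "bil sm ?F"
    by (simp add: bil_def \<psi> tau_add vs.scale_left_distrib vs.scale_right_distrib mult.commute)
  define \<theta> where "\<theta> = del ?F"
  have add: "\<theta> (x + y) = \<theta> x + \<theta> y" and scale: "\<theta> (sm r x) = sm r (\<theta> x)" for x y r
    by (simp_all add: \<theta>_def del_arg_add[OF vs b] del_arg_scale[OF vs b])
  have V: "\<theta> x = sm (\<psi> x) one" if "x \<in> V p" for x p
    using del_V[OF vs b that] by (simp add: \<theta>_def)
  have mul: "\<theta> (x \<odot> y) = \<theta> x \<odot> y + tw (odd N) x \<odot> \<theta> y" for x y
  proof -
    have left: "a \<odot> del ?F c = del (\<lambda>\<epsilon> c v. a \<odot> ?F \<epsilon> c v) c" for a c
      using del_commute[of "\<lambda>f. a \<odot> f one" "\<lambda>\<epsilon> c v y. ?F \<epsilon> c v" c] by (simp add: mul_add_right)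
    have right: "del ?F c \<odot> a = del (\<lambda>\<epsilon> c v. ?F \<epsilon> c v \<odot> a) c" for a c
      using del_commute[of "\<lambda>f. f one \<odot> a" "\<lambda>\<epsilon> c v y. ?F \<epsilon> c v" c] by (simp add: mul_add_left)
    have "del (\<lambda>\<epsilon> c v. ?F \<epsilon> (x \<odot> c) v) y = tw (odd N) x \<odot> \<theta> y"
      unfolding \<theta>_def left by (intro del_cong) (simp add: tau_mul)
    moreover have "del (\<lambda>\<epsilon> c v. ?F \<epsilon> (c \<odot> tw \<epsilon> y) v) x = \<theta> x \<odot> y"
      unfolding \<theta>_def right
    proof (rule del_cong)
      fix \<epsilon> c u p assume u: "u \<in> V p" "odd p = \<epsilon>"
      \<comment> \<open>Only generators of degree N contribute, so \<epsilon> is the parity of N and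
        the two twists of y cancel.\<close>
      show "?F \<epsilon> (c \<odot> tw \<epsilon> y) u = ?F \<epsilon> c u \<odot> y"
        using \<psi>_V[OF u(1)] u(2) by (cases "p = N") (auto simp: tau_mul)
    qed
    ultimately show ?thesis by (simp add: \<theta>_def del_mul[OF vs b])
  qed
  have one: "\<theta> one = 0" using mul[of one one] by (simp split: if_splits)
  have V_deg: "\<theta> x \<in> gr (p - N)" if "x \<in> V p" for x p
    using V[OF that] \<psi>_V[OF that] one_gr by (cases "p = N") (simp_all add: gr_scale)
  have word: "\<exists>q. val w \<in> gr q \<and> \<theta> (val w) \<in> gr (q - N)" if "w \<in> LW" for w
    using that
  proof (induct w)
    case Nil
    then show ?case using one_gr one by auto
  next
    case (Cons x w)
    then obtain p q where p: "x \<in> V p" and q: "val w \<in> gr q" "\<theta> (val w) \<in> gr (q - N)"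
      by (auto simp: LW_Cons)
    have "tw (odd N) x \<odot> \<theta> (val w) \<in> gr (p + (q - N))"
      using V_gr[OF p] by (intro mul_gr q) (auto intro: tau_gr_closed)
    moreover have "\<theta> x \<odot> val w \<in> gr (p - N + q)" by (rule mul_gr[OF V_deg[OF p] q(1)])
    ultimately have "\<theta> (val (x # w)) \<in> gr (p + q - N)"
      by (simp add: mul gr_add algebra_simps)
    then show ?case using mul_gr[OF V_gr[OF p] q(1)] by (intro exI[of _ "p + q"]) simp
  qed
  \<comment> \<open>Words are homogeneous and \<theta> lowers their degree by N; comparing
    components transfers this to all homogeneous elements, whose word representations may mix
    degrees.\<close>
  have hc: "hcomp gr (\<theta> x) q = \<theta> (hcomp gr x (q + N))" for x q
  proof (induct x rule: word_induct)
    case (word r w)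
    then obtain j where j: "val w \<in> gr j" "\<theta> (val w) \<in> gr (j - N)" using \<open>\<And>w. w \<in> LW \<Longrightarrow> _\<close> by blast
    then show ?case
      using scale[of 0 0] by (auto simp: scale hcomp_scale hcomp_hom[OF j(1)] hcomp_hom[OF j(2)])
  qed (simp add: add hcomp_add)
  have t: "\<theta> \<in> Der N"
  proof (rule DerI)
    show "\<theta> x \<in> gr (p - N)" if "x \<in> gr p" for p x
      using hcomp_gr[of "\<theta> x" "p - N"] by (simp add: hc hcomp_hom[OF that])
    show "\<theta> (x \<odot> y) = \<theta> x \<odot> y + sm (koszul N p) (x \<odot> \<theta> y)" if "x \<in> gr p" for p x y
      unfolding mul tw_gr[OF that] by simp
  qed (rule add scale)+
  have "DD N \<theta> = 0"
  proof (rule Der_eq_0I[OF DD_Der[OF t]])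
    fix p u assume u: "u \<in> V p"
    \<comment> \<open>For u of degree p \<le> N the element \<theta> (d u) has degree p + 1 - N
      \<le> 1, so it is zero or a scalar of augmentation zero.\<close>
    have "\<theta> (d u) = 0"
    proof (cases "u = 0")
      case True
      then show ?thesis by (simp add: Der_zero[OF t])
    next
      case False
      then have p: "p \<le> N" using u top[of p] by (cases "N < p") auto
      have g: "\<theta> (d u) \<in> gr (p + 1 - N)" by (rule Der_gr[OF t d_gr[OF V_gr[OF u]]])
      show ?thesis
      proof (cases "p + 1 - N = 0")
        case True
        then show ?thesis using gr_0_eq[of "\<theta> (d u)"] g Der_eps_Fil_2[OF t d_Fil_2[of u]] by simp
      qed (use gr_low[OF g] p in simp)
    qed
    then show "DD N \<theta> u = 0" by (simp add: DD_apply V[OF u])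
  qed
  moreover have "\<theta> v = one" by (simp add: V[OF v(1)] \<psi>_v)
  ultimately show ?thesis using t by blast
qed

end

section \<open>Vanishing of Gottlieb elements and infinitely many homotopy groups\<close>

context Baut1_even_sphere
begin

lemma gottlieb_trivial: "e < int k \<Longrightarrow> rat_gottlieb A k = {const_class A}"
proof -
  assume k: "e < int k"
  have "\<beta> = const_class A" if b: "\<beta> \<in> rat_gottlieb A k" for \<beta>
  proof -
    obtain \<theta> where "\<theta> \<in> Der (int k)" "DD (int k) \<theta> = 0" "\<beta> = (\<lambda>x. (eps x, eps (\<theta> x)))"
      using gottlieb_derivation[OF b] by blast
    then show ?thesis using eps_cycle k by (simp add: const_class)
  qed
  then show ?thesis using const_class_gottlieb by blast
qed

lemma pi_infinite: "\<not> pi_finite A"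
proof
  assume "pi_finite A"
  then have fin: "finite {p. V p \<noteq> {0}}" by (rule pi_finite_generators)
  have "\<exists>p v. v \<in> V p \<and> \<alpha> v \<noteq> 0"
  proof (rule ccontr)
    assume "\<not> ?thesis"
    then have "\<alpha> = 0" by (intro Der_eq_0I[OF alpha(2)]) blast
    moreover have "DD (2 * e + 1) 0 = 0" by (simp add: fun_eq_iff DD_apply)
    ultimately show False using alpha_not_boundary[OF Der_0] by simp
  qed
  then obtain p v where v: "v \<in> V p" "\<alpha> v \<noteq> 0" by blast
  have p: "2 * e \<le> p" using gr_neg[OF _ Der_gr[OF alpha(2) V_gr[OF v(1)]]] v(2) by force
  have "v \<noteq> 0" using v(2) Der_zero[OF alpha(2)] by auto
  then have ne: "p \<in> {p. V p \<noteq> {0}}" using v(1) by auto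
  define N where "N = Max {p. V p \<noteq> {0}}"
  have N: "V N \<noteq> {0}" "p \<le> N" "\<And>q. N < q \<Longrightarrow> V q = {0}"
    using Max_in[OF fin] Max_ge[OF fin] ne unfolding N_def by (auto simp: not_le[symmetric])
  obtain u where u: "u \<in> V N" "u \<noteq> 0" using N(1) V_0[of N] by blast
  obtain \<theta> where t: "\<theta> \<in> Der N" "DD N \<theta> = 0" "\<theta> u = one"
    using ex_top_derivation[OF u N(3)] by blast
  have "e < N" using p N(2) e(2) by linarith
  from eps_cycle[OF t(1,2) this, of u] show False by (simp add: t(3))
qed

end

lemma Baut1_even_sphere_consequences:
  fixes X :: "'a::ab_group_add cdga" and T :: "'m::ab_group_add itself"
  assumes n: "n \<ge> 1" and X: "sc_finite_type_model X V" and S: "Baut1_rat_equiv_sphere T X (2 * n)"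
  shows "\<not> pi_finite X" "k > 2 * n - 1 \<Longrightarrow> rat_gottlieb X k = {const_class X}"
proof -
  interpret sullivan X V
  proof (intro sullivan.intro sullivan_axioms.intro cdga.intro)
    show "minimal_sullivan X V" "V 1 = {0}" using X by (simp_all add: sc_finite_type_model_def)
    then show "is_cdga X" by (simp add: minimal_sullivan_def)
  qed
  obtain x \<alpha> where "Baut1_even_sphere X V (2 * int n - 1) x \<alpha>"
    using Baut1_even_sphere[OF n S] by (elim exE)
  then interpret Baut1_even_sphere X V "2 * int n - 1" x \<alpha> .
  show "\<not> pi_finite X" by (rule pi_infinite)
  show "rat_gottlieb X k = {const_class X}" if "k > 2 * n - 1"
    using that n by (intro gottlieb_trivial) linarith
qed

theorem theorem1p1:
  fixes n :: nat
  assumes "n \<ge> 1"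
  shows "(\<forall>(X :: 'a::ab_group_add cdga) V.
            sc_finite_type_model X V \<and>
            Baut1_rat_equiv_sphere TYPE('m::ab_group_add) X (2 * n) \<longrightarrow>
              \<not> pi_finite X \<and>
              (\<forall>k > 2 * n - 1. rat_gottlieb X k = {const_class X}))
       \<and> \<not> (\<exists>(Y :: 'b::ab_group_add cdga) W.
            sc_finite_type_model Y W \<and> pi_finite Y \<and>
            Baut1_rat_equiv_sphere TYPE('l::ab_group_add) Y (2 * n))"
proof (intro conjI allI impI notI)
  fix X :: "'a cdga" and V
  assume X: "sc_finite_type_model X V \<and> Baut1_rat_equiv_sphere TYPE('m) X (2 * n)"
  show False if "pi_finite X"
    using Baut1_even_sphere_consequences(1)[OF assms X[THEN conjunct1] X[THEN conjunct2]] that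
    by (rule notE)
  show "rat_gottlieb X k = {const_class X}" if "k > 2 * n - 1" for k
    by (rule Baut1_even_sphere_consequences(2)[OF assms X[THEN conjunct1] X[THEN conjunct2] that])
next
  assume "\<exists>(Y :: 'b cdga) W. sc_finite_type_model Y W \<and> pi_finite Y \<and>
      Baut1_rat_equiv_sphere TYPE('l) Y (2 * n)"
  then obtain Y :: "'b cdga" and W where Y: "sc_finite_type_model Y W" "pi_finite Y"
      "Baut1_rat_equiv_sphere TYPE('l) Y (2 * n)"
    by (elim exE conjE)
  show False
    using Baut1_even_sphere_consequences(1)[OF assms Y(1,3)] Y(2) by (rule notE)
qed

end
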